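(* Let $(X_B,V_B)$, $\mu$, $x^*$, $i^*$, $\mathcal N$, $I_n$, $F_n^{(k)}$ and the data $M,\lambda,r,l,\bar c(ef),L,S(i),d_j$ be as in the context. Let $j\in\{0,\dots,L\}$ and $d_j\le t<d_{j+1}$. Then the limit laws are the piecewise linear functions $$F^{(1)}(t)=\lim_{n\to\infty,\,n\in\mathcal N}F_n^{(1)}(t)=\sum_{ef\in\bigcup_{i=1}^{j}S(i)}\bar c(ef)\,\frac{r(\mathbf t(f))}{\lambda^2}+\frac{t}{r(i^* )}\sum_{ef\in\bigcup_{i=j+1}^{L}S(i)}\frac{r(\mathbf t(f))}{\lambda^2},$$ and, for every $k\ge 2$, $$F^{(k)}(t)=\lim_{n\to\infty,\,n\in\mathcal N}F_n^{(k)}(t)=\sum_{\substack{e_1\cdots e_{k+1}\in E(2,k+2):\ \mathbf s(e_1)=i^*,\\ e_1^{(k)}e_2^{(k)}\in\bigcup_{i=1}^{j}S(i)}}\bar c(e_1e_2)\,\frac{r(\mathbf t(e_{k+1}))}{\lambda^{k+1}}.$$ Moreover, for each $j$ the convergence is uniform in $t$ on any closed interval $I\subseteq\,]d_j,d_{j+1}[$.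
   Context: **Ordered Bratteli diagrams.** $B=(V,E,\preceq)$ has vertices $V=V_0\cup V_1\cup\cdots$ (finite disjoint levels, $V_0=\{v_0\}$) and edges $E=E_1\cup E_2\cup\cdots$ (finite disjoint levels). Each $e\in E_k$ has a source $\mathbf s(e)\in V_{k-1}$ and a terminal vertex $\mathbf t(e)\in V_k$; every vertex of $V_k$ is the terminal vertex of some edge of $E_k$ if $k\ge1$ and the source of some edge of $E_{k+1}$. $\preceq$ is a partial order on $E$ in which two edges are comparable iff they have the same terminal vertex. For $k\le l$, $E(k,l)$ is the set of paths $e_k\cdots e_l$, $e_i\in E_i$, $\mathbf t(e_i)=\mathbf s(e_{i+1})$, from $V_{k-1}$ to $V_l$. $X_B$ is the set of infinite paths $(e_1,e_2,\dots)$ starting at $v_0$, with the topology generated by the cylinder sets $[e_1\cdots e_n]$ of infinite paths beginning with $e_1\cdots e_n$. $B$ is properly ordered: there is a unique path $x_{\max}\in X_B$ all of whose edges are maximal and a unique $x_{\min}\in X_B$ all of whose edges are minimal. The Vershik map $V_B:X_B\to X_B$: $V_B(x_{\max})=x_{\min}$; for $x=(e_1,e_2,\dots)\ne x_{\max}$, let $k$ be least with $e_k$ not maximal, let $f_k$ be the successor of $e_k$, and let $V_B(x)=(f_1,\dots,f_{k-1},f_k,e_{k+1},\dots)$ where $f_1\cdots f_{k-1}$ is the path of minimal edges from $v_0$ to $\mathbf s(f_k)$. **Standing assumptions.** $(X_B,V_B)$ is a Cantor minimal system and $B$ is stationary: $V_i$ is identified with $\{1,\dots,m\}$ for all $i\ge1$,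 the $m\times m$ incidence matrix $M_{i,j}=|\{e\in E_n:\mathbf s(e)=i,\mathbf t(e)=j\}|$ is the same for all $n\ge2$, and the order on $E_n$ is the same for all $n\ge2$ (so all $E_n$, $n\ge2$, are identified with each other, preserving source, terminal vertex and order; in particular $E(n+1,n+p)$ is identified with $E(2,p+1)$ for $n\ge 1$). Moreover: all entries of $M$ are strictly positive; for every $i\in V_1$ there is a unique edge from $v_0$ to $i$; for every $n\ge2$ and every $i\in V_n$, the minimal edge of $E_n$ with terminal vertex $i$ has source $1$. **Measure.** $\lambda$ is the maximal (Perron) eigenvalue of $M$; $r=(r(i))^T$ and $l=(l(i))$ are the corresponding strictly positive right and left eigenvectors with $\sum_i r(i)=1$, $\sum_i l(i)r(i)=1$. $\mu$ is the unique $V_B$-invariant probability measure, $\mu([e_1\cdots e_n])=r(\mathbf t(e_n))/\lambda^{n-1}$ for $e_1\cdots e_n\in E(1,n)$. **Entrance times.** Fix $x^*=(x_1^*,x_2^*,\dots)\in X_B$; $I_n=[x_1^*\cdots x_n^*]$, and $[I_ne_1\cdots e_p]$ denotes $[x_1^*\cdots x_n^*e_1\cdots e_p]$. Fix $i^*\in\{1,\dots,m\}$ with $\mathbf t(x_n^* )=i^*$ for infinitely many $n$, and an infinite set $\mathcal N$ of positive integers $n$ with $\mathbf t(x_n^* )=i^*$. Put $N_n^{(0)}(x)=0$ and $N_n^{(k)}(x)=\inf\{s>N_n^{(k-1)}(x):V_B^s(x)\in I_n\}$ for $k\ge1$; $F_n^{(1)}(t)=\mu\{x\in X_B:\mu(I_n)N_n^{(1)}(x)\le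 t\}$ and, for $k\ge2$, $F_n^{(k)}(t)=\mu\{x\in X_B:\mu(I_n)(N_n^{(k)}(x)-N_n^{(k-1)}(x))\le t\}$. **The constants.** For $n\in\mathcal N$ and $ef\in E(n+1,n+2)$ with $\mathbf s(e)=i^*$, $N_n^{(1)}$ is constant on $[I_nef]$. For $i\in\{1,\dots,m\}$, $c(ef)(i)$ is the number of times the trajectory of a point $z\in[I_nef]$ passes through the cylinder of the minimal path from $v_0$ to $i\in V_n$ before returning to $I_n$, i.e. the number of $s\in\{0,\dots,N_n^{(1)}(z)-1\}$ such that $V_B^s(z)$ lies in that cylinder; it depends neither on $z\in[I_nef]$ nor on $n$ (after identifying $ef$ with an element of $E(2,3)$). Put $\bar c(ef)=\sum_{i=1}^m c(ef)(i)\,l(i)$. Let $c_1<\dots<c_L$ be the distinct values of $\bar c(ef)$ for $ef\in E(2,3)$ with $\mathbf s(e)=i^*$ (all positive), and $S(i)=\{ef\in E(2,3):\mathbf s(e)=i^*,\ \bar c(ef)=c_i\}$. Put $d_0=0$, $d_i=c_i\,r(i^* )$ for $1\le i\le L$, $d_{L+1}=\infty$. For $k\ge1$ and a path $e_1\cdots e_{k+1}\in E(n+1,n+k+1)$ with $\mathbf s(e_1)=i^*$, there is a unique $e_1^{(k)}e_2^{(k)}\in E(n+1,n+2)$ with $\mathbf s(e_1^{(k)})=i^*$ such that $V_B^{N_n^{(k-1)}(z)}(z)\in[I_ne_1^{(k)}e_2^{(k)}]$ for all $z\in[I_ne_1\cdots e_{k+1}]$; via the identifications it does not depend on $n$, so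 it is defined as an element of $E(2,3)$ for $e_1\cdots e_{k+1}\in E(2,k+2)$.
   Formalization: For k ≥ 2 the convergence F_n^(k)(t) → F^(k)(t) is asserted only for t ≠ d_1,…,d_L; at a jump t = d_j it can fail (return times may approach d_j from above). There F^(k)(d_j) is the value of the limit law's right-continuous distribution function, given by the stated formula. *)

theory Defs
  imports "HOL-Probability.Probability"
begin

text \<open>
  The disjoint unions of levels are encoded by indexing: a vertex of level \<open>n\<close> is a pair of \<open>n\<close> and
  an element of \<open>verts B n\<close>, an edge of level \<open>n \<ge> 1\<close> is a pair of \<open>n\<close> and an element of
  \<open>edges B n\<close>.  The values \<open>edges B 0\<close>, \<open>src B 0\<close>, \<open>tgt B 0\<close>, \<open>edge_ord B 0\<close> are never used.
  In \<open>edge_ord B n\<close> the pair \<open>(e, f)\<close> means that \<open>e\<close> precedes or equals \<open>f\<close>.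
\<close>

record ('v, 'e) bratteli =
  verts :: "nat \<Rightarrow> 'v set"
  edges :: "nat \<Rightarrow> 'e set"
  src :: "nat \<Rightarrow> 'e \<Rightarrow> 'v"
  tgt :: "nat \<Rightarrow> 'e \<Rightarrow> 'v"
  edge_ord :: "nat \<Rightarrow> 'e rel"

text \<open>Edges of different levels have different terminal vertices, so the partial order on the set
  of all edges is given by its restrictions to the levels.\<close>

locale ordered_bratteli =
  fixes B :: "('v, 'e) bratteli"
  assumes root: "is_singleton (verts B 0)"
    and finite_verts: "\<And>n. finite (verts B n)"
    and finite_edges: "\<And>n. n \<ge> 1 \<Longrightarrow> finite (edges B n)"
    and src_in: "\<And>n e. n \<ge> 1 \<Longrightarrow> e \<in> edges B n \<Longrightarrow> src B n e \<in> verts B (n - 1)"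
    and tgt_in: "\<And>n e. n \<ge> 1 \<Longrightarrow> e \<in> edges B n \<Longrightarrow> tgt B n e \<in> verts B n"
    and tgt_onto: "\<And>n v. n \<ge> 1 \<Longrightarrow> v \<in> verts B n \<Longrightarrow> \<exists>e\<in>edges B n. tgt B n e = v"
    and src_onto: "\<And>n v. v \<in> verts B n \<Longrightarrow> \<exists>e\<in>edges B (Suc n). src B (Suc n) e = v"
    and partial_order: "\<And>n. n \<ge> 1 \<Longrightarrow> partial_order_on (edges B n) (edge_ord B n)"
    and comparable_iff: "\<And>n e f. n \<ge> 1 \<Longrightarrow> e \<in> edges B n \<Longrightarrow> f \<in> edges B n \<Longrightarrow>
      (e, f) \<in> edge_ord B n \<or> (f, e) \<in> edge_ord B n \<longleftrightarrow> tgt B n e = tgt B n f"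

definition is_max_edge :: "('v, 'e) bratteli \<Rightarrow> nat \<Rightarrow> 'e \<Rightarrow> bool" where
  "is_max_edge B n e \<longleftrightarrow> e \<in> edges B n \<and> (\<forall>f\<in>edges B n. (e, f) \<in> edge_ord B n \<longrightarrow> f = e)"

definition is_min_edge :: "('v, 'e) bratteli \<Rightarrow> nat \<Rightarrow> 'e \<Rightarrow> bool" where
  "is_min_edge B n e \<longleftrightarrow> e \<in> edges B n \<and> (\<forall>f\<in>edges B n. (f, e) \<in> edge_ord B n \<longrightarrow> f = e)"

definition edge_succ :: "('v, 'e) bratteli \<Rightarrow> nat \<Rightarrow> 'e \<Rightarrow> 'e" where
  "edge_succ B n e = (THE f. f \<in> edges B n \<and> f \<noteq> e \<and> (e, f) \<in> edge_ord B n \<and>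
     (\<forall>g\<in>edges B n. (e, g) \<in> edge_ord B n \<and> (g, f) \<in> edge_ord B n \<longrightarrow> g = e \<or> g = f))"

text \<open>\<open>E(k, l)\<close>; entry \<open>i\<close> of the list is an edge of level \<open>k + i\<close>.\<close>

definition paths :: "('v, 'e) bratteli \<Rightarrow> nat \<Rightarrow> nat \<Rightarrow> 'e list set" where
  "paths B k l = {p. length p = Suc l - k \<and>
     (\<forall>i<length p. p ! i \<in> edges B (k + i)) \<and>
     (\<forall>i. Suc i < length p \<longrightarrow> tgt B (k + i) (p ! i) = src B (k + Suc i) (p ! Suc i))}"

text \<open>The infinite paths \<open>(x 1, x 2, \<dots>)\<close> starting at the root; since \<open>verts B 0\<close> is a singleton, the
  source of \<open>x 1\<close> needs no mention.  Membership in \<open>PiE\<close> fixes the irrelevant value \<open>x 0\<close>.\<close>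

definition path_space :: "('v, 'e) bratteli \<Rightarrow> (nat \<Rightarrow> 'e) set" where
  "path_space B = {x \<in> PiE {1..} (edges B). \<forall>n\<ge>1. tgt B n (x n) = src B (Suc n) (x (Suc n))}"

definition prefix :: "(nat \<Rightarrow> 'e) \<Rightarrow> nat \<Rightarrow> 'e list" where
  "prefix x n = map x [1..<Suc n]"

definition cylinder :: "('v, 'e) bratteli \<Rightarrow> 'e list \<Rightarrow> (nat \<Rightarrow> 'e) set" where
  "cylinder B p = {x \<in> path_space B. prefix x (length p) = p}"

definition path_topology :: "('v, 'e) bratteli \<Rightarrow> (nat \<Rightarrow> 'e) topology" where
  "path_topology B = topology_generated_by {cylinder B p | p n. n \<ge> 1 \<and> p \<in> paths B 1 n}"

locale properly_ordered_bratteli = ordered_bratteli B for B :: "('v, 'e) bratteli" +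
  assumes ex1_max: "\<exists>!x. x \<in> path_space B \<and> (\<forall>n\<ge>1. is_max_edge B n (x n))"
    and ex1_min: "\<exists>!x. x \<in> path_space B \<and> (\<forall>n\<ge>1. is_min_edge B n (x n))"

definition max_path :: "('v, 'e) bratteli \<Rightarrow> nat \<Rightarrow> 'e" where
  "max_path B = (THE x. x \<in> path_space B \<and> (\<forall>n\<ge>1. is_max_edge B n (x n)))"

definition min_path :: "('v, 'e) bratteli \<Rightarrow> nat \<Rightarrow> 'e" where
  "min_path B = (THE x. x \<in> path_space B \<and> (\<forall>n\<ge>1. is_min_edge B n (x n)))"

text \<open>Requiring the image \<open>y\<close> to be a path makes its edges of level below \<open>k\<close> the minimal path from
  the root to the source of the successor edge.\<close>

definition vershik :: "('v, 'e) bratteli \<Rightarrow> (nat \<Rightarrow> 'e) \<Rightarrow> (nat \<Rightarrow> 'e)" where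
  "vershik B x =
    (if x = max_path B then min_path B
     else let k = (LEAST k. k \<ge> 1 \<and> \<not> is_max_edge B k (x k)) in
       THE y. y \<in> path_space B \<and> (\<forall>n\<in>{1..<k}. is_min_edge B n (y n)) \<and>
         y k = edge_succ B k (x k) \<and> (\<forall>n>k. y n = x n))"

definition minimal_system :: "'a topology \<Rightarrow> ('a \<Rightarrow> 'a) \<Rightarrow> bool" where
  "minimal_system X T \<longleftrightarrow> homeomorphic_map X X T \<and>
     (\<forall>C. closedin X C \<and> T ` C = C \<longrightarrow> C = {} \<or> C = topspace X)"

definition cantor_minimal_system :: "'a topology \<Rightarrow> ('a \<Rightarrow> 'a) \<Rightarrow> bool" where
  "cantor_minimal_system X T \<longleftrightarrow> minimal_system X T \<and>
     X homeomorphic_space product_topology (\<lambda>_::nat. discrete_topology (UNIV :: bool set)) UNIV"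

definition incidence :: "('v, 'e) bratteli \<Rightarrow> nat \<Rightarrow> 'v \<Rightarrow> 'v \<Rightarrow> nat" where
  "incidence B n i j = card {e \<in> edges B n. src B n e = i \<and> tgt B n e = j}"

text \<open>A stationary diagram with the identifications of its levels carried out: all levels
  \<open>verts B n\<close>, \<open>n \<ge> 1\<close>, are \<open>{1..m}\<close>, and all levels of edges from the second on are equal, together
  with source, terminal vertex and order.  Hence \<open>paths B (n + 1) (n + p) = paths B 2 (p + 1)\<close>
  for \<open>n \<ge> 1\<close>.\<close>

locale stationary_bratteli = properly_ordered_bratteli B for B :: "(nat, 'e) bratteli" +
  fixes m :: nat
  assumes verts_eq: "\<And>n. n \<ge> 1 \<Longrightarrow> verts B n = {1..m}"
    and edges_eq: "\<And>n. n \<ge> 2 \<Longrightarrow> edges B n = edges B 2"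
    and src_eq: "\<And>n e. n \<ge> 2 \<Longrightarrow> e \<in> edges B 2 \<Longrightarrow> src B n e = src B 2 e"
    and tgt_eq: "\<And>n e. n \<ge> 2 \<Longrightarrow> e \<in> edges B 2 \<Longrightarrow> tgt B n e = tgt B 2 e"
    and edge_ord_eq: "\<And>n. n \<ge> 2 \<Longrightarrow> edge_ord B n = edge_ord B 2"
    and incidence_pos: "\<And>i j. i \<in> {1..m} \<Longrightarrow> j \<in> {1..m} \<Longrightarrow> incidence B 2 i j > 0"
    and first_edges: "\<And>i. i \<in> {1..m} \<Longrightarrow> \<exists>!e. e \<in> edges B 1 \<and> tgt B 1 e = i"
    and min_edge_src: "\<And>n e. n \<ge> 2 \<Longrightarrow> is_min_edge B n e \<Longrightarrow> src B n e = 1"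
    and cantor_minimal: "cantor_minimal_system (path_topology B) (vershik B)"

text \<open>\<open>lam\<close> is the eigenvalue of largest modulus among the complex eigenvalues of \<open>M\<close>.\<close>

definition perron_data ::
    "nat \<Rightarrow> (nat \<Rightarrow> nat \<Rightarrow> nat) \<Rightarrow> real \<Rightarrow> (nat \<Rightarrow> real) \<Rightarrow> (nat \<Rightarrow> real) \<Rightarrow> bool" where
  "perron_data m M lam r l \<longleftrightarrow>
     (\<forall>(\<kappa>::complex) v. (\<exists>i\<in>{1..m}. v i \<noteq> 0) \<and>
        (\<forall>i\<in>{1..m}. (\<Sum>j=1..m. of_nat (M i j) * v j) = \<kappa> * v i) \<longrightarrow> cmod \<kappa> \<le> lam) \<and>
     (\<forall>i\<in>{1..m}. r i > 0 \<and> (\<Sum>j=1..m. real (M i j) * r j) = lam * r i) \<and>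
     (\<forall>j\<in>{1..m}. l j > 0 \<and> (\<Sum>i=1..m. l i * real (M i j)) = lam * l j) \<and>
     (\<Sum>i=1..m. r i) = 1 \<and> (\<Sum>i=1..m. l i * r i) = 1"

definition invariant_prob :: "'a topology \<Rightarrow> ('a \<Rightarrow> 'a) \<Rightarrow> 'a measure \<Rightarrow> bool" where
  "invariant_prob X T \<mu> \<longleftrightarrow> prob_space \<mu> \<and> space \<mu> = topspace X \<and>
     sets \<mu> = sigma_sets (topspace X) {U. openin X U} \<and>
     T \<in> measurable \<mu> \<mu> \<and> distr \<mu> \<mu> T = \<mu>"

text \<open>The infimum is taken in \<open>nat\<close>; by minimality the set is never empty in the application.\<close>

primrec entrance_time :: "('a \<Rightarrow> 'a) \<Rightarrow> 'a set \<Rightarrow> nat \<Rightarrow> 'a \<Rightarrow> nat" where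
  "entrance_time T U 0 x = 0"
| "entrance_time T U (Suc k) x = Inf {s. s > entrance_time T U k x \<and> (T ^^ s) x \<in> U}"

definition entrance_cdf ::
    "('a \<Rightarrow> 'a) \<Rightarrow> 'a measure \<Rightarrow> 'a set \<Rightarrow> nat \<Rightarrow> real \<Rightarrow> real" where
  "entrance_cdf T \<mu> U k t = measure \<mu> {x \<in> space \<mu>.
     measure \<mu> U * (real (entrance_time T U k x) - real (entrance_time T U (k - 1) x)) \<le> t}"

text \<open>For \<open>p \<in> paths B 2 (k + 1)\<close>, a path in the identified levels \<open>n + 1, \<dots>, n + k\<close>,
  \<open>cyl_at B xs n p\<close> is the cylinder \<open>[I\<^sub>n p]\<close>; in particular \<open>cyl_at B xs n []\<close> is \<open>I\<^sub>n\<close>.\<close>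

definition cyl_at :: "('v, 'e) bratteli \<Rightarrow> (nat \<Rightarrow> 'e) \<Rightarrow> nat \<Rightarrow> 'e list \<Rightarrow> (nat \<Rightarrow> 'e) set" where
  "cyl_at B xs n p = cylinder B (prefix xs n @ p)"

definition min_path_to :: "('v, 'e) bratteli \<Rightarrow> nat \<Rightarrow> 'v \<Rightarrow> 'e list" where
  "min_path_to B n i = (THE p. p \<in> paths B 1 n \<and>
     (\<forall>a<length p. is_min_edge B (Suc a) (p ! a)) \<and> tgt B n (last p) = i)"

text \<open>The next two definite descriptions express that the described object depends neither on \<open>n\<close>
  nor on the point of the cylinder.\<close>

definition visit_count ::
    "('v, 'e) bratteli \<Rightarrow> nat set \<Rightarrow> (nat \<Rightarrow> 'e) \<Rightarrow> 'e list \<Rightarrow> 'v \<Rightarrow> nat" where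
  "visit_count B N xs ef i = (THE c. \<forall>n\<in>N. \<forall>z\<in>cyl_at B xs n ef.
     c = card {s. s < entrance_time (vershik B) (cyl_at B xs n []) 1 z \<and>
                  (vershik B ^^ s) z \<in> cylinder B (min_path_to B n i)})"

definition return_edges ::
    "('v, 'e) bratteli \<Rightarrow> nat set \<Rightarrow> (nat \<Rightarrow> 'e) \<Rightarrow> 'v \<Rightarrow> nat \<Rightarrow> 'e list \<Rightarrow> 'e list" where
  "return_edges B N xs istar k p = (THE q. q \<in> paths B 2 3 \<and> src B 2 (hd q) = istar \<and>
     (\<forall>n\<in>N. \<forall>z\<in>cyl_at B xs n p.
        (vershik B ^^ entrance_time (vershik B) (cyl_at B xs n []) (k - 1) z) z \<in> cyl_at B xs n q))"

definition weighted_count ::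
    "(nat, 'e) bratteli \<Rightarrow> nat \<Rightarrow> (nat \<Rightarrow> real) \<Rightarrow> nat set \<Rightarrow> (nat \<Rightarrow> 'e) \<Rightarrow> 'e list \<Rightarrow> real" where
  "weighted_count B m l N xs ef = (\<Sum>i=1..m. real (visit_count B N xs ef i) * l i)"

definition edge_pairs :: "('v, 'e) bratteli \<Rightarrow> 'v \<Rightarrow> 'e list set" where
  "edge_pairs B istar = {ef \<in> paths B 2 3. src B 2 (hd ef) = istar}"

text \<open>The \<open>i\<close>-th smallest element of a finite set of reals, counted from \<open>1\<close>.\<close>

definition nth_value :: "real set \<Rightarrow> nat \<Rightarrow> real" where
  "nth_value A i = sorted_list_of_set A ! (i - 1)"

definition breakpoint :: "nat \<Rightarrow> (nat \<Rightarrow> real) \<Rightarrow> real \<Rightarrow> nat \<Rightarrow> ereal" where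
  "breakpoint L c rho i = (if i = 0 then 0 else if i \<le> L then ereal (c i * rho) else \<infinity>)"

text \<open>For \<open>k \<ge> 2\<close> the limits of the functions \<open>entrance_cdf\<close> in question are step functions.  As usual for
  convergence in law, the functions need not converge to the (right-continuous) limit at its jumps
  \<open>breakpoint L c rho j\<close>, \<open>1 \<le> j \<le> L\<close>: normalised return times may approach a jump from above.\<close>

end

theory Submission
  imports Defs
begin

text \<open>
  Why the theorem holds.  Fix a level \<open>n \<ge> 1\<close>.  A path \<open>x\<close> is determined by three data: its vertex \<open>v\<close> of
  level \<open>n\<close>, the rank \<open>a\<close> of its first \<open>n\<close> edges among the \<open>h\<^sub>n v\<close> paths from the root to \<open>v\<close>
  (\<open>address_eq_imp_agree\<close>), and its edges beyond level \<open>n\<close>.  As all levels of edges from the second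
  on are equal, the edges beyond level \<open>n\<close>, preceded by the only edge from the root to \<open>v\<close>, form a path
  \<open>y\<close> of the same diagram, \<open>shift_path B n x\<close>.  The Vershik map raises \<open>a\<close> by one while
  \<open>a + 1 < h\<^sub>n v\<close>; at the top of the tower it sets \<open>a\<close> to \<open>0\<close> and applies itself to \<open>y\<close>
  (\<open>tower_step\<close>).  So the system is, for every \<open>n\<close>, the tower over itself whose height over \<open>y\<close> is \<open>h\<^sub>n\<close>
  of the first vertex of \<open>y\<close>.

  The cylinder \<open>I\<^sub>n\<close>, \<open>n \<in> N\<close>, is one floor of the towers over the set \<open>J\<close> of the paths whose first vertex
  is \<open>istar\<close>.  Hence a return of \<open>x\<close> to \<open>I\<^sub>n\<close> is a return of \<open>y\<close> to \<open>J\<close>, and the return time of \<open>x\<close> is the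
  sum of the heights of the towers that are passed on the way (\<open>return_to_U\<close>).  Sorted by vertices, this
  is the sum of the \<open>h\<^sub>n i\<close>, each taken as often as the orbit of \<open>y\<close> sees the vertex \<open>i\<close>, and these
  multiplicities are the visit counts.  Nothing here but the heights depends on \<open>n\<close>.

  The next return of \<open>y\<close> to \<open>J\<close> needs few edges of \<open>y\<close>.  Every tower of level \<open>2\<close> contains \<open>istar\<close> because
  the incidence matrix is positive, so before that return the orbit crosses the top of a tower of level
  \<open>q \<ge> 2\<close> at most once; and the vertex behind the crossing is read off from the edge of level
  \<open>q + 1\<close>, because minimal edges start at the vertex \<open>1\<close>.  So the edges up to level \<open>q + 1\<close> determine
  the return time and the edges up to level \<open>q\<close> of the point of return (\<open>entrance_agree\<close>).  This
  makes the visit counts functions of two edges and \<open>return_edges\<close> a function of \<open>k + 1\<close> edges.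

  For the laws let \<open>G s\<close> be the measure of the points that enter \<open>I\<^sub>n\<close> first at time \<open>s\<close> and do so in a
  given \<open>W \<subseteq> I\<^sub>n\<close>.  By invariance \<open>G s - G (s + 1)\<close> is the measure of the points of \<open>I\<^sub>n\<close> itself that do so.
  Summation shows that the entrance point lies in \<open>W\<close> with probability \<open>\<Sum> return time \<times> measure\<close> over
  the cylinders in \<open>I\<^sub>n\<close> whose return point is in \<open>W\<close>, and that truncating the entrance time at \<open>K\<close>
  truncates the return times at \<open>K\<close> (\<open>entrance_law\<close>).  This gives closed formulas for the distribution
  functions at every level in \<open>N\<close> (\<open>entrance_cdf_1\<close>, \<open>entrance_cdf_ge2\<close>).

  In these formulas only the return times divided by \<open>lam ^ (n - 1)\<close> vary with \<open>n\<close>, and they tend to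
  \<open>cbar\<close>, since \<open>h\<^sub>n i / lam ^ (n - 1)\<close> tends to \<open>l i\<close> (\<open>perron_asymptotics\<close>).  For \<open>k = 1\<close> the limit is a sum
  of terms \<open>min (cbar ef) (t / r istar)\<close>, which are constant or linear according to which side of a
  break point \<open>t\<close> lies on; the truncation to an integer disappears because \<open>lam > 1\<close>.  For \<open>k \<ge> 2\<close> the
  formula sums over the paths whose \<open>k\<close>-th return time is at most \<open>t\<close> after normalisation, and away from
  the break points this condition has its limiting truth value for all large \<open>n\<close>.  Finiteness of the sums
  makes the convergence uniform.
\<close>

section \<open>Edges with a common terminal vertex\<close>

definition below :: "('v, 'e) bratteli \<Rightarrow> nat \<Rightarrow> 'e \<Rightarrow> 'e set" where
  "below B n e = {f \<in> edges B n. (f, e) \<in> edge_ord B n \<and> f \<noteq> e}"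

definition into :: "('v, 'e) bratteli \<Rightarrow> nat \<Rightarrow> 'v \<Rightarrow> 'e set" where
  "into B n v = {e \<in> edges B n. tgt B n e = v}"

context ordered_bratteli
begin

lemma edge_ord_antisym: "n \<ge> 1 \<Longrightarrow> (e, f) \<in> edge_ord B n \<Longrightarrow> (f, e) \<in> edge_ord B n \<Longrightarrow> e = f"
  using partial_order[of n] by (auto simp: partial_order_on_def antisym_def)

lemma edge_ord_trans:
  "n \<ge> 1 \<Longrightarrow> (e, f) \<in> edge_ord B n \<Longrightarrow> (f, g) \<in> edge_ord B n \<Longrightarrow> (e, g) \<in> edge_ord B n"
  using partial_order[of n] by (auto simp: partial_order_on_def preorder_on_def elim: transE)

lemma finite_below [simp]: "n \<ge> 1 \<Longrightarrow> finite (below B n e)"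
  unfolding below_def using finite_edges by auto

lemma finite_into [simp]: "n \<ge> 1 \<Longrightarrow> finite (into B n v)"
  unfolding into_def using finite_edges by auto

lemma self_notin_below [simp]: "e \<notin> below B n e"
  by (simp add: below_def)

lemma below_edge: "f \<in> below B n e \<Longrightarrow> f \<in> edges B n"
  by (simp add: below_def)

lemma below_tgt: "n \<ge> 1 \<Longrightarrow> e \<in> edges B n \<Longrightarrow> f \<in> below B n e \<Longrightarrow> tgt B n f = tgt B n e"
  using comparable_iff[of n f e] by (auto simp: below_def)

lemma below_linear:
  assumes "n \<ge> 1" "e \<in> edges B n" "f \<in> edges B n" "tgt B n e = tgt B n f" "e \<noteq> f"
  shows "e \<in> below B n f \<or> f \<in> below B n e"
  using comparable_iff[of n e f] assms by (auto simp: below_def)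

lemma below_trans:
  assumes "n \<ge> 1" "f \<in> below B n e" "g \<in> below B n f"
  shows "g \<in> below B n e"
  using assms edge_ord_trans[of n g f e] edge_ord_antisym[of n f g] by (auto simp: below_def)

lemma insert_below_subset_below: "n \<ge> 1 \<Longrightarrow> f \<in> below B n e \<Longrightarrow> insert f (below B n f) \<subseteq> below B n e"
  using below_trans by blast

lemma insert_below_subset_into:
  "n \<ge> 1 \<Longrightarrow> e \<in> edges B n \<Longrightarrow> insert e (below B n e) \<subseteq> into B n (tgt B n e)"
  using below_tgt below_edge by (fastforce simp: into_def)

lemma is_min_edge_iff: "is_min_edge B n e \<longleftrightarrow> e \<in> edges B n \<and> below B n e = {}"
  by (auto simp: is_min_edge_def below_def)

text \<open>
  In this form maximality says that the sums of tower heights over the predecessors of \<open>e\<close>, which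
  define addresses, have reached all edges into the vertex but \<open>e\<close> itself.
\<close>

lemma is_max_edge_iff:
  assumes "n \<ge> 1"
  shows "is_max_edge B n e \<longleftrightarrow> e \<in> edges B n \<and> insert e (below B n e) = into B n (tgt B n e)"
proof (cases "e \<in> edges B n")
  case True
  have "is_max_edge B n e \<longleftrightarrow> (\<forall>f. e \<notin> below B n f \<or> f \<notin> edges B n)"
    using True by (auto simp: is_max_edge_def below_def)
  also have "\<dots> \<longleftrightarrow> into B n (tgt B n e) \<subseteq> insert e (below B n e)"
  proof
    assume "\<forall>f. e \<notin> below B n f \<or> f \<notin> edges B n"
    then show "into B n (tgt B n e) \<subseteq> insert e (below B n e)"
      using below_linear[OF assms _ True] by (auto simp: into_def)
  next
    assume *: "into B n (tgt B n e) \<subseteq> insert e (below B n e)"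
    show "\<forall>f. e \<notin> below B n f \<or> f \<notin> edges B n"
    proof (intro allI, rule ccontr)
      fix f assume f: "\<not> (e \<notin> below B n f \<or> f \<notin> edges B n)"
      then have "f \<in> into B n (tgt B n e)"
        using below_tgt[OF assms, of f e] by (auto simp: into_def)
      then have "f \<in> insert e (below B n e)" using * by blast
      then show False using f below_trans[OF assms, of f e e] self_notin_below by blast
    qed
  qed
  finally show ?thesis using True insert_below_subset_into[OF assms True] by blast
qed (simp add: is_max_edge_def)

lemma ex1_min_edge:
  assumes "n \<ge> 1" "v \<in> verts B n"
  shows "\<exists>!e. is_min_edge B n e \<and> tgt B n e = v"
proof (rule ex_ex1I)
  obtain e0 where e0: "e0 \<in> into B n v"
    using tgt_onto[OF assms] by (auto simp: into_def)
  then obtain e where e: "e \<in> into B n v"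
    "\<And>f. f \<in> into B n v \<Longrightarrow> card (below B n e) \<le> card (below B n f)"
    by (rule ex_has_least_nat[where P="\<lambda>e. e \<in> into B n v" and m="\<lambda>e. card (below B n e)", 
          THEN exE]) auto
  have "below B n e = {}"
  proof (rule ccontr)
    assume "below B n e \<noteq> {}"
    then obtain f where f: "f \<in> below B n e" by auto
    then have "f \<in> into B n v"
      using e(1) below_tgt[OF assms(1) _ f] below_edge[OF f] by (auto simp: into_def)
    moreover have "below B n f \<subset> below B n e"
      using insert_below_subset_below[OF assms(1) f] self_notin_below by blast
    ultimately show False
      using e(2)[of f] psubset_card_mono[OF finite_below[OF assms(1)]] by (metis leD)
  qed
  then show "\<exists>e. is_min_edge B n e \<and> tgt B n e = v"
    using e(1) by (auto simp: is_min_edge_iff into_def)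
next
  fix e f
  assume "is_min_edge B n e \<and> tgt B n e = v" "is_min_edge B n f \<and> tgt B n f = v"
  then show "e = f"
    using below_linear[OF assms(1), of e f] by (auto simp: is_min_edge_iff)
qed

text \<open>
  The successor is the edge above \<open>e\<close> with the fewest predecessors: an edge strictly between would have
  fewer.  There is no second immediate successor, since edges into one vertex are comparable.
\<close>

lemma edge_succ:
  assumes n: "n \<ge> 1" and e: "e \<in> edges B n" and nmax: "\<not> is_max_edge B n e"
  shows "edge_succ B n e \<in> edges B n"
    and "tgt B n (edge_succ B n e) = tgt B n e"
    and "below B n (edge_succ B n e) = insert e (below B n e)"
proof -
  let ?P = "\<lambda>f. f \<in> edges B n \<and> f \<noteq> e \<and> (e, f) \<in> edge_ord B n \<and>
     (\<forall>g\<in>edges B n. (e, g) \<in> edge_ord B n \<and> (g, f) \<in> edge_ord B n \<longrightarrow> g = e \<or> g = f)"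
  obtain f0 where f0: "f0 \<in> edges B n \<and> e \<in> below B n f0"
    using nmax e by (auto simp: is_max_edge_def below_def)
  then obtain f where f: "f \<in> edges B n" "e \<in> below B n f"
    "\<And>g. g \<in> edges B n \<and> e \<in> below B n g \<Longrightarrow> card (below B n f) \<le> card (below B n g)"
    by (rule ex_has_least_nat[where P="\<lambda>f. f \<in> edges B n \<and> e \<in> below B n f"
          and m="\<lambda>e. card (below B n e)", THEN exE]) auto
  have P: "?P f"
  proof (intro conjI ballI impI)
    fix g assume g: "g \<in> edges B n" "(e, g) \<in> edge_ord B n \<and> (g, f) \<in> edge_ord B n"
    show "g = e \<or> g = f"
    proof (rule ccontr)
      assume "\<not> (g = e \<or> g = f)"
      then have g': "e \<in> below B n g" "g \<in> below B n f" using g e by (auto simp: below_def)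
      then have "below B n g \<subset> below B n f"
        using insert_below_subset_below[OF n g'(2)] self_notin_below by blast
      then have "card (below B n g) < card (below B n f)"
        using n by (intro psubset_card_mono) auto
      then show False using f(3)[of g] g(1) g'(1) by linarith
    qed
  qed (use f e in \<open>auto simp: below_def\<close>)
  have sub: "g = f" if "?P g" for g
  proof (rule ccontr)
    assume "g \<noteq> f"
    have "tgt B n g = tgt B n f"
      using that P comparable_iff[OF n e, of g] comparable_iff[OF n e, of f] by auto
    then show False
      using that P below_linear[OF n, of g f] \<open>g \<noteq> f\<close> unfolding below_def by auto
  qed
  have eq: "edge_succ B n e = f"
    unfolding edge_succ_def using P sub by (rule the_equality)
  show "edge_succ B n e \<in> edges B n" using eq f by simp
  show tgt: "tgt B n (edge_succ B n e) = tgt B n e"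
    using below_tgt[OF n f(1,2)] eq by simp
  show "below B n (edge_succ B n e) = insert e (below B n e)"
    unfolding eq
  proof (intro equalityI subsetI)
    fix g assume g: "g \<in> below B n f"
    show "g \<in> insert e (below B n e)"
    proof (rule ccontr)
      assume *: "g \<notin> insert e (below B n e)"
      then have "e \<in> below B n g"
        using below_linear[OF n e below_edge[OF g]] below_tgt[OF n f(1) g] tgt eq by auto
      then show False using P g * by (auto simp: below_def)
    qed
  next
    fix g assume "g \<in> insert e (below B n e)"
    then show "g \<in> below B n f" using f(2) below_trans[OF n f(2)] by auto
  qed
qed

end

section \<open>Paths and their addresses in the towers\<close>

text \<open>
  Taking the source of the next edge, not the terminal vertex of the edge before, covers the root as well.
\<close>

definition vtx :: "('v, 'e) bratteli \<Rightarrow> (nat \<Rightarrow> 'e) \<Rightarrow> nat \<Rightarrow> 'v" where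
  "vtx B x n = src B (Suc n) (x (Suc n))"

text \<open>
  The number of paths from the root to the vertex \<open>v\<close> of level \<open>n\<close>.
\<close>

primrec tower_height :: "('v, 'e) bratteli \<Rightarrow> nat \<Rightarrow> 'v \<Rightarrow> nat" where
  "tower_height B 0 v = 1"
| "tower_height B (Suc n) v = (\<Sum>e\<in>into B (Suc n) v. tower_height B n (src B (Suc n) e))"

text \<open>
  The rank of the first \<open>n\<close> edges of \<open>x\<close> among all paths from the root to the same vertex, in the order
  that compares the last edges first: each edge below the last one accounts for all paths to its source.
\<close>

primrec address :: "('v, 'e) bratteli \<Rightarrow> nat \<Rightarrow> (nat \<Rightarrow> 'e) \<Rightarrow> nat" where
  "address B 0 x = 0"
| "address B (Suc n) x =
     address B n x + (\<Sum>e\<in>below B (Suc n) (x (Suc n)). tower_height B n (src B (Suc n) e))"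

context ordered_bratteli
begin

abbreviation X :: "(nat \<Rightarrow> 'e) set" where
  "X \<equiv> path_space B"

lemma path_space_iff:
  "x \<in> X \<longleftrightarrow>
     x 0 = undefined \<and> (\<forall>n\<ge>1. x n \<in> edges B n \<and> tgt B n (x n) = src B (Suc n) (x (Suc n)))"
  by (auto simp: path_space_def PiE_iff extensional_def Suc_le_eq)

lemma path_eqI:
  "x \<in> X \<Longrightarrow> y \<in> X \<Longrightarrow> (\<And>n. n \<ge> 1 \<Longrightarrow> x n = y n) \<Longrightarrow> x = y"
  by (rule ext) (metis path_space_iff less_one linorder_not_le)

lemma path_edge: "x \<in> X \<Longrightarrow> n \<ge> 1 \<Longrightarrow> x n \<in> edges B n"
  by (simp add: path_space_iff)

lemma tgt_eq_vtx: "x \<in> X \<Longrightarrow> n \<ge> 1 \<Longrightarrow> tgt B n (x n) = vtx B x n"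
  by (simp add: path_space_iff vtx_def)

lemma vtx_in: "x \<in> X \<Longrightarrow> vtx B x n \<in> verts B n"
  using src_in[of "Suc n" "x (Suc n)"] by (simp add: vtx_def path_edge)

lemma height_pos: "v \<in> verts B n \<Longrightarrow> tower_height B n v > 0"
proof (induction n arbitrary: v)
  case (Suc n)
  then obtain e where e: "e \<in> into B (Suc n) v"
    using tgt_onto[of "Suc n" v] by (auto simp: into_def)
  then have "tower_height B n (src B (Suc n) e) > 0"
    using src_in[of "Suc n" e] by (intro Suc.IH) (auto simp: into_def)
  then show ?case using e by (auto intro!: sum_pos2[of _ e])
qed auto

text \<open>
  The last edge and its predecessors are distinct edges into the same vertex, and the paths through each
  of them are counted once in the height.
\<close>

lemma address_less_height:
  assumes x: "x \<in> X"
  shows "address B n x < tower_height B n (vtx B x n)"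
proof (induction n)
  case (Suc n)
  let ?e = "x (Suc n)" and ?h = "\<lambda>e. tower_height B n (src B (Suc n) e)"
  have "address B (Suc n) x < (\<Sum>e\<in>insert ?e (below B (Suc n) ?e). ?h e)"
    using Suc by (simp add: vtx_def)
  also have "\<dots> \<le> (\<Sum>e\<in>into B (Suc n) (tgt B (Suc n) ?e). ?h e)"
    using insert_below_subset_into[of "Suc n" ?e] path_edge[OF x, of "Suc n"]
    by (intro sum_mono2) auto
  also have "tgt B (Suc n) ?e = vtx B x (Suc n)" using tgt_eq_vtx[OF x] by simp
  finally show ?case by simp
qed simp

text \<open>
  The edges into a vertex own disjoint blocks of ranks, of the lengths given by the heights of their
  sources.  So the rank reveals the last edge, what remains of it is the rank of the shorter path, and so on.
\<close>

lemma address_eq_imp_agree: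
  assumes x: "x \<in> X" and y: "y \<in> X"
  assumes "address B n x = address B n y" "vtx B x n = vtx B y n"
  shows "\<forall>i\<in>{1..n}. x i = y i"
  using assms(3,4)
proof (induction n)
  case (Suc n)
  have less: "address B (Suc n) u < address B (Suc n) w"
    if u: "u \<in> X" and "u (Suc n) \<in> below B (Suc n) (w (Suc n))" for u w
  proof -
    have "address B (Suc n) u <
        (\<Sum>e\<in>insert (u (Suc n)) (below B (Suc n) (u (Suc n))). tower_height B n (src B (Suc n) e))"
      using address_less_height[OF u, of n] by (simp add: vtx_def)
    also have "\<dots> \<le> (\<Sum>e\<in>below B (Suc n) (w (Suc n)). tower_height B n (src B (Suc n) e))"
      using that insert_below_subset_below[of "Suc n"] by (intro sum_mono2) auto
    finally show ?thesis by simp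
  qed
  have eq: "x (Suc n) = y (Suc n)"
  proof (rule ccontr)
    assume "x (Suc n) \<noteq> y (Suc n)"
    then have "x (Suc n) \<in> below B (Suc n) (y (Suc n)) \<or> y (Suc n) \<in> below B (Suc n) (x (Suc n))"
      using Suc.prems(2) x y by (intro below_linear) (auto simp: path_edge tgt_eq_vtx)
    then show False using less[OF x, of y] less[OF y, of x] Suc.prems(1) by auto
  qed
  moreover have "\<forall>i\<in>{1..n}. x i = y i"
    using eq Suc.prems(1) by (intro Suc.IH) (auto simp: vtx_def)
  ultimately show ?case by (auto simp: le_Suc_eq)
qed simp

lemma address_cong: "(\<And>i. 1 \<le> i \<Longrightarrow> i \<le> n \<Longrightarrow> x i = y i) \<Longrightarrow> address B n x = address B n y"
  by (induction n) auto

lemma address_min: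
  "(\<And>i. 1 \<le> i \<Longrightarrow> i \<le> n \<Longrightarrow> is_min_edge B i (x i)) \<Longrightarrow> address B n x = 0"
  by (induction n) (auto simp: is_min_edge_iff)

text \<open>
  A predecessor of an edge would contribute the positive height of its source to the address.
\<close>

lemma address_0_imp_min:
  assumes x: "x \<in> X"
  shows "address B n x = 0 \<Longrightarrow> i \<in> {1..n} \<Longrightarrow> is_min_edge B i (x i)"
proof (induction n)
  case (Suc n)
  have "below B (Suc n) (x (Suc n)) = {}"
  proof (rule ccontr)
    assume "below B (Suc n) (x (Suc n)) \<noteq> {}"
    then obtain e where e: "e \<in> below B (Suc n) (x (Suc n))" by auto
    then have "tower_height B n (src B (Suc n) e) > 0"
      using src_in[of "Suc n" e] below_edge[OF e] by (intro height_pos) auto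
    then have "(\<Sum>e\<in>below B (Suc n) (x (Suc n)). tower_height B n (src B (Suc n) e)) > 0"
      using e by (auto intro!: sum_pos2[of _ e])
    then show False using Suc.prems by simp
  qed
  then show ?case
    using Suc path_edge[OF x, of "Suc n"] by (cases "i = Suc n") (auto simp: is_min_edge_iff)
qed simp

lemma address_max:
  assumes x: "x \<in> X"
  shows "(\<And>i. 1 \<le> i \<Longrightarrow> i \<le> n \<Longrightarrow> is_max_edge B i (x i)) \<Longrightarrow>
    Suc (address B n x) = tower_height B n (vtx B x n)"
proof (induction n)
  case (Suc n)
  let ?e = "x (Suc n)" and ?h = "\<lambda>e. tower_height B n (src B (Suc n) e)"
  have IH: "Suc (address B n x) = tower_height B n (vtx B x n)"
    using Suc by auto
  have "insert ?e (below B (Suc n) ?e) = into B (Suc n) (tgt B (Suc n) ?e)"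
    using Suc.prems[of "Suc n"] by (simp add: is_max_edge_iff)
  then have "tower_height B (Suc n) (vtx B x (Suc n)) = (\<Sum>e\<in>insert ?e (below B (Suc n) ?e). ?h e)"
    using tgt_eq_vtx[OF x, of "Suc n"] by simp
  also have "\<dots> = Suc (address B (Suc n) x)"
    using IH by (simp add: vtx_def)
  finally show ?case by simp
qed simp

lemma address_plus:
  "address B (k + d) x =
    address B k x + (\<Sum>n\<in>{k..<k+d}. \<Sum>e\<in>below B (Suc n) (x (Suc n)). tower_height B n (src B (Suc n) e))"
  by (induction d) auto

lemma ex_minimal_path:
  assumes "v \<in> verts B n"
  shows "\<exists>p. (\<forall>i\<in>{1..n}. is_min_edge B i (p i)) \<and>
    (\<forall>i. 1 \<le> i \<and> i < n \<longrightarrow> tgt B i (p i) = src B (Suc i) (p (Suc i))) \<and>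
    (n \<ge> 1 \<longrightarrow> tgt B n (p n) = v)"
  using assms
proof (induction n arbitrary: v)
  case (Suc n)
  obtain e where e: "is_min_edge B (Suc n) e" "tgt B (Suc n) e = v"
    using ex1_min_edge[of "Suc n" v] Suc.prems by auto
  then have "src B (Suc n) e \<in> verts B n"
    using src_in[of "Suc n" e] by (auto simp: is_min_edge_def)
  from Suc.IH[OF this] obtain p where p: "\<forall>i\<in>{1..n}. is_min_edge B i (p i)"
    "\<forall>i. 1 \<le> i \<and> i < n \<longrightarrow> tgt B i (p i) = src B (Suc i) (p (Suc i))"
    "n \<ge> 1 \<longrightarrow> tgt B n (p n) = src B (Suc n) e" by auto
  show ?case
    by (rule exI[of _ "p(Suc n := e)"]) (use p e in \<open>auto simp: le_Suc_eq less_Suc_eq\<close>)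
qed auto

lemma minimal_path_unique:
  assumes "\<forall>i\<in>{1..n}. is_min_edge B i (p i)" "\<forall>i\<in>{1..n}. is_min_edge B i (q i)"
    "\<forall>i. 1 \<le> i \<and> i < n \<longrightarrow> tgt B i (p i) = src B (Suc i) (p (Suc i))"
    "\<forall>i. 1 \<le> i \<and> i < n \<longrightarrow> tgt B i (q i) = src B (Suc i) (q (Suc i))"
    "tgt B n (p n) = tgt B n (q n)"
  shows "\<forall>i\<in>{1..n}. p i = q i"
  using assms
proof (induction n)
  case (Suc n)
  have min: "is_min_edge B (Suc n) (p (Suc n))" "is_min_edge B (Suc n) (q (Suc n))"
    using Suc.prems by auto
  then have "tgt B (Suc n) (p (Suc n)) \<in> verts B (Suc n)"
    using tgt_in[of "Suc n"] by (auto simp: is_min_edge_def)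
  then have eq: "p (Suc n) = q (Suc n)"
    using ex1_min_edge[of "Suc n" "tgt B (Suc n) (p (Suc n))"] min Suc.prems(5) by auto
  show ?case
  proof (cases "n = 0")
    case False
    have "\<forall>i\<in>{1..n}. p i = q i"
    proof (rule Suc.IH)
      have "tgt B n (p n) = src B (Suc n) (p (Suc n))" "tgt B n (q n) = src B (Suc n) (q (Suc n))"
        using Suc.prems(3,4) False by auto
      then show "tgt B n (p n) = tgt B n (q n)" using eq by simp
    qed (use Suc.prems in auto)
    then show ?thesis using eq by (auto simp: le_Suc_eq)
  qed (use eq in auto)
qed simp

end

section \<open>The Vershik map\<close>

text \<open>
  The property by which the Vershik map chooses its value \<open>y\<close> at a path \<open>x\<close> whose first edge that is not
  maximal has level \<open>k\<close>.
\<close>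

definition vershik_image_at ::
    "('v, 'e) bratteli \<Rightarrow> nat \<Rightarrow> (nat \<Rightarrow> 'e) \<Rightarrow> (nat \<Rightarrow> 'e) \<Rightarrow> bool" where
  "vershik_image_at B k x y \<longleftrightarrow> y \<in> path_space B \<and> (\<forall>n\<in>{1..<k}. is_min_edge B n (y n)) \<and>
         y k = edge_succ B k (x k) \<and> (\<forall>n>k. y n = x n)"

context properly_ordered_bratteli
begin

abbreviation T :: "(nat \<Rightarrow> 'e) \<Rightarrow> (nat \<Rightarrow> 'e)" where
  "T \<equiv> vershik B"

lemma max_path: "max_path B \<in> X" "n \<ge> 1 \<Longrightarrow> is_max_edge B n (max_path B n)"
  using theI'[OF ex1_max] by (auto simp: max_path_def)

lemma min_path: "min_path B \<in> X" "n \<ge> 1 \<Longrightarrow> is_min_edge B n (min_path B n)"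
  using theI'[OF ex1_min] by (auto simp: min_path_def)

lemma eq_max_path:
  "x \<in> X \<Longrightarrow> (\<And>n. n \<ge> 1 \<Longrightarrow> is_max_edge B n (x n)) \<Longrightarrow> x = max_path B"
  using ex1_max max_path by blast

lemma eq_min_path:
  "x \<in> X \<Longrightarrow> (\<And>n. n \<ge> 1 \<Longrightarrow> is_min_edge B n (x n)) \<Longrightarrow> x = min_path B"
  using ex1_min min_path by blast

lemma vershik_max_path: "T (max_path B) = min_path B"
  by (simp add: vershik_def)

lemma path_cases:
  assumes "x \<in> X"
  obtains "x = max_path B"
  | k where "k \<ge> 1" "\<forall>i\<in>{1..<k}. is_max_edge B i (x i)" "\<not> is_max_edge B k (x k)"
proof (cases "\<forall>n\<ge>1. is_max_edge B n (x n)")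
  case True
  then show ?thesis using eq_max_path[OF assms] that(1) by auto
next
  case False
  let ?P = "\<lambda>k. k \<ge> 1 \<and> \<not> is_max_edge B k (x k)"
  have "?P (LEAST k. ?P k)" using LeastI_ex[of ?P] False by blast
  moreover have "\<forall>i\<in>{1..<LEAST k. ?P k}. is_max_edge B i (x i)"
  proof
    fix i assume i: "i \<in> {1..<LEAST k. ?P k}"
    then have "\<not> ?P i" by (intro not_less_Least) simp
    then show "is_max_edge B i (x i)" using i by simp
  qed
  ultimately show ?thesis using that(2)[of "LEAST k. ?P k"] by blast
qed

text \<open>
  The edges up to level \<open>k - 1\<close> are minimal and lead to the source of the successor edge; going down from
  there, every minimal edge is determined by its terminal vertex.
\<close>

lemma vershik_image_at_unique:
  assumes k: "k \<ge> 1" and y: "vershik_image_at B k x y" and z: "vershik_image_at B k x z"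
  shows "y = z"
proof (rule path_eqI)
  show yp: "y \<in> X" and zp: "z \<in> X"
    using y z by (auto simp: vershik_image_at_def)
  fix n :: nat assume n: "n \<ge> 1"
  have "\<forall>i\<in>{1..k-1}. y i = z i"
  proof (cases "k = 1")
    case False
    have "tgt B (k-1) (y (k-1)) = src B k (y k)" "tgt B (k-1) (z (k-1)) = src B k (z k)"
      using tgt_eq_vtx[OF yp, of "k-1"] tgt_eq_vtx[OF zp, of "k-1"] k False by (auto simp: vtx_def)
    then have "tgt B (k-1) (y (k-1)) = tgt B (k-1) (z (k-1))"
      using y z by (simp add: vershik_image_at_def)
    then show ?thesis
      using y z yp zp by (intro minimal_path_unique) (auto simp: vershik_image_at_def path_space_iff)
  qed simp
  then show "y n = z n"
    using y z n by (cases n k rule: linorder_cases) (auto simp: vershik_image_at_def)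
qed

lemma vershik_image_at_exists:
  assumes x: "x \<in> X" and k: "k \<ge> 1" and nmax: "\<not> is_max_edge B k (x k)"
  shows "\<exists>y. vershik_image_at B k x y"
proof -
  define f where "f = edge_succ B k (x k)"
  have f: "f \<in> edges B k" "tgt B k f = tgt B k (x k)"
    using edge_succ[OF k path_edge[OF x k] nmax] by (auto simp: f_def)
  then have "src B k f \<in> verts B (k - 1)" using src_in[OF k] by simp
  from ex_minimal_path[OF this] obtain p where p:
    "\<forall>i\<in>{1..k-1}. is_min_edge B i (p i)"
    "\<forall>i. 1 \<le> i \<and> i < k-1 \<longrightarrow> tgt B i (p i) = src B (Suc i) (p (Suc i))"
    "k - 1 \<ge> 1 \<longrightarrow> tgt B (k-1) (p (k-1)) = src B k f" by auto
  define y where "y n = (if n = 0 then undefined else if n < k then p n else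
      if n = k then f else x n)" for n
  have "y \<in> X"
    unfolding path_space_iff
  proof (intro conjI allI impI)
    fix n :: nat assume n: "1 \<le> n"
    show "y n \<in> edges B n"
      using n p(1) f path_edge[OF x] by (auto simp: y_def is_min_edge_def)
    consider "Suc n < k" | "Suc n = k" | "n = k" | "n > k" by linarith
    then show "tgt B n (y n) = src B (Suc n) (y (Suc n))"
    proof cases
      case 1
      then show ?thesis using n p(2) by (simp add: y_def)
    next
      case 2
      then show ?thesis using n p(3) by (auto simp: y_def)
    next
      case 3
      then show ?thesis using n f(2) x by (auto simp: y_def path_space_iff)
    next
      case 4
      then show ?thesis using n x by (auto simp: y_def path_space_iff)
    qed
  qed (simp add: y_def)
  then have "vershik_image_at B k x y"
    using k p(1) by (auto simp: vershik_image_at_def y_def f_def)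
  then show ?thesis by blast
qed

lemma vershik_image_at_vershik:
  assumes x: "x \<in> X" and k: "k \<ge> 1"
    and max: "\<forall>i\<in>{1..<k}. is_max_edge B i (x i)" and nmax: "\<not> is_max_edge B k (x k)"
  shows "vershik_image_at B k x (T x)"
proof -
  have ne: "x \<noteq> max_path B" using max_path(2)[OF k] nmax by auto
  have "(LEAST k. k \<ge> 1 \<and> \<not> is_max_edge B k (x k)) = k"
    using k max nmax by (intro Least_equality) (auto simp: not_less[symmetric])
  then have "T x = (THE y. vershik_image_at B k x y)"
    using ne by (simp add: vershik_def vershik_image_at_def Let_def)
  then show ?thesis
    using vershik_image_at_exists[OF x k nmax] vershik_image_at_unique[OF k]
    by (metis theI)
qed

lemma vershik_in_path_space:
  assumes x: "x \<in> X"
  shows "T x \<in> X"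
  using x
proof (cases rule: path_cases)
  case 1
  then show ?thesis by (simp add: vershik_max_path min_path)
next
  case (2 k)
  then show ?thesis using vershik_image_at_vershik[OF x 2] by (simp add: vershik_image_at_def)
qed

lemma funpow_vershik_in: "x \<in> X \<Longrightarrow> (T ^^ s) x \<in> X"
  by (induction s) (auto intro: vershik_in_path_space)

lemma vershik_all_max:
  assumes x: "x \<in> X" and max: "\<forall>i\<in>{1..n}. is_max_edge B i (x i)" and i: "i \<in> {1..n}"
  shows "is_min_edge B i (T x i)"
  using x
proof (cases rule: path_cases)
  case 1
  then show ?thesis using i min_path(2) by (simp add: vershik_max_path)
next
  case (2 k)
  then have "n < k" using max by (metis atLeastAtMost_iff not_le)
  then show ?thesis
    using vershik_image_at_vershik[OF x 2] i by (auto simp: vershik_image_at_def)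
qed

text \<open>
  With \<open>k\<close> the level of the first edge that is not maximal, the rank below level \<open>k\<close> falls from its largest
  value, the height minus one, to \<open>0\<close>, while at level \<open>k\<close> the old edge becomes a predecessor and
  contributes that same height.  The net effect is \<open>+1\<close>.
\<close>

lemma vershik_not_all_max:
  assumes x: "x \<in> X" and nmax: "\<not> (\<forall>i\<in>{1..n}. is_max_edge B i (x i))"
  shows "address B n (T x) = Suc (address B n x)" "i > n \<Longrightarrow> T x i = x i"
proof -
  have "x \<noteq> max_path B" using nmax max_path(2) by auto
  then obtain k where k: "k \<ge> 1" "\<forall>i\<in>{1..<k}. is_max_edge B i (x i)"
      "\<not> is_max_edge B k (x k)"
    using path_cases[OF x] by blast
  have kn: "k \<le> n"
    using k nmax by (metis atLeastAtMost_iff atLeastLessThan_iff le_less_trans not_le)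
  note V = vershik_image_at_vershik[OF x k, unfolded vershik_image_at_def]
  show "T x i = x i" if "i > n" using V that kn by auto
  obtain k' where k': "k = Suc k'" using k(1) by (cases k) auto
  let ?h = "\<lambda>e. tower_height B k' (src B (Suc k') e)"
  have "Suc (address B k' x) = ?h (x k)"
    using address_max[OF x, of k'] k(2) k' by (simp add: vtx_def)
  moreover have "address B k' (T x) = 0"
    using V k' by (intro address_min) auto
  moreover have "below B k (T x k) = insert (x k) (below B k (x k))"
    using V edge_succ(3)[OF k(1) path_edge[OF x k(1)] k(3)] by simp
  ultimately have *: "address B k (T x) = Suc (address B k x)"
    using k(1) by (simp add: k')
  obtain d where d: "n = k + d" using kn le_Suc_ex by blast
  show "address B n (T x) = Suc (address B n x)"
    unfolding d address_plus * using V by simp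
qed

end

section \<open>Self-similarity of a stationary diagram\<close>

text \<open>
  The path \<open>x\<close> seen from level \<open>n\<close> on, as a path of the same stationary diagram: the vertices of level
  \<open>n\<close> take the place of those of level \<open>1\<close>, and the edge from the root is forced.  The value at \<open>0\<close> is the one
  that membership in the path space prescribes.
\<close>

definition shift_path :: "('v, 'e) bratteli \<Rightarrow> nat \<Rightarrow> (nat \<Rightarrow> 'e) \<Rightarrow> nat \<Rightarrow> 'e" where
  "shift_path B n x = (\<lambda>k. if k = 0 then undefined
     else if k = 1 then THE e. e \<in> edges B 1 \<and> tgt B 1 e = vtx B x n
     else x (n + k - 1))"

context stationary_bratteli
begin

lemma src_level: "n \<ge> 2 \<Longrightarrow> e \<in> edges B n \<Longrightarrow> src B n e = src B 2 e"
  using edges_eq[of n] src_eq[of n] by simp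

lemma tgt_level: "n \<ge> 2 \<Longrightarrow> e \<in> edges B n \<Longrightarrow> tgt B n e = tgt B 2 e"
  using edges_eq[of n] tgt_eq[of n] by simp

lemma is_min_edge_level: "n \<ge> 2 \<Longrightarrow> is_min_edge B n e = is_min_edge B 2 e"
  using edges_eq[of n] edge_ord_eq[of n] by (simp add: is_min_edge_def)

lemma is_max_edge_level: "n \<ge> 2 \<Longrightarrow> is_max_edge B n e = is_max_edge B 2 e"
  using edges_eq[of n] edge_ord_eq[of n] by (simp add: is_max_edge_def)

lemma edge_succ_level: "n \<ge> 2 \<Longrightarrow> edge_succ B n e = edge_succ B 2 e"
  using edges_eq[of n] edge_ord_eq[of n] by (simp add: edge_succ_def)

lemma below_1:
  assumes e: "e \<in> edges B 1"
  shows "below B 1 e = {}"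
proof -
  have "f = e" if "f \<in> below B 1 e" for f
    using first_edges[of "tgt B 1 e"] tgt_in[of 1 e] verts_eq[of 1] below_edge[OF that]
      below_tgt[OF _ e that] e by auto
  then show ?thesis using self_notin_below by blast
qed

lemma into_1:
  assumes e: "e \<in> edges B 1"
  shows "into B 1 (tgt B 1 e) = {e}"
  using first_edges[of "tgt B 1 e"] tgt_in[of 1 e] verts_eq[of 1] e by (auto simp: into_def)

lemma first_edge_min: "e \<in> edges B 1 \<Longrightarrow> is_min_edge B 1 e"
  using below_1 by (simp add: is_min_edge_iff)

lemma first_edge_max: "e \<in> edges B 1 \<Longrightarrow> is_max_edge B 1 e"
  using below_1 into_1 by (simp add: is_max_edge_iff)

lemma vtx_range: "x \<in> X \<Longrightarrow> n \<ge> 1 \<Longrightarrow> vtx B x n \<in> {1..m}"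
  using vtx_in[of x n] verts_eq by simp

lemma shift_path_1:
  assumes "x \<in> X" "n \<ge> 1"
  shows "shift_path B n x 1 \<in> edges B 1" "tgt B 1 (shift_path B n x 1) = vtx B x n"
  using theI'[OF first_edges[OF vtx_range[OF assms]]] by (auto simp: shift_path_def)

lemma shift_path_ge2: "k \<ge> 2 \<Longrightarrow> shift_path B n x k = x (n + k - 1)"
  by (simp add: shift_path_def)

lemma shift_path_in:
  assumes x: "x \<in> X" and n: "n \<ge> 1"
  shows "shift_path B n x \<in> X"
  unfolding path_space_iff
proof (intro conjI allI impI)
  fix k :: nat assume k: "1 \<le> k"
  consider "k = 1" | "k \<ge> 2" using k by linarith
  then have "shift_path B n x k \<in> edges B k \<and>
    tgt B k (shift_path B n x k) = src B (Suc k) (shift_path B n x (Suc k))"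
  proof cases
    case 1
    then show ?thesis
      using shift_path_1[OF x n] path_edge[OF x, of "Suc n"] n src_level[of "Suc n" "x (Suc n)"]
      by (simp add: shift_path_ge2 vtx_def numeral_2_eq_2)
  next
    case 2
    define j where "j = n + k - 1"
    have j: "j \<ge> 2" "n + Suc k - 1 = Suc j" using 2 n by (auto simp: j_def)
    have e: "x j \<in> edges B j" "x (Suc j) \<in> edges B (Suc j)"
      and t: "tgt B j (x j) = src B (Suc j) (x (Suc j))"
      using x j by (auto simp: path_space_iff)
    show ?thesis
      using 2 j e t tgt_level[of j "x j"] src_level[of "Suc j" "x (Suc j)"]
        edges_eq[of j] edges_eq[of "Suc j"] edges_eq[of k] edges_eq[of "Suc k"]
        tgt_eq[of k "x j"] src_eq[of "Suc k" "x (Suc j)"]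
      by (simp add: shift_path_ge2 flip: j_def)
  qed
  then show "shift_path B n x k \<in> edges B k"
    "tgt B k (shift_path B n x k) = src B (Suc k) (shift_path B n x (Suc k))" by auto
qed (simp add: shift_path_def)

lemma vtx_shift_path:
  assumes x: "x \<in> X" and n: "n \<ge> 1" and k: "k \<ge> 1"
  shows "vtx B (shift_path B n x) k = vtx B x (n + k - 1)"
proof -
  have "x (n + k) \<in> edges B (n + k)" using path_edge[OF x] n by simp
  then show ?thesis
    using n k edges_eq[of "n+k"] src_eq[of "Suc k"] src_eq[of "n + k"]
    by (simp add: vtx_def shift_path_ge2)
qed

lemma shift_path_cong:
  assumes x: "x \<in> X" and y: "y \<in> X" and "n \<ge> 1"
    and eq: "\<And>i. i > n \<Longrightarrow> x i = y i"
  shows "shift_path B n x = shift_path B n y"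
  using eq by (auto simp: shift_path_def vtx_def fun_eq_iff)

text \<open>
  If the first \<open>n\<close> edges are maximal, the Vershik map looks for an edge to raise beyond level \<open>n\<close> only, and
  there it sees the same order.  The edge from the root that \<open>shift_path\<close> puts in front is the only one to its
  terminal vertex, hence both minimal and maximal, and is never the one that is raised.
\<close>

lemma vershik_shift_path:
  assumes x: "x \<in> X" and n: "n \<ge> 1" and max: "\<forall>i\<in>{1..n}. is_max_edge B i (x i)"
  shows "shift_path B n (T x) = T (shift_path B n x)"
  using x
proof (cases rule: path_cases)
  case 1
  note Vx = vershik_in_path_space[OF x]
  have "shift_path B n x = max_path B"
  proof (rule eq_max_path[OF shift_path_in[OF x n]])
    fix k :: nat assume "k \<ge> 1"
    then consider "k = 1" | "k \<ge> 2" by linarith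
    then show "is_max_edge B k (shift_path B n x k)"
      using shift_path_1[OF x n] first_edge_max n max_path(2)[of "n + k - 1"]
      is_max_edge_level[of k] is_max_edge_level[of "n + k - 1"]
      by cases (simp_all add: 1 shift_path_ge2)
  qed
  moreover have "shift_path B n (T x) = min_path B"
  proof (rule eq_min_path[OF shift_path_in[OF Vx n]])
    fix k :: nat assume "k \<ge> 1"
    then consider "k = 1" | "k \<ge> 2" by linarith
    then show "is_min_edge B k (shift_path B n (T x) k)"
      using shift_path_1[OF Vx n] first_edge_min n min_path(2)[of "n + k - 1"]
      is_min_edge_level[of k] is_min_edge_level[of "n + k - 1"]
      by cases (simp_all add: 1 shift_path_ge2 vershik_max_path)
  qed
  ultimately show ?thesis by (simp add: vershik_max_path)
next
  case (2 k)
  note Vx = vershik_in_path_space[OF x]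
  have "n < k" using max 2 by (metis atLeastAtMost_iff not_le)
  \<comment> \<open>Level \<open>k\<close> of \<open>x\<close> is level \<open>k - n + 1\<close> of the shifted path, as the forced edge occupies level \<open>1\<close>.\<close>
  define k' where "k' = k - n + 1"
  have k': "k' \<ge> 2" "n + k' - 1 = k" using \<open>n < k\<close> by (auto simp: k'_def)
  note V = vershik_image_at_vershik[OF x 2, unfolded vershik_image_at_def]
  have "vershik_image_at B k' (shift_path B n x) (T (shift_path B n x))"
  proof (rule vershik_image_at_vershik[OF shift_path_in[OF x n]])
    show "\<not> is_max_edge B k' (shift_path B n x k')"
      using k' 2 \<open>n < k\<close> n is_max_edge_level[of k] is_max_edge_level[of k'] by (simp add: shift_path_ge2)
    show "\<forall>i\<in>{1..<k'}. is_max_edge B i (shift_path B n x i)"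
    proof
      fix i assume i: "i \<in> {1..<k'}"
      then consider "i = 1" | "i \<ge> 2" by fastforce
      then show "is_max_edge B i (shift_path B n x i)"
      proof cases
        case 1
        then show ?thesis using shift_path_1[OF x n] first_edge_max by simp
      next
        case i2: 2
        have "is_max_edge B (n + i - 1) (x (n + i - 1))"
          using i i2 n \<open>n < k\<close> by (intro bspec[OF 2(2)]) (auto simp: k'_def)
        then show ?thesis
          using i2 n is_max_edge_level[of "n + i - 1"] is_max_edge_level[of i]
          by (simp add: shift_path_ge2)
      qed
    qed
  qed (use k' in simp)
  moreover have "vershik_image_at B k' (shift_path B n x) (shift_path B n (T x))"
    unfolding vershik_image_at_def
  proof (intro conjI)
    show "shift_path B n (T x) k' = edge_succ B k' (shift_path B n x k')"
      using V k' n \<open>n < k\<close> edge_succ_level[of k] edge_succ_level[of k'] by (simp add: shift_path_ge2)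
    show "\<forall>j>k'. shift_path B n (T x) j = shift_path B n x j"
      using V k' n by (auto simp: shift_path_ge2)
    show "\<forall>i\<in>{1..<k'}. is_min_edge B i (shift_path B n (T x) i)"
    proof
      fix i assume i: "i \<in> {1..<k'}"
      then consider "i = 1" | "i \<ge> 2" by fastforce
      then show "is_min_edge B i (shift_path B n (T x) i)"
      proof cases
        case 1
        then show ?thesis using shift_path_1[OF Vx n] first_edge_min by simp
      next
        case i2: 2
        have "is_min_edge B (n + i - 1) (T x (n + i - 1))"
          using conjunct1[OF conjunct2[OF V]] i i2 n \<open>n < k\<close>
          by (elim bspec) (auto simp: k'_def)
        then show ?thesis
          using i2 n is_min_edge_level[of "n + i - 1"] is_min_edge_level[of i]
          by (simp add: shift_path_ge2)
      qed
    qed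
  qed (rule shift_path_in[OF Vx n])
  ultimately show ?thesis using vershik_image_at_unique[of k'] k' by auto
qed

text \<open>
  The system is a tower over itself: below the top of a tower of level \<open>n\<close> a step climbs one floor, and
  from the top floor it leads to the bottom of the tower over the Vershik image of the shifted path.
\<close>

lemma tower_step:
  assumes x: "x \<in> X" and n: "n \<ge> 1"
  defines "climb \<equiv> Suc (address B n x) < tower_height B n (vtx B x n)"
  shows "address B n (T x) = (if climb then Suc (address B n x) else 0)"
    and "shift_path B n (T x) =
      (if climb then shift_path B n x else T (shift_path B n x))"
proof (atomize(full), cases "\<forall>i\<in>{1..n}. is_max_edge B i (x i)")
  case True
  then have "\<not> climb" using address_max[OF x, of n] by (simp add: climb_def)
  moreover have "address B n (T x) = 0"
    using vershik_all_max[OF x True] by (intro address_min) auto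
  ultimately show "address B n (T x) = (if climb then Suc (address B n x) else 0) \<and>
    shift_path B n (T x) = (if climb then shift_path B n x else T (shift_path B n x))"
    using vershik_shift_path[OF x n True] by simp
next
  case False
  note Vx = vershik_in_path_space[OF x] and V = vershik_not_all_max[OF x False]
  have "vtx B (T x) n = vtx B x n" using V(2)[of "Suc n"] by (simp add: vtx_def)
  then have climb using V(1) address_less_height[OF Vx, of n] by (simp add: climb_def)
  moreover have "shift_path B n (T x) = shift_path B n x"
    using V(2) Vx x n by (intro shift_path_cong) auto
  ultimately show "address B n (T x) = (if climb then Suc (address B n x) else 0) \<and>
    shift_path B n (T x) = (if climb then shift_path B n x else T (shift_path B n x))"
    using V(1) by simp
qed

end

text \<open>
  The number of steps from the bottom of the tower of level \<open>n\<close> over \<open>y\<close> to the bottom of the \<open>q\<close>-th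
  tower that follows, that is, the Birkhoff sum of the tower heights along the orbit of \<open>y\<close>.
\<close>

definition ladder :: "('v, 'e) bratteli \<Rightarrow> nat \<Rightarrow> (nat \<Rightarrow> 'e) \<Rightarrow> nat \<Rightarrow> nat" where
  "ladder B n y q = (\<Sum>u<q. tower_height B n (vtx B ((vershik B ^^ u) y) 1))"

lemma ladder_0 [simp]: "ladder B n y 0 = 0"
  and ladder_Suc [simp]:
    "ladder B n y (Suc q) = ladder B n y q + tower_height B n (vtx B ((vershik B ^^ q) y) 1)"
  by (auto simp: ladder_def)

lemma ladder_mono: "q \<le> q' \<Longrightarrow> ladder B n y q \<le> ladder B n y q'"
  unfolding ladder_def by (intro sum_mono2) auto

text \<open>
  Every time falls on at most one floor \<open>u\<close> of one tower \<open>q\<close>, as in division with remainder.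
\<close>

lemma ladder_unique:
  assumes "ladder B n y q + u = ladder B n y q' + u'"
    and "u < tower_height B n (vtx B ((vershik B ^^ q) y) 1)"
    and "u' < tower_height B n (vtx B ((vershik B ^^ q') y) 1)"
  shows "q = q' \<and> u = u'"
  using ladder_mono[of "Suc q" q' B n y] ladder_mono[of "Suc q'" q B n y] assms
  by (cases q q' rule: linorder_cases) auto

context stationary_bratteli
begin

lemma vtx_shift_path_1: "x \<in> X \<Longrightarrow> n \<ge> 1 \<Longrightarrow> vtx B (shift_path B n x) 1 = vtx B x n"
  using vtx_shift_path[of x n 1] by simp

text \<open>
  Counted from the bottom of its tower, \<open>z\<close> starts at height \<open>address B n z\<close>; after \<open>s\<close> steps it is
  on floor \<open>u\<close> of the \<open>q\<close>-th tower for the unique \<open>q\<close> and \<open>u\<close> that add up to \<open>address B n z + s\<close>.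
\<close>

lemma tower_orbit_exists:
  assumes z: "z \<in> X" and n: "n \<ge> 1"
  shows "\<exists>q u. ladder B n (shift_path B n z) q + u = address B n z + s \<and>
    u < tower_height B n (vtx B ((T ^^ q) (shift_path B n z)) 1) \<and>
    address B n ((T ^^ s) z) = u \<and>
    shift_path B n ((T ^^ s) z) = (T ^^ q) (shift_path B n z)"
proof (induction s)
  case 0
  show ?case
    using address_less_height[OF z, of n] vtx_shift_path_1[OF z n]
    by (intro exI[of _ 0] exI[of _ "address B n z"]) simp
next
  case (Suc s)
  let ?y = "shift_path B n z" and ?w = "(T ^^ s) z"
  from Suc obtain q u where qu: "ladder B n ?y q + u = address B n z + s"
    "u < tower_height B n (vtx B ((T ^^ q) ?y) 1)"
    "address B n ?w = u" "shift_path B n ?w = (T ^^ q) ?y" by auto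
  have w: "?w \<in> X" using z by (rule funpow_vershik_in)
  have h: "vtx B ((T ^^ q) ?y) 1 = vtx B ?w n"
    using vtx_shift_path_1[OF w n] qu(4) by simp
  show ?case
  proof (cases "Suc u < tower_height B n (vtx B ?w n)")
    case True
    then show ?thesis
      using qu tower_step[OF w n] h
      by (intro exI[of _ q] exI[of _ "Suc u"]) simp
  next
    case False
    then have "tower_height B n (vtx B ?w n) = Suc u" using qu(2) h by simp
    moreover have "vtx B ((T ^^ Suc q) ?y) 1 \<in> verts B n"
      using vtx_range[OF funpow_vershik_in[OF shift_path_in[OF z n]], of 1 "Suc q"] verts_eq[OF n] 
      by simp
    ultimately show ?thesis
      using qu tower_step[OF w n] False h height_pos[of "vtx B ((T ^^ Suc q) ?y) 1" n]
      by (intro exI[of _ "Suc q"] exI[of _ 0]) simp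
  qed
qed

lemma tower_orbit:
  assumes z: "z \<in> X" and n: "n \<ge> 1"
    and "ladder B n (shift_path B n z) q + u = address B n z + s"
    and "u < tower_height B n (vtx B ((T ^^ q) (shift_path B n z)) 1)"
  shows "address B n ((T ^^ s) z) = u \<and>
    shift_path B n ((T ^^ s) z) = (T ^^ q) (shift_path B n z)"
proof -
  obtain q' u' where *: "ladder B n (shift_path B n z) q' + u' = address B n z + s"
    "u' < tower_height B n (vtx B ((T ^^ q') (shift_path B n z)) 1)"
    "address B n ((T ^^ s) z) = u'"
    "shift_path B n ((T ^^ s) z) = (T ^^ q') (shift_path B n z)"
    using tower_orbit_exists[OF z n, of s] by auto
  then have "q = q' \<and> u = u'" using assms by (intro ladder_unique) auto
  then show ?thesis using * by simp
qed

lemma ladder_strict_mono: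
  assumes z: "z \<in> X" and n: "n \<ge> 1" and "q < q'"
  shows "ladder B n (shift_path B n z) q < ladder B n (shift_path B n z) q'"
proof -
  let ?y = "shift_path B n z"
  have "vtx B ((T ^^ q) ?y) 1 \<in> verts B n"
    using vtx_range[OF funpow_vershik_in[OF shift_path_in[OF z n]], of 1 q] verts_eq[OF n] by simp
  then have "ladder B n ?y q < ladder B n ?y (Suc q)" using height_pos by simp
  also have "\<dots> \<le> ladder B n ?y q'" using assms(3) by (intro ladder_mono) simp
  finally show ?thesis .
qed

end

section \<open>Entrance times of a recurrent set\<close>

text \<open>
  The induced map: every point goes to its first point of entrance to \<open>U\<close>, at a positive time.
\<close>

definition entrance_map :: "('a \<Rightarrow> 'a) \<Rightarrow> 'a set \<Rightarrow> 'a \<Rightarrow> 'a" where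
  "entrance_map T U x = (T ^^ entrance_time T U 1 x) x"

lemma entrance_time_1:
  assumes "s > 0" "(T ^^ s) x \<in> U"
  shows "entrance_time T U 1 x > 0" "(T ^^ entrance_time T U 1 x) x \<in> U"
    "\<And>r. 0 < r \<Longrightarrow> (T ^^ r) x \<in> U \<Longrightarrow> entrance_time T U 1 x \<le> r"
proof -
  let ?S = "{s. s > 0 \<and> (T ^^ s) x \<in> U}"
  have eq: "entrance_time T U 1 x = Inf ?S" by simp
  have "Inf ?S \<in> ?S" using assms by (intro Inf_nat_def1) auto
  then show "entrance_time T U 1 x > 0" "(T ^^ entrance_time T U 1 x) x \<in> U"
    unfolding eq by auto
  show "entrance_time T U 1 x \<le> r" if "0 < r" "(T ^^ r) x \<in> U" for r
    unfolding eq using that by (intro cInf_lower) auto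
qed

lemma entrance_time_1_eqI:
  assumes "s > 0" "(T ^^ s) x \<in> U" "\<And>r. 0 < r \<Longrightarrow> r < s \<Longrightarrow> (T ^^ r) x \<notin> U"
  shows "entrance_time T U 1 x = s"
  using entrance_time_1[of s T x U] assms by (metis le_neq_implies_less)

text \<open>
  After the \<open>k\<close>-th entrance the clock is restarted at the point of entrance.
\<close>

lemma entrance_time_Suc:
  assumes "\<exists>s>0. (T ^^ s) ((T ^^ entrance_time T U k x) x) \<in> U"
  shows "entrance_time T U (Suc k) x =
    entrance_time T U k x + entrance_time T U 1 ((T ^^ entrance_time T U k x) x)"
proof -
  let ?a = "entrance_time T U k x"
  let ?S = "{s. s > 0 \<and> (T ^^ s) ((T ^^ ?a) x) \<in> U}"
  have "{s. s > ?a \<and> (T ^^ s) x \<in> U} = (\<lambda>s. ?a + s) ` ?S"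
  proof (intro equalityI subsetI)
    fix s assume s: "s \<in> {s. s > ?a \<and> (T ^^ s) x \<in> U}"
    then have "(T ^^ (s - ?a)) ((T ^^ ?a) x) \<in> U"
      using funpow_add[of "s - ?a" ?a T] by simp
    then show "s \<in> (\<lambda>s. ?a + s) ` ?S" using s by (intro image_eqI[of _ _ "s - ?a"]) auto
  qed (auto simp: funpow_add add.commute[of ?a])
  moreover have "Inf ((\<lambda>s. ?a + s) ` ?S) = ?a + Inf ?S"
  proof -
    have "?S \<noteq> {}" using assms by auto
    then have "Inf ?S \<in> ?S" by (rule Inf_nat_def1)
    then show ?thesis by (intro cInf_eq_minimum) (auto intro: cInf_lower)
  qed
  ultimately show ?thesis by simp
qed

lemma entrance_time_iterate:
  assumes T: "\<And>x. x \<in> X \<Longrightarrow> T x \<in> X" and rec: "\<And>x. x \<in> X \<Longrightarrow> \<exists>s>0. (T ^^ s) x \<in> U"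
    and x: "x \<in> X"
  shows "(entrance_map T U ^^ k) x \<in> X"
    and "(T ^^ entrance_time T U k x) x = (entrance_map T U ^^ k) x"
    and "entrance_time T U (Suc k) x =
      entrance_time T U k x + entrance_time T U 1 ((entrance_map T U ^^ k) x)"
proof -
  have TX: "(T ^^ s) y \<in> X" if "y \<in> X" for s y
    using that by (induction s) (auto intro: T)
  have E: "entrance_map T U y \<in> X" if "y \<in> X" for y
    using TX[OF that] by (simp add: entrance_map_def)
  show X: "(entrance_map T U ^^ k) x \<in> X" for k
    using x by (induction k) (auto intro: E)
  have *: "(T ^^ entrance_time T U k x) x = (entrance_map T U ^^ k) x" for k
  proof (induction k)
    case (Suc k)
    have "\<exists>s>0. (T ^^ s) ((T ^^ entrance_time T U k x) x) \<in> U"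
      using rec TX[OF x] by blast
    from entrance_time_Suc[OF this] Suc.IH
    have "entrance_time T U (Suc k) x =
        entrance_time T U 1 ((entrance_map T U ^^ k) x) + entrance_time T U k x" by simp
    then have "(T ^^ entrance_time T U (Suc k) x) x =
        (T ^^ entrance_time T U 1 ((entrance_map T U ^^ k) x)) ((T ^^ entrance_time T U k x) x)"
      by (simp only: funpow_add o_apply)
    also have "\<dots> = entrance_map T U ((entrance_map T U ^^ k) x)"
      unfolding Suc.IH by (rule entrance_map_def[symmetric])
    finally show ?case by simp
  qed simp
  show "(T ^^ entrance_time T U k x) x = (entrance_map T U ^^ k) x" by (rule *)
  have "\<exists>s>0. (T ^^ s) ((T ^^ entrance_time T U k x) x) \<in> U"
    using rec TX[OF x] by blast
  from entrance_time_Suc[OF this]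
  show "entrance_time T U (Suc k) x =
      entrance_time T U k x + entrance_time T U 1 ((entrance_map T U ^^ k) x)"
    by (simp only: *)
qed

section \<open>Returns to a vertex of the first level\<close>

abbreviation at_vertex :: "('v, 'e) bratteli \<Rightarrow> 'v \<Rightarrow> (nat \<Rightarrow> 'e) set" where
  "at_vertex B i \<equiv> {y. vtx B y 1 = i}"

context stationary_bratteli
begin

lemma tower_height_1:
  assumes "v \<in> {1..m}"
  shows "tower_height B 1 v = 1"
proof -
  obtain e where "e \<in> edges B 1" "tgt B 1 e = v" using first_edges[OF assms] by auto
  then have "into B 1 v = {e}" using into_1 by auto
  then show ?thesis by simp
qed

lemma address_1: "x \<in> X \<Longrightarrow> address B 1 x = 0"
  using first_edge_min path_edge[of x 1] by (intro address_min) (auto simp: le_antisym)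

lemma address_2:
  assumes x: "x \<in> X"
  shows "address B 2 x = card (below B 2 (x 2))"
proof -
  have "tower_height B 1 (src B 2 e) = 1" if "e \<in> below B 2 (x 2)" for e
    using src_in[of 2 e] below_edge[OF that] verts_eq[of 1] by (intro tower_height_1) simp
  then have "(\<Sum>e\<in>below B 2 (x 2). tower_height B 1 (src B 2 e)) = card (below B 2 (x 2))"
    by simp
  then show ?thesis using address_1[OF x] by (simp add: numeral_2_eq_2)
qed

lemma tower_height_vtx_mono:
  assumes x: "x \<in> X" and "k \<le> q"
  shows "tower_height B k (vtx B x k) \<le> tower_height B q (vtx B x q)"
  using assms(2)
proof (induction q rule: dec_induct)
  case (step q)
  have "x (Suc q) \<in> into B (Suc q) (vtx B x (Suc q))"
    using path_edge[OF x, of "Suc q"] tgt_eq_vtx[OF x, of "Suc q"] by (simp add: into_def)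
  then have "tower_height B q (vtx B x q) \<le> tower_height B (Suc q) (vtx B x (Suc q))"
    using member_le_sum[of "x (Suc q)" "into B (Suc q) (vtx B x (Suc q))"
        "\<lambda>e. tower_height B q (src B (Suc q) e)"] by (simp add: vtx_def)
  then show ?case using step.IH by simp
qed simp

text \<open>
  The first vertex of the image depends on the edge of level \<open>2\<close> alone: it is the source of the
  successor of that edge or, if the edge is maximal, the source of a minimal edge, which is \<open>1\<close>.
\<close>

lemma vtx_vershik_cong:
  assumes x: "x \<in> X" and y: "y \<in> X" and eq: "x 2 = y 2"
  shows "vtx B (T x) 1 = vtx B (T y) 1"
proof -
  have max1: "is_max_edge B 1 (u 1)" if "u \<in> X" for u
    using first_edge_max path_edge[OF that, of 1] by simp
  show ?thesis
  proof (cases "is_max_edge B 2 (x 2)")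
    case True
    have "vtx B (T u) 1 = 1" if u: "u \<in> X" "is_max_edge B 2 (u 2)" for u
    proof -
      have "\<forall>i\<in>{1..2}. is_max_edge B i (u i)"
        using max1[OF u(1)] u(2) by (auto simp: le_Suc_eq numeral_2_eq_2)
      from vershik_all_max[OF u(1) this, of 2] show ?thesis
        using min_edge_src[of 2] by (simp add: vtx_def numeral_2_eq_2)
    qed
    then show ?thesis using x y eq True by simp
  next
    case False
    have "T u 2 = edge_succ B 2 (u 2)"
      if u: "u \<in> X" "\<not> is_max_edge B 2 (u 2)" for u
    proof -
      have "\<forall>i\<in>{1..<2}. is_max_edge B i (u i)"
        using max1[OF u(1)] by (auto simp: less_Suc_eq numeral_2_eq_2)
      from vershik_image_at_vershik[OF u(1) _ this u(2)] show ?thesis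
        by (simp add: vershik_image_at_def)
    qed
    then show ?thesis using x y eq False by (simp add: vtx_def numeral_2_eq_2)
  qed
qed

text \<open>
  By positivity of the incidence matrix some edge leads from \<open>i\<close> to the vertex of \<open>w\<close> at level \<open>2\<close>.  As
  towers of level \<open>1\<close> have height one, the floors of a tower of level \<open>2\<close> are the edges into its vertex, so
  that edge is met after as many steps as it has predecessors.
\<close>

lemma visit_in_tower:
  assumes w: "w \<in> X" and "address B 2 w = 0" and i: "i \<in> {1..m}"
  obtains u where "u < tower_height B 2 (vtx B w 2)" "vtx B ((T ^^ u) w) 1 = i"
proof -
  have j: "vtx B w 2 \<in> {1..m}" using vtx_range[OF w] by simp
  then have "{e \<in> edges B 2. src B 2 e = i \<and> tgt B 2 e = vtx B w 2} \<noteq> {}"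
    using incidence_pos[OF i j] by (force simp: incidence_def)
  then obtain e where e: "e \<in> edges B 2" "src B 2 e = i" "tgt B 2 e = vtx B w 2" by blast
  define u where "u = card (below B 2 e)"
  have h1: "tower_height B 1 (src B 2 f) = 1" if "f \<in> edges B 2" for f
    using src_in[of 2 f] that verts_eq[of 1] by (intro tower_height_1) simp
  have "card (insert e (below B 2 e)) \<le> card (into B 2 (vtx B w 2))"
    using insert_below_subset_into[of 2 e] e by (intro card_mono) auto
  also have "\<dots> = tower_height B 2 (vtx B w 2)"
    using h1 by (simp add: numeral_2_eq_2 into_def)
  finally have u: "u < tower_height B 2 (vtx B w 2)" by (simp add: u_def)
  let ?x = "(T ^^ u) w"
  have x: "?x \<in> X" using w by (rule funpow_vershik_in)
  have "address B 2 ?x = u \<and> shift_path B 2 ?x = shift_path B 2 w"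
    using tower_orbit[OF w, of 2 0 u u] u assms(2) vtx_shift_path_1[OF w, of 2] by simp
  then have *: "card (below B 2 (?x 2)) = card (below B 2 e)" "vtx B ?x 2 = vtx B w 2"
    using address_2[OF x] vtx_shift_path_1[OF w, of 2] vtx_shift_path_1[OF x, of 2]
    by (auto simp: u_def)
  have x2: "?x 2 \<in> edges B 2" "tgt B 2 (?x 2) = tgt B 2 e"
    using path_edge[OF x, of 2] tgt_eq_vtx[OF x, of 2] * e by auto
  have lt: "card (below B 2 f) < card (below B 2 g)" if "f \<in> below B 2 g" for f g
  proof (rule psubset_card_mono)
    show "below B 2 f \<subset> below B 2 g"
      using insert_below_subset_below[of 2 f g] that self_notin_below by fastforce
  qed simp
  have "?x 2 = e"
    using below_linear[of 2 "?x 2" e] x2 e(1) lt[of "?x 2" e] lt[of e "?x 2"] *(1) by auto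
  then have "vtx B ?x 1 = i" using e by (simp add: vtx_def numeral_2_eq_2)
  then show ?thesis using that u by blast
qed

text \<open>
  After its first crossing the orbit is at the bottom of a tower of level \<open>q\<close>, hence of one of level \<open>2\<close>,
  and the latter contains the vertex \<open>i\<close> and is not higher.
\<close>

lemma visit_before_second_crossing:
  assumes y: "y \<in> X" and q: "q \<ge> 2" and i: "i \<in> {1..m}"
  obtains s where "s > 0" "address B q y + s < ladder B q (shift_path B q y) 2"
    "vtx B ((T ^^ s) y) 1 = i"
proof -
  let ?y = "shift_path B q y"
  have q1: "q \<ge> 1" using q by simp
  define s where "s = ladder B q ?y 1 - address B q y"
  have lt: "address B q y < ladder B q ?y 1"
    using address_less_height[OF y, of q] vtx_shift_path_1[OF y q1] by simp
  let ?w = "(T ^^ s) y"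
  have w: "?w \<in> X" using y by (rule funpow_vershik_in)
  have "vtx B ((T ^^ 1) ?y) 1 \<in> verts B q"
    using vtx_range[OF funpow_vershik_in[OF shift_path_in[OF y q1]], of 1 1] verts_eq[OF q1] by simp
  then have "address B q ?w = 0 \<and> shift_path B q ?w = (T ^^ 1) ?y"
    using lt height_pos by (intro tower_orbit[OF y q1]) (auto simp: s_def)
  then have 0: "address B q ?w = 0" and sw: "shift_path B q ?w = (T ^^ 1) ?y" by auto
  have "address B 2 ?w = 0"
    using address_0_imp_min[OF w 0] q by (intro address_min) auto
  then obtain u where u: "u < tower_height B 2 (vtx B ?w 2)" "vtx B ((T ^^ u) ?w) 1 = i"
    using visit_in_tower[OF w _ i] by blast
  have "u < tower_height B q (vtx B ((T ^^ 1) ?y) 1)"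
    using u(1) tower_height_vtx_mono[OF w q] vtx_shift_path_1[OF w q1] sw by simp
  then have "address B q y + (u + s) < ladder B q ?y 2"
    using lt by (simp add: numeral_2_eq_2 s_def)
  then show ?thesis using that[of "u + s"] lt u(2) by (simp add: s_def funpow_add)
qed

text \<open>
  Up to the first crossing of the top of the tower of level \<open>q\<close> both orbits climb the same tower.  Between
  the first and the second crossing they again climb equal towers, because the vertex behind the crossing
  depends on the common edge of level \<open>q + 1\<close> only.
\<close>

lemma orbit_agree:
  assumes y: "y \<in> X" and y': "y' \<in> X" and q: "q \<ge> 2"
    and eq: "\<And>j. j \<in> {1..Suc q} \<Longrightarrow> y j = y' j"
    and s: "address B q y + s < ladder B q (shift_path B q y) 2"
  shows "\<forall>j\<in>{1..q}. (T ^^ s) y j = (T ^^ s) y' j"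
proof -
  have q1: "q \<ge> 1" using q by simp
  let ?u = "shift_path B q y" and ?u' = "shift_path B q y'"
  note u = shift_path_in[OF y q1] and u' = shift_path_in[OF y' q1]
  have a: "address B q y = address B q y'" using eq by (intro address_cong) auto
  have "vtx B ?u 1 = vtx B ?u' 1"
    using vtx_shift_path_1[OF y q1] vtx_shift_path_1[OF y' q1] eq[of "Suc q"] by (simp add: vtx_def)
  moreover have "vtx B (T ?u) 1 = vtx B (T ?u') 1"
    using eq[of "Suc q"] q by (intro vtx_vershik_cong[OF u u']) (simp add: shift_path_ge2)
  ultimately have v: "vtx B ((T ^^ k) ?u) 1 = vtx B ((T ^^ k) ?u') 1"
    if "k < 2" for k using that by (auto simp: less_Suc_eq numeral_2_eq_2)
  obtain k t where kt: "ladder B q ?u k + t = address B q y + s"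
    "t < tower_height B q (vtx B ((T ^^ k) ?u) 1)"
    "address B q ((T ^^ s) y) = t"
    "shift_path B q ((T ^^ s) y) = (T ^^ k) ?u"
    using tower_orbit_exists[OF y q1, of s] by auto
  have k: "k < 2"
  proof (rule ccontr)
    assume "\<not> k < 2"
    then show False using kt(1) s ladder_mono[of 2 k B q ?u] by simp
  qed
  have "ladder B q ?u k = ladder B q ?u' k"
    unfolding ladder_def using v k by (intro sum.cong) auto
  then have *: "address B q ((T ^^ s) y') = t \<and>
      shift_path B q ((T ^^ s) y') = (T ^^ k) ?u'"
    using kt v[OF k] a by (intro tower_orbit[OF y' q1]) auto
  note x = funpow_vershik_in[OF y, of s] and x' = funpow_vershik_in[OF y', of s]
  show ?thesis
    using * kt v[OF k] vtx_shift_path_1[OF x q1] vtx_shift_path_1[OF x' q1]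
    by (intro address_eq_imp_agree[OF x x']) simp_all
qed

lemma at_vertex_recurrent:
  assumes "y \<in> X" "i \<in> {1..m}"
  shows "\<exists>s>0. (T ^^ s) y \<in> at_vertex B i"
  using visit_before_second_crossing[OF assms(1) order_refl assms(2)] by blast

text \<open>
  One return costs one level of information: both points meet the vertex \<open>i\<close> before the second crossing of
  level \<open>q\<close>, and till then their orbits agree up to level \<open>q\<close>, in particular in the first vertex.
\<close>

lemma entrance_agree:
  assumes y: "y \<in> X" and y': "y' \<in> X" and q: "q \<ge> 2" and i: "i \<in> {1..m}"
    and eq: "\<And>j. j \<in> {1..Suc q} \<Longrightarrow> y j = y' j"
  defines "N \<equiv> entrance_time T (at_vertex B i) 1"
  shows "N y' = N y"
    and "s \<le> N y \<Longrightarrow> j \<in> {1..q} \<Longrightarrow> (T ^^ s) y j = (T ^^ s) y' j"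
proof -
  obtain t where t: "t > 0" "address B q y + t < ladder B q (shift_path B q y) 2"
    "vtx B ((T ^^ t) y) 1 = i"
    using visit_before_second_crossing[OF y q i] by blast
  have mem: "(T ^^ t) y \<in> at_vertex B i" using t(3) by simp
  note N = entrance_time_1[OF t(1) mem, folded N_def]
  have "N y \<le> t" using N(3)[OF t(1) mem] .
  then have agree: "\<forall>j\<in>{1..q}. (T ^^ s) y j = (T ^^ s) y' j" if "s \<le> N y" for s
    using that t(2) by (intro orbit_agree[OF y y' q eq]) auto
  then show "s \<le> N y \<Longrightarrow> j \<in> {1..q} \<Longrightarrow> (T ^^ s) y j = (T ^^ s) y' j" by blast
  have v: "vtx B ((T ^^ s) y) 1 = vtx B ((T ^^ s) y') 1" if "s \<le> N y" for s
    using agree[OF that] q by (simp add: vtx_def)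
  show "N y' = N y"
    unfolding N_def
  proof (rule entrance_time_1_eqI)
    show "entrance_time T (at_vertex B i) 1 y > 0" using N(1) by (simp add: N_def)
    show "(T ^^ entrance_time T (at_vertex B i) 1 y) y' \<in> at_vertex B i"
      using N(2) v[of "N y"] by (simp add: N_def)
    fix r assume r: "0 < r" "r < entrance_time T (at_vertex B i) 1 y"
    then have "r < N y" by (simp add: N_def)
    then have "(T ^^ r) y \<notin> at_vertex B i" using N(3)[OF r(1)] by auto
    then show "(T ^^ r) y' \<notin> at_vertex B i" using v[of r] \<open>r < N y\<close> by simp
  qed
qed

lemma entrance_map_in: "y \<in> X \<Longrightarrow> entrance_map T U y \<in> X"
  by (simp add: entrance_map_def funpow_vershik_in del: entrance_time.simps)

lemma entrance_map_iterate_agree: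
  assumes "y \<in> X" "y' \<in> X" and q: "q \<ge> 2" and i: "i \<in> {1..m}"
    and "\<And>j. j \<in> {1..q + k} \<Longrightarrow> y j = y' j" and "j \<in> {1..q}"
  shows "(entrance_map T (at_vertex B i) ^^ k) y j =
    (entrance_map T (at_vertex B i) ^^ k) y' j"
  using assms(1,2,5,6)
proof (induction k arbitrary: y y')
  case (Suc k)
  let ?E = "entrance_map T (at_vertex B i)"
  have "?E y j = ?E y' j" if "j \<in> {1..q + k}" for j
    using entrance_agree[OF Suc.prems(1,2) _ i, of "q + k"] Suc.prems(3) q that
    by (simp add: entrance_map_def del: entrance_time.simps)
  then have "(?E ^^ k) (?E y) j = (?E ^^ k) (?E y') j"
    using Suc.prems by (intro Suc.IH entrance_map_in) auto
  then show ?case by (simp add: funpow_swap1)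
qed simp

end

section \<open>Cylinders\<close>

lemma length_prefix [simp]: "length (prefix x n) = n"
  by (simp add: prefix_def del: upt_Suc)

lemma nth_prefix: "j < n \<Longrightarrow> prefix x n ! j = x (Suc j)"
  unfolding prefix_def by (subst nth_map) (simp_all del: upt_Suc)

lemma last_prefix: "n \<ge> 1 \<Longrightarrow> last (prefix x n) = x n"
  by (cases n) (simp_all add: prefix_def)

lemma prefix_eq_iff: "prefix x (length p) = p \<longleftrightarrow> (\<forall>j<length p. x (Suc j) = p ! j)"
  unfolding list_eq_iff_nth_eq[of "prefix x (length p)"] by (simp add: nth_prefix)

lemma in_cyl_at_iff:
  "z \<in> cyl_at B xs n p \<longleftrightarrow>
    z \<in> path_space B \<and> (\<forall>j\<in>{1..n}. z j = xs j) \<and> (\<forall>j<length p. z (Suc n + j) = p ! j)"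
proof -
  have "(\<forall>j<n + length p. z (Suc j) = (prefix xs n @ p) ! j) \<longleftrightarrow>
      (\<forall>j\<in>{1..n}. z j = xs j) \<and> (\<forall>j<length p. z (Suc n + j) = p ! j)" (is "?L \<longleftrightarrow> ?R")
  proof
    assume L: ?L
    have "z j = xs j" if j: "j \<in> {1..n}" for j
    proof -
      obtain i where "j = Suc i" "i < n" using j by (cases j) auto
      then show ?thesis using L[rule_format, of i] by (simp add: nth_append nth_prefix)
    qed
    moreover have "z (Suc n + j) = p ! j" if "j < length p" for j
      using L[rule_format, of "n + j"] that by (simp add: nth_append)
    ultimately show ?R by blast
  next
    assume R: ?R
    show ?L
    proof (intro allI impI)
      fix j assume j: "j < n + length p"
      show "z (Suc j) = (prefix xs n @ p) ! j"
      proof (cases "j < n")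
        case True
        then show ?thesis using R by (simp add: nth_append nth_prefix)
      next
        case False
        then have "j - n < length p" using j by simp
        then have "z (Suc n + (j - n)) = p ! (j - n)" using R by blast
        then show ?thesis using False by (simp add: nth_append)
      qed
    qed
  qed
  then show ?thesis
    using prefix_eq_iff[of z "prefix xs n @ p"] by (simp add: cyl_at_def cylinder_def)
qed

context ordered_bratteli
begin

lemma in_initial_cylinder_iff:
  assumes xs: "xs \<in> X" and n: "n \<ge> 1"
  shows "z \<in> cyl_at B xs n [] \<longleftrightarrow>
    z \<in> X \<and> address B n z = address B n xs \<and> vtx B z n = vtx B xs n"
proof
  assume "z \<in> cyl_at B xs n []"
  then have z: "z \<in> X" and eq: "\<forall>j\<in>{1..n}. z j = xs j" by (auto simp: in_cyl_at_iff)
  have "vtx B z n = vtx B xs n"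
    using eq n tgt_eq_vtx[OF z n] tgt_eq_vtx[OF xs n] by simp
  moreover have "address B n z = address B n xs" using eq by (intro address_cong) auto
  ultimately show "z \<in> X \<and> address B n z = address B n xs \<and> vtx B z n = vtx B xs n"
    using z by simp
next
  assume *: "z \<in> X \<and> address B n z = address B n xs \<and> vtx B z n = vtx B xs n"
  then have "\<forall>j\<in>{1..n}. z j = xs j" using xs by (intro address_eq_imp_agree) auto
  then show "z \<in> cyl_at B xs n []" using * by (auto simp: in_cyl_at_iff)
qed

lemma prefix_in_paths: "z \<in> X \<Longrightarrow> prefix z n \<in> paths B 1 n"
  by (auto simp: paths_def nth_prefix path_space_iff)

text \<open>
  Every vertex is the source of some edge, so that finite paths extend to infinite ones.
\<close>

lemma path_extends:
  assumes p: "p \<in> paths B 1 n" and n: "n \<ge> 1"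
  shows "cylinder B p \<noteq> {}"
proof -
  have len: "length p = n" and pe: "\<And>i. i < n \<Longrightarrow> p ! i \<in> edges B (Suc i)"
    and pt: "\<And>i. Suc i < n \<Longrightarrow> tgt B (Suc i) (p ! i) = src B (Suc (Suc i)) (p ! Suc i)"
    using p by (auto simp: paths_def)
  have "\<exists>f. \<forall>d. (f d \<in> edges B (n + d) \<and> (d = 0 \<longrightarrow> f d = p ! (n - 1))) \<and>
      src B (Suc (n + d)) (f (Suc d)) = tgt B (n + d) (f d)"
  proof (rule dependent_nat_choice)
    show "\<exists>e. e \<in> edges B (n + 0) \<and> (0 = (0::nat) \<longrightarrow> e = p ! (n - 1))"
      using pe[of "n - 1"] n by auto
  next
    fix e d assume "e \<in> edges B (n + d) \<and> (d = 0 \<longrightarrow> e = p ! (n - 1))"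
    then have "tgt B (n + d) e \<in> verts B (n + d)" using tgt_in[of "n + d" e] n by simp
    from src_onto[OF this]
    show "\<exists>e'. (e' \<in> edges B (n + Suc d) \<and> (Suc d = 0 \<longrightarrow> e' = p ! (n - 1))) \<and>
      src B (Suc (n + d)) e' = tgt B (n + d) e" by auto
  qed
  then obtain f where f: "\<And>d. f d \<in> edges B (n + d)" "f 0 = p ! (n - 1)"
    "\<And>d. src B (Suc (n + d)) (f (Suc d)) = tgt B (n + d) (f d)" by metis
  define x where "x k = (if k = 0 then undefined else if k \<le> n then p ! (k - 1) else f (k - n))" for k
  have "x k \<in> edges B k \<and> tgt B k (x k) = src B (Suc k) (x (Suc k))" if k: "k \<ge> 1" for k
  proof -
    consider "k < n" | "k \<ge> n" by linarith
    then show ?thesis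
    proof cases
      case 1
      then show ?thesis using k pe[of "k - 1"] pt[of "k - 1"] by (simp add: x_def)
    next
      case 2
      have "x k = f (k - n)" using 2 f(2) n by (auto simp: x_def)
      then show ?thesis using 2 f(1)[of "k - n"] f(3)[of "k - n"] by (simp add: x_def Suc_diff_le)
    qed
  qed
  then have "x \<in> X" by (auto simp: path_space_iff x_def)
  moreover have "prefix x (length p) = p"
    unfolding prefix_eq_iff using len by (simp add: x_def)
  ultimately have "x \<in> cylinder B p" by (simp add: cylinder_def)
  then show ?thesis by blast
qed

text \<open>
  The cylinder of the minimal path to \<open>i\<close> is the bottom floor of the tower of \<open>i\<close>.
\<close>

lemma in_cylinder_min_path_to_iff:
  assumes n: "n \<ge> 1" and i: "i \<in> verts B n"
  shows "z \<in> cylinder B (min_path_to B n i) \<longleftrightarrow>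
    z \<in> X \<and> address B n z = 0 \<and> vtx B z n = i"
proof -
  let ?P = "\<lambda>p. p \<in> paths B 1 n \<and> (\<forall>a<length p. is_min_edge B (Suc a) (p ! a)) \<and>
    tgt B n (last p) = i"
  have min: "\<forall>j\<in>{1..n}. is_min_edge B j (p ! (j - 1))" if p: "?P p" for p
  proof
    fix j assume "j \<in> {1..n}"
    then obtain a where "j = Suc a" "a < length p" using p by (cases j) (auto simp: paths_def)
    then show "is_min_edge B j (p ! (j - 1))" using p by simp
  qed
  have link: "\<forall>j. 1 \<le> j \<and> j < n \<longrightarrow> tgt B j (p ! (j - 1)) = src B (Suc j) (p ! (Suc j - 1))"
    if p: "?P p" for p
  proof (intro allI impI)
    fix j assume "1 \<le> j \<and> j < n"
    then obtain a where "j = Suc a" "Suc a < length p" using p by (cases j) (auto simp: paths_def)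
    then show "tgt B j (p ! (j - 1)) = src B (Suc j) (p ! (Suc j - 1))"
      using conjunct1[OF p] by (simp add: paths_def)
  qed
  have uniq: "p = q" if p: "?P p" and q: "?P q" for p q
  proof -
    have len: "length p = n" "length q = n" using p q by (auto simp: paths_def)
    have last: "last p = p ! (n - 1)" "last q = q ! (n - 1)"
      using len n last_conv_nth[of p] last_conv_nth[of q] by force+
    have "\<forall>j\<in>{1..n}. p ! (j - 1) = q ! (j - 1)"
      using minimal_path_unique[OF min[OF p] min[OF q] link[OF p] link[OF q]] p q last by simp
    then have "p ! j = q ! j" if "j < n" for j
      using that by (metis Suc_leI atLeastAtMost_iff diff_Suc_1 le_add1 plus_1_eq_Suc)
    then show ?thesis using len by (intro nth_equalityI) auto
  qed
  have pre: "?P (prefix z n)" if z: "z \<in> X" "address B n z = 0" "vtx B z n = i" for z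
  proof (intro conjI allI impI)
    show "prefix z n \<in> paths B 1 n" using z(1) by (rule prefix_in_paths)
    show "is_min_edge B (Suc a) (prefix z n ! a)" if "a < length (prefix z n)" for a
      using address_0_imp_min[OF z(1,2), of "Suc a"] that by (simp add: nth_prefix)
    have "last (prefix z n) = z n"
      using n by (rule last_prefix)
    then show "tgt B n (last (prefix z n)) = i" using tgt_eq_vtx[OF z(1) n] z(3) by simp
  qed
  obtain p where p: "\<forall>i\<in>{1..n}. is_min_edge B i (p i)"
    "\<forall>i. 1 \<le> i \<and> i < n \<longrightarrow> tgt B i (p i) = src B (Suc i) (p (Suc i))" "tgt B n (p n) = i"
    using ex_minimal_path[OF i] n by auto
  have "last (prefix p n) = p n"
    using n by (rule last_prefix)
  then have "?P (prefix p n)"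
    using p n by (auto simp: paths_def nth_prefix is_min_edge_def)
  then have P: "?P (min_path_to B n i)"
    unfolding min_path_to_def using uniq by (intro theI[of ?P "prefix p n"]) auto
  have len: "length (min_path_to B n i) = n" using P by (simp add: paths_def)
  show ?thesis
  proof
    assume "z \<in> cylinder B (min_path_to B n i)"
    then have z: "z \<in> X" and eq: "\<forall>j<n. z (Suc j) = min_path_to B n i ! j"
      using prefix_eq_iff[of z "min_path_to B n i"] len by (auto simp: cylinder_def)
    have "is_min_edge B j (z j)" if j: "1 \<le> j" "j \<le> n" for j
    proof -
      obtain a where "j = Suc a" "a < n" using j by (cases j) auto
      then show ?thesis using P eq len by simp
    qed
    then have "address B n z = 0" by (intro address_min) auto
    moreover have "last (min_path_to B n i) = z n"
      using n len eq[rule_format, of "n - 1"] last_conv_nth[of "min_path_to B n i"] by force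
    ultimately show "z \<in> X \<and> address B n z = 0 \<and> vtx B z n = i"
      using z P tgt_eq_vtx[OF z n] by simp
  next
    assume *: "z \<in> X \<and> address B n z = 0 \<and> vtx B z n = i"
    then have "prefix z n = min_path_to B n i" using pre P uniq by blast
    then show "z \<in> cylinder B (min_path_to B n i)" using * len by (simp add: cylinder_def)
  qed
qed

end

text \<open>
  Paths of \<open>k\<close> edges from the vertex \<open>i\<close> of some level \<open>n \<ge> 1\<close>, written, as the levels are identified, with
  edges of the levels \<open>2\<close> to \<open>k + 1\<close>.
\<close>

definition paths_from :: "('v, 'e) bratteli \<Rightarrow> 'v \<Rightarrow> nat \<Rightarrow> 'e list set" where
  "paths_from B i k = {p \<in> paths B 2 (Suc k). src B 2 (hd p) = i}"

context stationary_bratteli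
begin

text \<open>
  The levels are gone from the right-hand side; this is what carries a path from one level to another.
\<close>

lemma paths_from_iff:
  assumes "k \<ge> 1"
  shows "p \<in> paths_from B i k \<longleftrightarrow> length p = k \<and> set p \<subseteq> edges B 2 \<and> src B 2 (p ! 0) = i \<and>
    (\<forall>j. Suc j < k \<longrightarrow> tgt B 2 (p ! j) = src B 2 (p ! Suc j))"
proof -
  have "hd p = p ! 0" if "length p = k" using that assms by (intro hd_conv_nth) auto
  moreover have "(\<forall>j<k. p ! j \<in> edges B (2 + j)) \<longleftrightarrow> set p \<subseteq> edges B 2" if "length p = k"
    using edges_eq[of "2 + _"] that by (auto simp: in_set_conv_nth subset_iff)
  moreover have "tgt B (2 + j) (p ! j) = tgt B 2 (p ! j)" "src B (2 + j) (p ! j) = src B 2 (p ! j)"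
    if "set p \<subseteq> edges B 2" "j < length p" for j
    using that tgt_eq[of "2 + j" "p ! j"] src_eq[of "2 + j" "p ! j"] by (auto simp: subset_iff)
  moreover have "src B (2 + Suc j) (p ! Suc j) = src B 2 (p ! Suc j)"
    if "set p \<subseteq> edges B 2" "Suc j < length p" for j
    using that src_eq[of "2 + Suc j" "p ! Suc j"] by (auto simp: subset_iff)
  ultimately show ?thesis
    unfolding paths_from_def paths_def mem_Collect_eq by (auto simp: subset_iff)
qed

lemma paths_from_nonempty: "k \<ge> 1 \<Longrightarrow> p \<in> paths_from B i k \<Longrightarrow> p \<noteq> []"
  by (auto simp: paths_from_iff)

lemma finite_paths_from: "k \<ge> 1 \<Longrightarrow> finite (paths_from B i k)"
  by (rule finite_subset[OF _ finite_lists_length_eq[of "edges B 2" k]])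
    (auto simp: paths_from_iff finite_edges)

lemma edge_pairs_eq: "edge_pairs B i = paths_from B i 2"
  by (simp add: edge_pairs_def paths_from_def numeral_3_eq_3 numeral_2_eq_2)

lemma take_paths_from:
  assumes "p \<in> paths_from B i k" "1 \<le> j" "j \<le> k"
  shows "take j p \<in> paths_from B i j"
  using assms set_take_subset[of j p] by (auto simp: paths_from_iff)

lemma segment_in_paths_from:
  assumes z: "z \<in> X" and n: "n \<ge> 1" and k: "k \<ge> 1"
  shows "map z [Suc n..<Suc n + k] \<in> paths_from B (vtx B z n) k"
proof -
  have e: "z j \<in> edges B 2" if "j > n" for j
    using path_edge[OF z, of j] edges_eq[of j] that n by simp
  have t: "tgt B 2 (z j) = src B 2 (z (Suc j))" if "j > n" for j
    using tgt_eq_vtx[OF z, of j] tgt_level[of j "z j"] src_level[of "Suc j" "z (Suc j)"]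
      path_edge[OF z] that n by (simp add: vtx_def)
  have "vtx B z n = src B 2 (z (Suc n))"
    using src_level[of "Suc n" "z (Suc n)"] path_edge[OF z] n by (simp add: vtx_def)
  then show ?thesis
    using k e t by (auto simp: paths_from_iff simp del: upt_Suc)
qed

lemma prefix_append_in_paths:
  assumes x: "x \<in> X" and n: "n \<ge> 1" and k: "k \<ge> 1" and p: "p \<in> paths_from B (vtx B x n) k"
  shows "prefix x n @ p \<in> paths B 1 (n + k)"
    and "tgt B (n + k) (last p) = tgt B (Suc k) (last p)"
proof -
  have len: "length p = k" and sub: "set p \<subseteq> edges B 2" and s0: "src B 2 (p ! 0) = vtx B x n"
    and t: "\<And>j. Suc j < k \<Longrightarrow> tgt B 2 (p ! j) = src B 2 (p ! Suc j)"
    using p k by (auto simp: paths_from_iff)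
  have lev: "p ! j \<in> edges B (Suc (n + j)) \<and> tgt B (Suc (n + j)) (p ! j) = tgt B 2 (p ! j) \<and>
      src B (Suc (n + j)) (p ! j) = src B 2 (p ! j)" if "j < k" for j
  proof -
    have "p ! j \<in> edges B 2" using sub that len by auto
    then show ?thesis
      using edges_eq[of "Suc (n + j)"] tgt_eq[of "Suc (n + j)"] src_eq[of "Suc (n + j)"] n by simp
  qed
  show "prefix x n @ p \<in> paths B 1 (n + k)"
    unfolding paths_def mem_Collect_eq
  proof (intro conjI allI impI)
    show "length (prefix x n @ p) = Suc (n + k) - 1" using len by simp
    fix i
    show "(prefix x n @ p) ! i \<in> edges B (1 + i)" if i: "i < length (prefix x n @ p)"
    proof (cases "i < n")
      case True
      then show ?thesis using path_edge[OF x, of "Suc i"] by (simp add: nth_append nth_prefix)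
    next
      case False
      then show ?thesis using lev[of "i - n"] i len by (simp add: nth_append)
    qed
    show "tgt B (1 + i) ((prefix x n @ p) ! i) = src B (1 + Suc i) ((prefix x n @ p) ! Suc i)"
      if i: "Suc i < length (prefix x n @ p)"
    proof -
      consider "Suc i < n" | "Suc i = n" | "i \<ge> n" by linarith
      then show ?thesis
      proof cases
        case 1
        then show ?thesis using x by (simp add: nth_append nth_prefix path_space_iff)
      next
        case 2
        then have "tgt B n (x n) = src B (Suc n) (p ! 0)"
          using tgt_eq_vtx[OF x n] s0 lev[of 0] k by simp
        then show ?thesis using 2 by (auto simp: nth_append nth_prefix)
      next
        case 3
        then show ?thesis
          using lev[of "i - n"] lev[of "Suc i - n"] t[of "i - n"] i len
          by (simp add: nth_append Suc_diff_le)
      qed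
    qed
  qed
  have "last p \<in> edges B 2" using sub len k by (metis last_in_set length_0_conv not_one_le_zero subsetD)
  then show "tgt B (n + k) (last p) = tgt B (Suc k) (last p)"
    using tgt_eq[of "n + k" "last p"] tgt_eq[of "Suc k" "last p"] n k by simp
qed

lemma cyl_at_nonempty:
  assumes "x \<in> X" "n \<ge> 1" "k \<ge> 1" "p \<in> paths_from B (vtx B x n) k"
  shows "cyl_at B x n p \<noteq> {}"
  using path_extends[OF prefix_append_in_paths(1)[OF assms]] assms(2) by (simp add: cyl_at_def)

end

section \<open>Returns to the shrinking cylinders\<close>

text \<open>
  For counting visits: it does not matter whether the vertex at the start of a return or the equal one at
  its end is counted.
\<close>

lemma card_shifted_interval:
  fixes P :: "nat \<Rightarrow> bool"
  assumes "0 < \<rho>" "P 0 \<longleftrightarrow> P \<rho>"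
  shows "card {q. 0 < q \<and> q \<le> \<rho> \<and> P q} = card {q. q < \<rho> \<and> P q}"
proof (cases "P 0")
  case True
  then have "{q. 0 < q \<and> q \<le> \<rho> \<and> P q} = insert \<rho> {q. 0 < q \<and> q < \<rho> \<and> P q}"
    "{q. q < \<rho> \<and> P q} = insert 0 {q. 0 < q \<and> q < \<rho> \<and> P q}"
    using assms by auto
  moreover have "finite {q. 0 < q \<and> q < \<rho> \<and> P q}" by simp
  ultimately show ?thesis by simp
next
  case False
  then have "0 < q \<and> q \<le> \<rho> \<longleftrightarrow> q < \<rho>" if "P q" for q
    using that assms by (cases "q = 0"; cases "q = \<rho>") auto
  then show ?thesis by (intro arg_cong[where f=card]) blast
qed

locale entrance_setting = stationary_bratteli B m for B :: "(nat, 'e) bratteli" and m +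
  fixes xs :: "nat \<Rightarrow> 'e" and istar :: nat and N :: "nat set"
  assumes xs_path: "xs \<in> path_space B"
    and istar_in: "istar \<in> {1..m}"
    and N_nonempty: "N \<noteq> {}"
    and N_level: "\<And>n. n \<in> N \<Longrightarrow> n \<ge> 1 \<and> tgt B n (xs n) = istar"
begin

abbreviation U :: "nat \<Rightarrow> (nat \<Rightarrow> 'e) set" where
  "U n \<equiv> cyl_at B xs n []"

abbreviation J :: "(nat \<Rightarrow> 'e) set" where
  "J \<equiv> at_vertex B istar"

abbreviation base_time :: "(nat \<Rightarrow> 'e) \<Rightarrow> nat" where
  "base_time \<equiv> entrance_time T J 1"

abbreviation enter :: "nat \<Rightarrow> (nat \<Rightarrow> 'e) \<Rightarrow> (nat \<Rightarrow> 'e)" where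
  "enter n \<equiv> entrance_map T (U n)"

abbreviation time :: "nat \<Rightarrow> (nat \<Rightarrow> 'e) \<Rightarrow> nat" where
  "time n \<equiv> entrance_time T (U n) 1"

(* Entrance times are handled through their characterisation as first hits; unfolded, they would become infima. *)
declare entrance_time.simps(2) [simp del]

lemma vtx_xs: "n \<in> N \<Longrightarrow> vtx B xs n = istar"
  using N_level[of n] tgt_eq_vtx[OF xs_path, of n] by simp

text \<open>
  \<open>U n\<close> is one floor of the towers of level \<open>n\<close> over \<open>J\<close>.
\<close>

lemma in_U_iff:
  assumes n: "n \<in> N"
  shows "z \<in> U n \<longleftrightarrow> z \<in> X \<and> address B n z = address B n xs \<and>
    shift_path B n z \<in> J"
  using in_initial_cylinder_iff[OF xs_path, of n z] N_level[OF n] vtx_xs[OF n]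
    vtx_shift_path_1[of z n] by auto

lemma address_xs_less: "n \<in> N \<Longrightarrow> address B n xs < tower_height B n istar"
  using address_less_height[OF xs_path, of n] vtx_xs by simp

lemma U_recurrent:
  assumes n: "n \<in> N" and z: "z \<in> X"
  shows "\<exists>s>0. (T ^^ s) z \<in> U n"
proof -
  have n1: "n \<ge> 1" using N_level n by auto
  let ?y = "shift_path B n z"
  obtain q where q: "q > 0" "(T ^^ q) ?y \<in> J"
    using at_vertex_recurrent[OF shift_path_in[OF z n1] istar_in] by blast
  have "address B n z < ladder B n ?y 1"
    using address_less_height[OF z, of n] vtx_shift_path_1[OF z n1] by simp
  also have "\<dots> \<le> ladder B n ?y q" using q by (intro ladder_mono) simp
  finally have lt: "address B n z < ladder B n ?y q" .
  define s where "s = ladder B n ?y q + address B n xs - address B n z"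
  have "address B n ((T ^^ s) z) = address B n xs \<and>
      shift_path B n ((T ^^ s) z) = (T ^^ q) ?y"
    using lt q address_xs_less[OF n] by (intro tower_orbit[OF z n1]) (auto simp: s_def)
  then have "(T ^^ s) z \<in> U n"
    using q funpow_vershik_in[OF z] by (simp add: in_U_iff[OF n])
  moreover have "s > 0" using lt by (simp add: s_def)
  ultimately show ?thesis by blast
qed

text \<open>
  From a floor over \<open>J\<close> the orbit comes back to that floor whenever the shifted path comes back to \<open>J\<close>, and
  at no other time.  As departure and arrival happen at equal heights, the elapsed time is the total height of
  the towers in between.
\<close>

lemma return_to_U:
  assumes n: "n \<in> N" and z: "z \<in> U n"
  shows "time n z = ladder B n (shift_path B n z) (base_time (shift_path B n z))"
    and "enter n z \<in> U n"
    and "shift_path B n (enter n z) =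
      entrance_map T J (shift_path B n z)"
proof -
  have n1: "n \<ge> 1" using N_level n by auto
  have zp: "z \<in> X" and za: "address B n z = address B n xs"
    using z in_U_iff[OF n] by auto
  let ?y = "shift_path B n z"
  define \<rho> where "\<rho> = base_time ?y"
  obtain q where q: "q > 0" "(T ^^ q) ?y \<in> J"
    using at_vertex_recurrent[OF shift_path_in[OF zp n1] istar_in] by blast
  note \<rho> = entrance_time_1[OF q, folded \<rho>_def]
  define s where "s = ladder B n ?y \<rho>"
  have orb: "address B n ((T ^^ s) z) = address B n xs \<and>
      shift_path B n ((T ^^ s) z) = (T ^^ \<rho>) ?y"
    using \<rho>(2) address_xs_less[OF n] by (intro tower_orbit[OF zp n1]) (auto simp: s_def za)
  then have sU: "(T ^^ s) z \<in> U n"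
    using \<rho> funpow_vershik_in[OF zp] by (simp add: in_U_iff[OF n])
  have t: "time n z = s"
  proof (rule entrance_time_1_eqI)
    show "s > 0" using ladder_strict_mono[OF zp n1 \<rho>(1)] by (simp add: s_def)
    show "(T ^^ s) z \<in> U n" by (rule sU)
    fix r assume r: "0 < r" "r < s"
    obtain k u where ku: "ladder B n ?y k + u = address B n z + r"
      "address B n ((T ^^ r) z) = u"
      "shift_path B n ((T ^^ r) z) = (T ^^ k) ?y"
      using tower_orbit_exists[OF zp n1, of r] by auto
    show "(T ^^ r) z \<notin> U n"
    proof
      assume "(T ^^ r) z \<in> U n"
      then have "u = address B n z" "(T ^^ k) ?y \<in> J"
        using ku za in_U_iff[OF n] by auto
      then have k: "ladder B n ?y k = r" using ku by simp
      then have "k > 0" using r by (cases k) auto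
      then have "\<rho> \<le> k" using \<rho>(3) \<open>(T ^^ k) ?y \<in> J\<close> by auto
      then have "s \<le> r" using k ladder_mono[of \<rho> k B n ?y] by (simp add: s_def)
      then show False using r by simp
    qed
  qed
  show "time n z = ladder B n ?y (base_time ?y)"
    using t by (simp only: s_def \<rho>_def)
  have E: "enter n z = (T ^^ s) z"
    unfolding entrance_map_def t ..
  show "enter n z \<in> U n" using sU E by simp
  show "shift_path B n (enter n z) = entrance_map T J ?y"
    using orb E by (simp add: entrance_map_def \<rho>_def del: entrance_time.simps)
qed

lemma entrance_map_iterate_shift:
  assumes n: "n \<in> N" and z: "z \<in> U n"
  shows "(enter n ^^ k) z \<in> U n \<and>
    shift_path B n ((enter n ^^ k) z) =
      (entrance_map T J ^^ k) (shift_path B n z)"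
proof (induction k)
  case (Suc k)
  then show ?case using return_to_U[OF n] by simp
qed (use z in simp)

definition base_visits :: "(nat \<Rightarrow> 'e) \<Rightarrow> nat \<Rightarrow> nat" where
  "base_visits y i = card {u. u < base_time y \<and> vtx B ((T ^^ u) y) 1 = i}"

lemma time_eq_sum_visits:
  assumes n: "n \<in> N" and z: "z \<in> U n"
  shows "time n z = (\<Sum>i=1..m. base_visits (shift_path B n z) i * tower_height B n i)"
proof -
  have n1: "n \<ge> 1" using N_level n by auto
  let ?y = "shift_path B n z"
  have y: "?y \<in> X" using z in_U_iff[OF n] n1 shift_path_in by blast
  let ?v = "\<lambda>u. vtx B ((T ^^ u) ?y) 1"
  let ?R = "{..<base_time ?y}"
  have group: "(\<Sum>i=1..m. \<Sum>u\<in>{u\<in>?R. ?v u = i}. tower_height B n (?v u)) =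
      (\<Sum>u\<in>?R. tower_height B n (?v u))"
    using vtx_range[OF funpow_vershik_in[OF y], of 1] by (intro sum.group) auto
  have visits: "(\<Sum>u\<in>{u\<in>?R. ?v u = i}. tower_height B n (?v u)) =
      base_visits ?y i * tower_height B n i" for i
    by (simp add: base_visits_def)
  show ?thesis
    unfolding return_to_U(1)[OF n z] ladder_def by (rule group[unfolded visits, symmetric])
qed

text \<open>
  The bottom of a tower of \<open>i\<close> is visited once for each \<open>q\<close> at which the shifted path has first vertex
  \<open>i\<close>.  If the floor of \<open>U n\<close> is not the bottom one, the bottom of the first tower is already behind at time
  \<open>0\<close>, but that of the last tower is passed before the return; both are towers of \<open>istar\<close>, and the count
  is the same.  In particular it depends on the shifted path only.
\<close>

lemma card_visits:
  assumes n: "n \<in> N" and z: "z \<in> U n" and i: "i \<in> {1..m}"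
  shows "card {s. s < time n z \<and> (T ^^ s) z \<in> cylinder B (min_path_to B n i)} =
    base_visits (shift_path B n z) i"
proof -
  have n1: "n \<ge> 1" using N_level n by auto
  have zp: "z \<in> X" and za: "address B n z = address B n xs" and zJ: "shift_path B n z \<in> J"
    using z in_U_iff[OF n] by auto
  let ?y = "shift_path B n z"
  let ?P = "\<lambda>q. vtx B ((T ^^ q) ?y) 1 = i"
  define \<alpha> where "\<alpha> = address B n z"
  define \<rho> where "\<rho> = base_time ?y"
  define \<Lambda> where "\<Lambda> = ladder B n ?y"
  obtain q where q: "q > 0" "(T ^^ q) ?y \<in> J"
    using at_vertex_recurrent[OF shift_path_in[OF zp n1] istar_in] by blast
  note \<rho> = entrance_time_1[OF q, folded \<rho>_def]
  have \<Lambda>: "\<Lambda> a < \<Lambda> b" if "a < b" for a b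
    using ladder_strict_mono[OF zp n1 that] by (simp add: \<Lambda>_def)
  have \<Lambda>1: "\<alpha> < \<Lambda> 1"
    using address_less_height[OF zp, of n] vtx_shift_path_1[OF zp n1] by (simp add: \<Lambda>_def \<alpha>_def)
  have \<Lambda>\<rho>: "\<Lambda> \<rho> + \<alpha> < \<Lambda> (Suc \<rho>)"
    using \<rho>(2) address_xs_less[OF n] by (simp add: \<Lambda>_def \<alpha>_def za)
  have t: "time n z = \<Lambda> \<rho>" using return_to_U(1)[OF n z] by (simp only: \<Lambda>_def \<rho>_def)
  have iv: "i \<in> verts B n" using i verts_eq[OF n1] by simp
  have visit: "(T ^^ s) z \<in> cylinder B (min_path_to B n i) \<longleftrightarrow>
      (\<exists>q. \<Lambda> q = \<alpha> + s \<and> ?P q)" for s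
  proof -
    let ?x = "(T ^^ s) z"
    have x: "?x \<in> X" using zp by (rule funpow_vershik_in)
    obtain k u where ku: "\<Lambda> k + u = \<alpha> + s" "address B n ?x = u"
      "shift_path B n ?x = (T ^^ k) ?y"
      using tower_orbit_exists[OF zp n1, of s] by (auto simp: \<Lambda>_def \<alpha>_def)
    have "?x \<in> cylinder B (min_path_to B n i) \<longleftrightarrow> u = 0 \<and> ?P k"
      using in_cylinder_min_path_to_iff[OF n1 iv, of ?x] x ku vtx_shift_path_1[OF x n1] by auto
    moreover have "u = 0 \<and> ?P k" if "\<Lambda> q = \<alpha> + s" "?P q" for q
    proof -
      have "address B n ?x = 0 \<and> shift_path B n ?x = (T ^^ q) ?y"
        using that height_pos[OF iv] by (intro tower_orbit[OF zp n1]) (auto simp: \<Lambda>_def \<alpha>_def)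
      then show ?thesis using ku that by auto
    qed
    ultimately show ?thesis using ku by auto
  qed
  \<comment> \<open>The towers whose bottoms are met at a time in \<open>{0..<\<Lambda> \<rho>}\<close>: the bottom of tower \<open>q\<close> is met at time \<open>\<Lambda> q - \<alpha>\<close>.\<close>
  define K where "K = {q. ?P q \<and> \<alpha> \<le> \<Lambda> q \<and> \<Lambda> q < \<Lambda> \<rho> + \<alpha>}"
  have "bij_betw (\<lambda>q. \<Lambda> q - \<alpha>) K
      {s. s < time n z \<and> (T ^^ s) z \<in> cylinder B (min_path_to B n i)}"
  proof (rule bij_betwI')
    fix a b assume "a \<in> K" "b \<in> K"
    then show "(\<Lambda> a - \<alpha> = \<Lambda> b - \<alpha>) = (a = b)"
      using \<Lambda>[of a b] \<Lambda>[of b a] by (cases a b rule: linorder_cases) (auto simp: K_def)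
  next
    fix a assume "a \<in> K"
    then show "\<Lambda> a - \<alpha> \<in> {s. s < time n z \<and> (T ^^ s) z \<in> cylinder B (min_path_to B n i)}"
      unfolding mem_Collect_eq visit t by (auto simp: K_def)
  next
    fix s assume "s \<in> {s. s < time n z \<and> (T ^^ s) z \<in> cylinder B (min_path_to B n i)}"
    then obtain q where q: "s < \<Lambda> \<rho>" "\<Lambda> q = \<alpha> + s" "?P q" unfolding mem_Collect_eq visit t by auto
    then show "\<exists>q\<in>K. s = \<Lambda> q - \<alpha>" by (intro bexI[of _ q]) (auto simp: K_def)
  qed
  then have "card {s. s < time n z \<and> (T ^^ s) z \<in> cylinder B (min_path_to B n i)} = card K"
    by (rule bij_betw_same_card[symmetric])
  also have "card K = card {q. q < \<rho> \<and> ?P q}"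
  proof (cases "\<alpha> = 0")
    case True
    have "\<Lambda> q < \<Lambda> \<rho> \<longleftrightarrow> q < \<rho>" for q
      using \<Lambda>[of q \<rho>] \<Lambda>[of \<rho> q] by (cases q \<rho> rule: linorder_cases) auto
    then show ?thesis using True by (auto simp: K_def intro!: arg_cong[where f=card])
  next
    case False
    have 0: "\<Lambda> 0 = 0" by (simp add: \<Lambda>_def)
    have "\<alpha> \<le> \<Lambda> q \<longleftrightarrow> 0 < q" for q
      using \<Lambda>1 \<Lambda>[of 1 q] 0 False by (cases "q = 0"; cases "q = 1") auto
    moreover have "\<Lambda> q < \<Lambda> \<rho> + \<alpha> \<longleftrightarrow> q \<le> \<rho>" for q
      using \<Lambda>[of q \<rho>] \<Lambda>[of "Suc \<rho>" q] \<Lambda>\<rho> False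
      by (cases "q < \<rho>"; cases "q = \<rho>"; cases "q = Suc \<rho>") auto
    ultimately have "K = {q. 0 < q \<and> q \<le> \<rho> \<and> ?P q}" by (auto simp: K_def)
    moreover have "card {q. 0 < q \<and> q \<le> \<rho> \<and> ?P q} = card {q. q < \<rho> \<and> ?P q}"
      using \<rho>(1,2) zJ by (intro card_shifted_interval) auto
    ultimately show ?thesis by (simp only:)
  qed
  also have "\<dots> = base_visits ?y i"
    unfolding base_visits_def \<rho>_def by (rule refl)
  finally show ?thesis .
qed

lemma cyl_at_subset_U: "cyl_at B xs n p \<subseteq> U n"
  by (auto simp: in_cyl_at_iff)

text \<open>
  Points of cylinders \<open>[I\<^sub>n p]\<close> with the same \<open>p\<close>, even for different \<open>n\<close>, have shifted paths with the same
  initial edges.  Every independence of \<open>n\<close> comes from here.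
\<close>

lemma shift_paths_agree:
  assumes n: "n \<in> N" and n': "n' \<in> N" and z: "z \<in> cyl_at B xs n p" and z': "z' \<in> cyl_at B xs n' p"
    and j: "j \<in> {1..Suc (length p)}"
  shows "shift_path B n z j = shift_path B n' z' j"
proof -
  have v: "vtx B z n = istar" if "n \<in> N" "z \<in> cyl_at B xs n p" for n z
    using that cyl_at_subset_U[of n p] in_U_iff[of n z] vtx_shift_path_1[of z n] N_level by auto
  show ?thesis
  proof (cases "j = 1")
    case True
    then show ?thesis using v n n' z z' by (simp add: shift_path_def)
  next
    case False
    define i where "i = j - 2"
    have i: "j = i + 2" "i < length p" using j False by (auto simp: i_def)
    have "shift_path B n z j = p ! i" if "z \<in> cyl_at B xs n p" for n z
      using that i by (simp add: shift_path_ge2 in_cyl_at_iff)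
    then show ?thesis using z z' by simp
  qed
qed

lemma base_visits_agree:
  assumes "y \<in> X" "y' \<in> X" and "\<And>j. j \<in> {1..3} \<Longrightarrow> y j = y' j"
  shows "base_visits y i = base_visits y' i"
proof -
  have eq: "y j = y' j" if "j \<in> {1..Suc 2}" for j using assms(3) that by simp
  note A = entrance_agree[OF assms(1,2) order_refl istar_in eq]
  have A1: "base_time y' = base_time y" by (rule A(1))
  have "vtx B ((T ^^ u) y) 1 = vtx B ((T ^^ u) y') 1" if "u < base_time y" for u
    using A(2)[of u 2] that by (simp add: vtx_def numeral_2_eq_2 del: entrance_time.simps)
  then have "{u. u < base_time y \<and> vtx B ((T ^^ u) y) 1 = i} =
      {u. u < base_time y \<and> vtx B ((T ^^ u) y') 1 = i}" by metis
  then show ?thesis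
    unfolding base_visits_def A1 by simp
qed

lemma in_cyl_at_path: "z \<in> cyl_at B xs n p \<Longrightarrow> z \<in> X"
  by (simp add: in_cyl_at_iff)

lemma paths_from_cyl_at_nonempty:
  assumes "n \<in> N" "k \<ge> 1" "p \<in> paths_from B istar k"
  shows "cyl_at B xs n p \<noteq> {}"
  using cyl_at_nonempty[OF xs_path, of n k p] assms N_level vtx_xs by auto

lemma visit_count_eq:
  assumes n: "n \<in> N" and ef: "ef \<in> edge_pairs B istar" and z: "z \<in> cyl_at B xs n ef" and i: "i \<in> {1..m}"
  shows "visit_count B N xs ef i = base_visits (shift_path B n z) i"
proof -
  let ?c = "base_visits (shift_path B n z) i"
  let ?card = "\<lambda>n z. card {s. s < time n z \<and> (T ^^ s) z \<in> cylinder B (min_path_to B n i)}"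
  have len: "length ef = 2" using ef by (auto simp: edge_pairs_eq paths_from_iff)
  have c: "?card n' z' = ?c" if n': "n' \<in> N" and z': "z' \<in> cyl_at B xs n' ef" for n' z'
  proof -
    have "?card n' z' = base_visits (shift_path B n' z') i"
      by (rule card_visits[OF n' subsetD[OF cyl_at_subset_U z'] i])
    also have "\<dots> = ?c"
      using n n' N_level[of n] N_level[of n'] in_cyl_at_path[OF z] in_cyl_at_path[OF z']
        shift_paths_agree[OF n' n z' z] len
      by (intro base_visits_agree shift_path_in) auto
    finally show ?thesis .
  qed
  have "(THE c. \<forall>n\<in>N. \<forall>z\<in>cyl_at B xs n ef. c = ?card n z) = ?c"
  proof (rule the1_equality')
    show "\<exists>\<^sub>\<le>\<^sub>1c. \<forall>n\<in>N. \<forall>z\<in>cyl_at B xs n ef. c = ?card n z"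
    proof (rule Uniq_I)
      fix c c'
      assume 1: "\<forall>n\<in>N. \<forall>z\<in>cyl_at B xs n ef. c = ?card n z"
        and 2: "\<forall>n\<in>N. \<forall>z\<in>cyl_at B xs n ef. c' = ?card n z"
      show "c' = c"
        using bspec[OF bspec[OF 1 n] z] bspec[OF bspec[OF 2 n] z] by (simp only:)
    qed
    show "\<forall>n\<in>N. \<forall>z\<in>cyl_at B xs n ef. ?c = ?card n z"
      using c by (intro ballI) (rule sym)
  qed
  then show ?thesis by (simp only: visit_count_def)
qed

text \<open>
  The value of the first return time to \<open>U n\<close> on the cylinder of the edge pair \<open>ef\<close>.
\<close>

definition return_time :: "nat \<Rightarrow> 'e list \<Rightarrow> nat" where
  "return_time n ef = (\<Sum>i=1..m. visit_count B N xs ef i * tower_height B n i)"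

lemma time_on_edge_pair:
  assumes n: "n \<in> N" and ef: "ef \<in> edge_pairs B istar" and z: "z \<in> cyl_at B xs n ef"
  shows "time n z = return_time n ef"
  using time_eq_sum_visits[OF n subsetD[OF cyl_at_subset_U z]] visit_count_eq[OF n ef z]
  by (simp add: return_time_def)

text \<open>
  Each of the \<open>k - 1\<close> returns costs one of the \<open>k + 1\<close> known edges, so two edges of the
  point of return are known.  They do not depend on \<open>n\<close>, because the returns are those of the shifted
  paths; so they can be read off at an arbitrary level and point.
\<close>

lemma return_edges:
  assumes k: "k \<ge> 1" and p: "p \<in> paths_from B istar (Suc k)"
  shows "return_edges B N xs istar k p \<in> edge_pairs B istar"
    and "n \<in> N \<Longrightarrow> z \<in> cyl_at B xs n p \<Longrightarrow>
      (enter n ^^ (k - 1)) z \<in> cyl_at B xs n (return_edges B N xs istar k p)"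
proof -
  have len: "length p = Suc k" using p by (auto simp: paths_from_iff)
  obtain n0 where n0: "n0 \<in> N" using N_nonempty by auto
  obtain z0 where z0: "z0 \<in> cyl_at B xs n0 p"
    using paths_from_cyl_at_nonempty[OF n0 _ p] by auto
  let ?E = "\<lambda>n. enter n ^^ (k - 1)"
  let ?base = "?E n0 z0"
  define q where "q = map ?base [Suc n0..<Suc n0 + 2]"
  have E: "?E n z \<in> U n \<and> shift_path B n (?E n z) =
      (entrance_map T J ^^ (k - 1)) (shift_path B n z)"
    if "n \<in> N" "z \<in> cyl_at B xs n p" for n z
    using entrance_map_iterate_shift that cyl_at_subset_U by blast
  have "?base \<in> X \<and> vtx B ?base n0 = istar"
    using E[OF n0 z0] in_U_iff[OF n0] vtx_shift_path_1[of ?base n0] N_level[OF n0] by auto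
  then have q: "q \<in> edge_pairs B istar"
    using segment_in_paths_from[of ?base n0 2] N_level[OF n0] by (simp add: q_def edge_pairs_eq)
  have mem: "?E n z \<in> cyl_at B xs n q" if n: "n \<in> N" and z: "z \<in> cyl_at B xs n p" for n z
  proof -
    let ?x = "?E n z"
    have base: "(entrance_map T J ^^ (k - 1)) (shift_path B n z) j =
        (entrance_map T J ^^ (k - 1)) (shift_path B n0 z0) j" if "j \<in> {1..3}" for j
    proof (rule entrance_map_iterate_agree[OF _ _ _ istar_in _ that])
      show "shift_path B n z \<in> X" "shift_path B n0 z0 \<in> X"
        using n n0 z z0 N_level by (auto intro!: shift_path_in dest: in_cyl_at_path)
      show "shift_path B n z j = shift_path B n0 z0 j" if "j \<in> {1..3 + (k - 1)}" for j
        using that shift_paths_agree[OF n n0 z z0, of j] k len by simp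
    qed simp
    have "shift_path B n ?x j = shift_path B n0 ?base j" if "j \<in> {1..3}" for j
      using conjunct2[OF E[OF n z]] conjunct2[OF E[OF n0 z0]] base[OF that] by (simp only:)
    from this[of 2] this[of 3] have "?x (Suc n) = ?base (Suc n0)" "?x (n + 2) = ?base (n0 + 2)"
      by (simp_all add: shift_path_ge2)
    then have "?x (Suc n + j) = q ! j" if "j < length q" for j
      using that by (cases j) (auto simp: q_def nth_append)
    then show ?thesis using E[OF n z] by (auto simp: in_cyl_at_iff)
  qed
  have it: "(T ^^ entrance_time T (U n) (k - 1) z) z = ?E n z"
    if n: "n \<in> N" and z: "z \<in> cyl_at B xs n p" for n z
    using entrance_time_iterate(2)[where X=X and T=T and U="U n" and x=z and k="k-1"]
      vershik_in_path_space U_recurrent[OF n] in_cyl_at_path[OF z] by blast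
  have "return_edges B N xs istar k p = q"
    unfolding return_edges_def
  proof (rule the_equality)
    show "q \<in> paths B 2 3 \<and> src B 2 (hd q) = istar \<and> (\<forall>n\<in>N. \<forall>z\<in>cyl_at B xs n p.
        (T ^^ entrance_time T (U n) (k - 1) z) z \<in> cyl_at B xs n q)"
      using q it mem by (auto simp: edge_pairs_def)
    fix q' assume q': "q' \<in> paths B 2 3 \<and> src B 2 (hd q') = istar \<and> (\<forall>n\<in>N. \<forall>z\<in>cyl_at B xs n p.
        (T ^^ entrance_time T (U n) (k - 1) z) z \<in> cyl_at B xs n q')"
    then have "(T ^^ entrance_time T (U n0) (k - 1) z0) z0 \<in> cyl_at B xs n0 q'"
      using n0 z0 by blast
    then have "?base \<in> cyl_at B xs n0 q'" by (simp only: it[OF n0 z0])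
    moreover have "length q' = 2" "length q = 2" using q' q by (auto simp: paths_def edge_pairs_def)
    ultimately show "q' = q"
      using mem[OF n0 z0] by (intro nth_equalityI) (auto simp: in_cyl_at_iff)
  qed
  then show "return_edges B N xs istar k p \<in> edge_pairs B istar"
    and "n \<in> N \<Longrightarrow> z \<in> cyl_at B xs n p \<Longrightarrow>
      (enter n ^^ (k - 1)) z \<in> cyl_at B xs n (return_edges B N xs istar k p)"
    using q mem by simp_all
qed

end

section \<open>The law of an entrance time under an invariant measure\<close>

text \<open>
  \<open>D s\<close> consists of the points that enter \<open>U\<close> first at time \<open>s > 0\<close>, and do so in \<open>W\<close>.  The
  preimage of \<open>D s\<close> under \<open>T\<close> splits into \<open>D (s + 1)\<close> and the points that are sent into \<open>D s \<inter> U\<close>, so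
  invariance gives \<open>measure M (D s) - measure M (D (s + 1)) = measure M (D s \<inter> U)\<close>.  Beyond the bound \<open>b\<close> on the return
  times the measures of the disjoint sets \<open>D s\<close> are all equal, hence zero, and the differences can be summed.
\<close>

lemma entrance_decomposition:
  fixes M :: "'a measure" and T :: "'a \<Rightarrow> 'a" and U W :: "'a set" and b :: nat
  defines "D \<equiv> \<lambda>s. {x \<in> space M. (T ^^ s) x \<in> W \<and> (\<forall>r\<in>{0<..<s}. (T ^^ r) x \<notin> U)}"
  assumes fin: "finite_measure M" and T: "T \<in> measurable M M" and inv: "distr M M T = M"
    and U: "U \<in> sets M" and W: "W \<in> sets M" and WU: "W \<subseteq> U"
    and bound: "\<And>s. s > b \<Longrightarrow> D s \<inter> U = {}"
  shows "D s \<in> sets M"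
    and "s \<ge> 1 \<Longrightarrow> measure M (D s) = (\<Sum>u=s..b. measure M (D u \<inter> U))"
    and "measure M (\<Union>s\<in>{1..K}. D s) = (\<Sum>u=1..b. real (min u K) * measure M (D u \<inter> U))"
proof -
  interpret finite_measure M by (rule fin)
  have Ts [measurable]: "(T ^^ s) \<in> measurable M M" for s
  proof (induction s)
    case (Suc s)
    then show ?case unfolding funpow.simps by (rule measurable_comp[OF _ T])
  qed (simp add: measurable_ident id_def)
  have [measurable]: "U \<in> sets M" "W \<in> sets M" using U W by auto
  show D_sets: "D s \<in> sets M" for s
    unfolding D_def by measurable
  have disj: "disjoint_family_on D S" if "0 \<notin> S" for S
  proof -
    have "D s \<inter> D t = {}" if "s < t" "0 < s" for s t
      using that WU by (auto simp: D_def)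
    then show ?thesis
      using that unfolding disjoint_family_on_def
      by (metis inf_commute linorder_less_linear neq0_conv)
  qed
  have step: "measure M (D s) = measure M (D (Suc s)) + measure M (D s \<inter> U)" if s: "s \<ge> 1" for s
  proof -
    have preimage: "T -` D s \<inter> space M = D (Suc s) \<union> (T -` (D s \<inter> U) \<inter> space M)"
    proof (intro equalityI subsetI)
      fix x assume x: "x \<in> T -` D s \<inter> space M"
      then have *: "(T ^^ Suc s) x \<in> W" "\<And>r. 0 < r \<Longrightarrow> r < s \<Longrightarrow> (T ^^ Suc r) x \<notin> U"
        by (auto simp: D_def funpow_swap1)
      show "x \<in> D (Suc s) \<union> (T -` (D s \<inter> U) \<inter> space M)"
      proof (cases "T x \<in> U")
        case False
        have "(T ^^ r) x \<notin> U" if "0 < r" "r < Suc s" for r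
        proof (cases r)
          case (Suc t)
          then show ?thesis using *(2)[of t] that False by (cases "t = 0") auto
        qed (use that in simp)
        then have "x \<in> D (Suc s)" using x *(1) by (simp add: D_def)
        then show ?thesis by simp
      qed (use x in simp)
    next
      fix x assume "x \<in> D (Suc s) \<union> (T -` (D s \<inter> U) \<inter> space M)"
      then show "x \<in> T -` D s \<inter> space M"
      proof
        assume "x \<in> D (Suc s)"
        then have x: "x \<in> space M" "(T ^^ Suc s) x \<in> W" "\<forall>r\<in>{0<..<Suc s}. (T ^^ r) x \<notin> U"
          unfolding D_def mem_Collect_eq by blast+
        have "(T ^^ r) (T x) \<notin> U" if "0 < r" "r < s" for r
          using bspec[OF x(3), of "Suc r"] that by (simp add: funpow_swap1)
        moreover have "(T ^^ s) (T x) \<in> W" using x(2) by (simp add: funpow_swap1)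
        ultimately have "T x \<in> D s"
          using measurable_space[OF T x(1)] by (simp add: D_def)
        then show ?thesis using x(1) by simp
      qed simp
    qed
    have "measure M (D s) = measure (distr M M T) (D s)" by (simp add: inv)
    also have "\<dots> = measure M (T -` D s \<inter> space M)"
      using T D_sets by (rule measure_distr)
    also have "\<dots> = measure M (D (Suc s)) + measure M (T -` (D s \<inter> U) \<inter> space M)"
      unfolding preimage
    proof (rule finite_measure_Union)
      show "D (Suc s) \<inter> (T -` (D s \<inter> U) \<inter> space M) = {}"
      proof -
        have "T x \<notin> U" if "x \<in> D (Suc s)" for x
        proof -
          have "\<forall>r\<in>{0<..<Suc s}. (T ^^ r) x \<notin> U"
            using that unfolding D_def mem_Collect_eq by blast
          from bspec[OF this, of 1] show ?thesis using s by simp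
        qed
        then show ?thesis by auto
      qed
      show "T -` (D s \<inter> U) \<inter> space M \<in> sets M"
        using D_sets U T by (intro measurable_sets[OF T]) auto
    qed (rule D_sets)
    also have "measure M (T -` (D s \<inter> U) \<inter> space M) = measure (distr M M T) (D s \<inter> U)"
      using D_sets U T by (intro measure_distr[symmetric]) auto
    finally show ?thesis by (simp add: inv)
  qed
  have const: "measure M (D (Suc b + k)) = measure M (D (Suc b))" for k
  proof (induction k)
    case (Suc k)
    have "D (Suc b + k) \<inter> U = {}" by (rule bound) simp
    then show ?case using step[of "Suc b + k"] Suc by simp
  qed simp
  have zero: "measure M (D (Suc b)) = 0"
  proof (rule ccontr)
    assume "measure M (D (Suc b)) \<noteq> 0"
    then have pos: "measure M (D (Suc b)) > 0" by (simp add: zero_less_measure_iff)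
    obtain k :: nat where k: "measure M (space M) < k * measure M (D (Suc b))"
      using reals_Archimedean3[OF pos] by blast
    have "measure M (\<Union>s\<in>{Suc b..<Suc b + k}. D s) = (\<Sum>s\<in>{Suc b..<Suc b + k}. measure M (D s))"
      using D_sets by (intro finite_measure_finite_Union disj) auto
    also have "\<dots> = (\<Sum>s\<in>{Suc b..<Suc b + k}. measure M (D (Suc b)))"
    proof (rule sum.cong)
      fix s assume "s \<in> {Suc b..<Suc b + k}"
      then show "measure M (D s) = measure M (D (Suc b))" using const[of "s - Suc b"] by simp
    qed simp
    also have "\<dots> = k * measure M (D (Suc b))" by simp
    finally show False using k bounded_measure[of "\<Union>s\<in>{Suc b..<Suc b + k}. D s"] by simp
  qed
  show eq: "measure M (D s) = (\<Sum>u=s..b. measure M (D u \<inter> U))" if "s \<ge> 1" for s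
  proof (cases "s \<le> Suc b")
    case True
    then show ?thesis
    proof (induction rule: inc_induct)
      case base
      then show ?case using zero by simp
    next
      case (step t)
      have "t \<ge> 1" using step \<open>s \<ge> 1\<close> by simp
      then show ?case
        using \<open>measure M (D (Suc t)) = _\<close> step.hyps
          \<open>\<And>s. s \<ge> 1 \<Longrightarrow> measure M (D s) = measure M (D (Suc s)) + measure M (D s \<inter> U)\<close>[of t]
        by (simp add: sum.atLeast_Suc_atMost)
    qed
  next
    case False
    then show ?thesis using const[of "s - Suc b"] zero by simp
  qed
  have "measure M (\<Union>s\<in>{1..K}. D s) = (\<Sum>s=1..K. measure M (D s))"
    using D_sets by (intro finite_measure_finite_Union disj) auto
  also have "\<dots> = (\<Sum>s=1..K. \<Sum>u\<in>{u\<in>{1..b}. s \<le> u}. measure M (D u \<inter> U))"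
    using eq by (intro sum.cong) (auto intro!: sum.cong)
  also have "\<dots> = (\<Sum>u=1..b. \<Sum>s\<in>{s\<in>{1..K}. s \<le> u}. measure M (D u \<inter> U))"
    by (rule sum.swap_restrict) auto
  also have "\<dots> = (\<Sum>u=1..b. real (min u K) * measure M (D u \<inter> U))"
  proof (rule sum.cong)
    fix u :: nat
    have "{s\<in>{1..K}. s \<le> u} = {1..min u K}" by auto
    then show "(\<Sum>s\<in>{s\<in>{1..K}. s \<le> u}. measure M (D u \<inter> U)) =
        real (min u K) * measure M (D u \<inter> U)" by simp
  qed simp
  finally show "measure M (\<Union>s\<in>{1..K}. D s) = (\<Sum>u=1..b. real (min u K) * measure M (D u \<inter> U))" .
qed

text \<open>
  Here \<open>U\<close> is cut into finitely many cells on which the return time is constant and the return point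
  is either always or never in \<open>W\<close>.  The result can be pictured as a tower over \<open>U\<close> in which a cell
  \<open>C p\<close> carries floors \<open>j < \<tau> p\<close>, all as large as the cell, and the points of floor \<open>j\<close> have the
  entrance time \<open>\<tau> p - j\<close>.
\<close>

proposition entrance_law:
  fixes M :: "'a measure" and C :: "'b \<Rightarrow> 'a set"
  assumes fin: "finite_measure M" and T: "T \<in> measurable M M" and inv: "distr M M T = M"
    and W: "W \<in> sets M" and WU: "W \<subseteq> U"
    and rec: "\<And>x. x \<in> space M \<Longrightarrow> \<exists>s>0. (T ^^ s) x \<in> U"
    and P: "finite P" "U = (\<Union>p\<in>P. C p)" "disjoint_family_on C P"
    and C: "\<And>p. p \<in> P \<Longrightarrow> C p \<in> sets M"
    and time: "\<And>p x. p \<in> P \<Longrightarrow> x \<in> C p \<Longrightarrow> entrance_time T U 1 x = \<tau> p"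
    and target: "\<And>p x. p \<in> P \<Longrightarrow> x \<in> C p \<Longrightarrow> entrance_map T U x \<in> W \<longleftrightarrow> w p"
  shows "measure M {x \<in> space M. entrance_time T U 1 x \<le> K \<and> entrance_map T U x \<in> W} =
      (\<Sum>p\<in>{p\<in>P. w p}. real (min (\<tau> p) K) * measure M (C p))"
    and "measure M {x \<in> space M. entrance_map T U x \<in> W} =
      (\<Sum>p\<in>{p\<in>P. w p}. real (\<tau> p) * measure M (C p))"
proof -
  interpret finite_measure M by (rule fin)
  have U: "U \<in> sets M" using P C by auto
  define D where "D s = {x \<in> space M. (T ^^ s) x \<in> W \<and> (\<forall>r\<in>{0<..<s}. (T ^^ r) x \<notin> U)}" for s
  have D: "x \<in> D s \<longleftrightarrow> x \<in> space M \<and> entrance_time T U 1 x = s \<and> entrance_map T U x \<in> W"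
    if s: "s \<ge> 1" for s x
  proof
    assume x: "x \<in> D s"
    then have "entrance_time T U 1 x = s"
      using s WU by (intro entrance_time_1_eqI) (auto simp: D_def)
    then show "x \<in> space M \<and> entrance_time T U 1 x = s \<and> entrance_map T U x \<in> W"
      using x by (simp add: entrance_map_def D_def del: entrance_time.simps)
  next
    assume x: "x \<in> space M \<and> entrance_time T U 1 x = s \<and> entrance_map T U x \<in> W"
    obtain t where t: "t > 0" "(T ^^ t) x \<in> U" using rec x by blast
    have "(T ^^ r) x \<notin> U" if "0 < r" "r < s" for r
      using entrance_time_1(3)[OF t that(1)] that(2) x by auto
    then show "x \<in> D s"
      using x by (auto simp: D_def entrance_map_def simp del: entrance_time.simps)
  qed
  define b where "b = Max (insert 0 (\<tau> ` P))"
  have \<tau>: "\<tau> p \<le> b" if "p \<in> P" for p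
    using that P(1) by (auto simp: b_def intro!: Max_ge)
  have pos: "\<tau> p \<ge> 1" if p: "p \<in> P" and x: "x \<in> C p" for p x
  proof -
    have "x \<in> space M" using sets.sets_into_space[OF C[OF p]] x by auto
    then obtain t where "t > 0" "(T ^^ t) x \<in> U" using rec by blast
    then show ?thesis using entrance_time_1(1)[of t T x U] time[OF p x] by simp
  qed
  have cell: "D u \<inter> U = (\<Union>p\<in>{p\<in>P. w p \<and> \<tau> p = u}. C p)" if u: "u \<ge> 1" for u
  proof (intro equalityI subsetI)
    fix x assume x: "x \<in> D u \<inter> U"
    then obtain p where p: "p \<in> P" "x \<in> C p" using P by auto
    then have "w p \<and> \<tau> p = u" using x D[OF u, of x] time[OF p] target[OF p] by simp
    then show "x \<in> (\<Union>p\<in>{p\<in>P. w p \<and> \<tau> p = u}. C p)" using p by auto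
  next
    fix x assume "x \<in> (\<Union>p\<in>{p\<in>P. w p \<and> \<tau> p = u}. C p)"
    then obtain p where p: "p \<in> P" "x \<in> C p" "w p" "\<tau> p = u" by auto
    moreover have "x \<in> space M" using sets.sets_into_space[OF C[OF p(1)]] p by auto
    ultimately show "x \<in> D u \<inter> U"
      using D[OF u, of x] time[OF p(1,2)] target[OF p(1,2)] P(2) by auto
  qed
  have empty: "C p = {}" if "p \<in> P" "\<tau> p = 0" for p
    using pos[OF that(1)] that(2) by fastforce
  have union: "{x \<in> space M. entrance_time T U 1 x \<le> K \<and> entrance_map T U x \<in> W} =
      (\<Union>s\<in>{1..K}. D s)" for K
  proof (intro equalityI subsetI)
    fix x assume x: "x \<in> {x \<in> space M. entrance_time T U 1 x \<le> K \<and> entrance_map T U x \<in> W}"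
    obtain t where "t > 0" "(T ^^ t) x \<in> U" using rec x by blast
    then have "entrance_time T U 1 x \<ge> 1" using entrance_time_1(1)[of t T x U] by simp
    then show "x \<in> (\<Union>s\<in>{1..K}. D s)" using x D by auto
  qed (use D in auto)
  have bound: "{x \<in> space M. (T ^^ s) x \<in> W \<and> (\<forall>r\<in>{0<..<s}. (T ^^ r) x \<notin> U)} \<inter> U = {}"
    if s: "s > b" for s
  proof -
    have "{p\<in>P. w p \<and> \<tau> p = s} = {}" using \<tau> s by fastforce
    then have "D s \<inter> U = {}" using cell[of s] s by auto
    then show ?thesis by (simp only: D_def)
  qed
  have D_sets: "D s \<in> sets M" for s
    unfolding D_def by (rule entrance_decomposition(1)[OF fin T inv U W WU bound])
  have law: "measure M {x \<in> space M. entrance_time T U 1 x \<le> K \<and> entrance_map T U x \<in> W} =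
    (\<Sum>p\<in>{p\<in>P. w p}. real (min (\<tau> p) K) * measure M (C p))" for K
  proof -
    have "measure M (\<Union>s\<in>{1..K}. D s) = (\<Sum>u=1..b. real (min u K) * measure M (D u \<inter> U))"
      unfolding D_def by (rule entrance_decomposition(3)[OF fin T inv U W WU bound])
    also have "\<dots> = (\<Sum>u=1..b. \<Sum>p\<in>{p\<in>{p\<in>P. w p}. \<tau> p = u}. real (min (\<tau> p) K) * measure M (C p))"
    proof (rule sum.cong)
      fix u assume "u \<in> {1..b}"
      then have "measure M (D u \<inter> U) = measure M (\<Union>p\<in>{p\<in>P. w p \<and> \<tau> p = u}. C p)"
        using cell[of u] by simp
      also have "\<dots> = (\<Sum>p\<in>{p\<in>P. w p \<and> \<tau> p = u}. measure M (C p))"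
        using P C by (intro finite_measure_finite_Union) (auto simp: disjoint_family_on_def)
      finally show "real (min u K) * measure M (D u \<inter> U) =
          (\<Sum>p\<in>{p\<in>{p\<in>P. w p}. \<tau> p = u}. real (min (\<tau> p) K) * measure M (C p))"
        by (auto simp: sum_distrib_left conj_assoc intro!: sum.cong)
    qed simp
    also have "\<dots> = (\<Sum>u=0..b. \<Sum>p\<in>{p\<in>{p\<in>P. w p}. \<tau> p = u}. real (min (\<tau> p) K) * measure M (C p))"
      using empty by (intro sum.mono_neutral_left) (auto intro!: sum.neutral)
    also have "\<dots> = (\<Sum>p\<in>{p\<in>P. w p}. real (min (\<tau> p) K) * measure M (C p))"
      using P(1) \<tau> by (intro sum.group) auto
    finally show ?thesis by (simp only: union)
  qed
  then show "measure M {x \<in> space M. entrance_time T U 1 x \<le> K \<and> entrance_map T U x \<in> W} =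
      (\<Sum>p\<in>{p\<in>P. w p}. real (min (\<tau> p) K) * measure M (C p))" .
  define A where "A K = {x \<in> space M. entrance_time T U 1 x \<le> K \<and> entrance_map T U x \<in> W}" for K
  have lim: "(\<lambda>K. measure M (A K)) \<longlonglongrightarrow> measure M (\<Union>K. A K)"
  proof (rule finite_Lim_measure_incseq)
    show "range A \<subseteq> sets M" using D_sets union unfolding A_def by auto
    show "incseq A" unfolding A_def incseq_def by auto
  qed
  have ev: "\<forall>\<^sub>F K in sequentially. measure M (A K) = (\<Sum>p\<in>{p\<in>P. w p}. real (\<tau> p) * measure M (C p))"
    using eventually_ge_at_top[of b]
  proof eventually_elim
    case (elim K)
    have "min (\<tau> p) K = \<tau> p" if "p \<in> P" for p using \<tau>[OF that] elim by simp
    then show ?case unfolding A_def law by (intro sum.cong) auto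
  qed
  have "measure M (\<Union>K. A K) = (\<Sum>p\<in>{p\<in>P. w p}. real (\<tau> p) * measure M (C p))"
    by (rule LIMSEQ_unique[OF lim tendsto_eventually[OF ev]])
  moreover have "(\<Union>K. A K) = {x \<in> space M. entrance_map T U x \<in> W}"
    unfolding A_def by auto
  ultimately show "measure M {x \<in> space M. entrance_map T U x \<in> W} =
      (\<Sum>p\<in>{p\<in>P. w p}. real (\<tau> p) * measure M (C p))" by (simp only:)
qed

section \<open>Perron--Frobenius asymptotics of the tower heights\<close>

text \<open>
  The deviations \<open>D n j = h n j / (lam ^ n * l j) - 1\<close> evolve by the positive matrix
  \<open>P i j = l i * M i j / (lam * l j)\<close>, whose columns sum to one, and they are orthogonal to the vector
  \<open>l i * r i\<close>, because \<open>\<Sum>i. r i * h n i\<close> starts at one and grows by the factor \<open>lam\<close>.  So a small multiple \<open>\<delta>\<close> of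
  this vector can be subtracted from every column of \<open>P\<close> without changing the evolution; the entries stay
  nonnegative and the column sums drop to \<open>1 - \<delta>\<close>, which contracts the supremum norm.
\<close>

lemma perron_asymptotics:
  fixes h :: "nat \<Rightarrow> nat \<Rightarrow> real"
  assumes perron: "perron_data m M lam r l" and m: "m \<ge> 1"
    and M: "\<And>i j. i \<in> {1..m} \<Longrightarrow> j \<in> {1..m} \<Longrightarrow> M i j > 0"
    and h0: "\<And>j. j \<in> {1..m} \<Longrightarrow> h 0 j = 1"
    and h_Suc: "\<And>n j. j \<in> {1..m} \<Longrightarrow> h (Suc n) j = (\<Sum>i=1..m. h n i * real (M i j))"
  shows "lam > 0" and "j \<in> {1..m} \<Longrightarrow> (\<lambda>n. h n j / lam ^ n) \<longlonglongrightarrow> l j"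
proof -
  have r: "\<And>i. i \<in> {1..m} \<Longrightarrow> r i > 0" "\<And>i. i \<in> {1..m} \<Longrightarrow> (\<Sum>j=1..m. real (M i j) * r j) = lam * r i"
    and l: "\<And>j. j \<in> {1..m} \<Longrightarrow> l j > 0" "\<And>j. j \<in> {1..m} \<Longrightarrow> (\<Sum>i=1..m. l i * real (M i j)) = lam * l j"
    and norm: "(\<Sum>i=1..m. r i) = 1" "(\<Sum>i=1..m. l i * r i) = 1"
    using perron by (auto simp: perron_data_def)
  have one: "(1::nat) \<in> {1..m}" using m by simp
  have "lam * r 1 > 0"
    unfolding r(2)[OF one, symmetric] using M[OF one] r(1) one by (intro sum_pos) auto
  then show lam: "lam > 0" using r(1)[OF one] zero_less_mult_pos2 by blast
  define P where "P i j = l i * real (M i j) / (lam * l j)" for i j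
  define D where "D n j = h n j / (lam ^ n * l j) - 1" for n j
  have Psum: "(\<Sum>i=1..m. P i j) = 1" if "j \<in> {1..m}" for j
    using l[OF that] lam by (simp add: P_def flip: sum_divide_distrib)
  have D_Suc: "D (Suc n) j = (\<Sum>i=1..m. D n i * P i j)" if j: "j \<in> {1..m}" for n j
  proof -
    have "(\<Sum>i=1..m. D n i * P i j) = (\<Sum>i=1..m. h n i / (lam ^ n * l i) * P i j) - (\<Sum>i=1..m. P i j)"
      by (simp add: D_def algebra_simps sum_subtractf)
    also have "(\<Sum>i=1..m. h n i / (lam ^ n * l i) * P i j) =
        (\<Sum>i=1..m. h n i * real (M i j) / (lam ^ Suc n * l j))"
      using l(1) lam by (intro sum.cong refl) (fastforce simp: P_def field_simps)
    also have "\<dots> = h (Suc n) j / (lam ^ Suc n * l j)"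
      unfolding h_Suc[OF j] by (rule sum_divide_distrib[symmetric])
    finally show ?thesis using Psum[OF j] by (simp add: D_def)
  qed
  have rh: "(\<Sum>i=1..m. r i * h n i) = lam ^ n" for n
  proof (induction n)
    case 0
    then show ?case using norm h0 by simp
  next
    case (Suc n)
    have "(\<Sum>j=1..m. r j * h (Suc n) j) = (\<Sum>j=1..m. \<Sum>i=1..m. h n i * (real (M i j) * r j))"
      using h_Suc by (intro sum.cong refl) (simp add: sum_distrib_left mult_ac)
    also have "\<dots> = (\<Sum>i=1..m. h n i * (\<Sum>j=1..m. real (M i j) * r j))"
      by (subst sum.swap) (simp add: sum_distrib_left)
    also have "\<dots> = (\<Sum>i=1..m. lam * (r i * h n i))"
      using r(2) by (intro sum.cong refl) simp
    also have "\<dots> = lam * (\<Sum>i=1..m. r i * h n i)"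
      by (rule sum_distrib_left[symmetric])
    finally show ?case using Suc by simp
  qed
  have orth: "(\<Sum>i=1..m. D n i * (l i * r i)) = 0" for n
  proof -
    have "(\<Sum>i=1..m. D n i * (l i * r i)) = (\<Sum>i=1..m. r i * h n i / lam ^ n - l i * r i)"
      using l(1) lam by (intro sum.cong refl) (fastforce simp: D_def field_simps)
    also have "\<dots> = (\<Sum>i=1..m. r i * h n i) / lam ^ n - 1"
      using norm by (simp add: sum_subtractf sum_divide_distrib)
    finally show ?thesis using rh lam by simp
  qed
  define \<delta> where "\<delta> = Min ((\<lambda>(i, j). P i j) ` ({1..m} \<times> {1..m}))"
  have \<delta>: "\<delta> > 0"
    unfolding \<delta>_def using one M l(1) lam by (subst Min_gr_iff) (auto simp: P_def)
  have P\<delta>: "P i j \<ge> \<delta> * (l i * r i)" if ij: "i \<in> {1..m}" "j \<in> {1..m}" for i j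
  proof -
    have "l i * r i \<le> (\<Sum>i=1..m. l i * r i)"
      using l(1) r(1) ij by (intro member_le_sum) (auto intro: less_imp_le)
    then have "\<delta> * (l i * r i) \<le> \<delta>" using \<delta> norm by (simp add: mult_left_le)
    also have "\<delta> \<le> P i j" unfolding \<delta>_def using ij by (intro Min_le) auto
    finally show ?thesis .
  qed
  have Qsum: "(\<Sum>i=1..m. P i j - \<delta> * (l i * r i)) = 1 - \<delta>" if "j \<in> {1..m}" for j
    using Psum[OF that] norm by (simp add: sum_subtractf flip: sum_distrib_left)
  have \<delta>1: "1 - \<delta> \<ge> 0"
    unfolding Qsum[OF one, symmetric] using P\<delta> one by (intro sum_nonneg) auto
  define C where "C = (\<Sum>i=1..m. \<bar>D 0 i\<bar>)"
  have bound: "\<bar>D n j\<bar> \<le> C * (1 - \<delta>) ^ n" if "j \<in> {1..m}" for n j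
    using that
  proof (induction n arbitrary: j)
    case 0
    then show ?case unfolding C_def by (auto intro: member_le_sum)
  next
    case (Suc n)
    have "D (Suc n) j = (\<Sum>i=1..m. D n i * P i j) - \<delta> * (\<Sum>i=1..m. D n i * (l i * r i))"
      using D_Suc[OF Suc.prems] orth by simp
    also have "\<dots> = (\<Sum>i=1..m. D n i * (P i j - \<delta> * (l i * r i)))"
      by (simp add: right_diff_distrib sum_subtractf sum_distrib_left mult_ac)
    finally have "\<bar>D (Suc n) j\<bar> \<le> (\<Sum>i=1..m. \<bar>D n i * (P i j - \<delta> * (l i * r i))\<bar>)"
      by simp
    also have "\<dots> \<le> (\<Sum>i=1..m. C * (1 - \<delta>) ^ n * (P i j - \<delta> * (l i * r i)))"
      using Suc P\<delta> by (intro sum_mono) (auto simp: abs_mult intro!: mult_right_mono)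
    also have "\<dots> = C * (1 - \<delta>) ^ Suc n"
      using Qsum[OF Suc.prems] by (simp flip: sum_distrib_left)
    finally show ?case .
  qed
  show "(\<lambda>n. h n j / lam ^ n) \<longlonglongrightarrow> l j" if j: "j \<in> {1..m}"
  proof -
    have "(\<lambda>n. C * (1 - \<delta>) ^ n) \<longlonglongrightarrow> C * 0"
      using \<delta> \<delta>1 by (intro tendsto_mult tendsto_const LIMSEQ_power_zero) auto
    then have geometric: "(\<lambda>n. C * (1 - \<delta>) ^ n) \<longlonglongrightarrow> 0" by simp
    have "(\<lambda>n. D n j) \<longlonglongrightarrow> 0"
      using bound[OF j] by (intro Lim_null_comparison[OF _ geometric] always_eventually) simp
    then have "(\<lambda>n. (D n j + 1) * l j) \<longlonglongrightarrow> (0 + 1) * l j"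
      by (intro tendsto_intros)
    moreover have "(D n j + 1) * l j = h n j / lam ^ n" for n
      using l(1)[OF j] by (simp add: D_def)
    ultimately show ?thesis by simp
  qed
qed

section \<open>The Perron eigenvalue and the normalised return times\<close>

lemma (in stationary_bratteli) tower_height_recurrence:
  assumes j: "j \<in> {1..m}" and n: "n \<ge> 1"
  shows "tower_height B (Suc n) j = (\<Sum>i=1..m. tower_height B n i * incidence B 2 i j)"
proof -
  have edges: "edges B (Suc n) = edges B 2" using edges_eq[of "Suc n"] n by simp
  have into: "into B (Suc n) j = {e \<in> edges B 2. tgt B 2 e = j}"
    using tgt_eq[of "Suc n"] n by (auto simp: into_def edges)
  have src: "src B 2 e \<in> {1..m}" if "e \<in> edges B 2" for e
    using src_in[of 2 e] that verts_eq[of 1] by simp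
  have "tower_height B (Suc n) j = (\<Sum>e\<in>{e \<in> edges B 2. tgt B 2 e = j}. tower_height B n (src B 2 e))"
    unfolding tower_height.simps into using src_eq[of "Suc n"] n by (intro sum.cong) auto
  also have "\<dots> = (\<Sum>i=1..m. \<Sum>e\<in>{e\<in>{e \<in> edges B 2. tgt B 2 e = j}. src B 2 e = i}.
      tower_height B n (src B 2 e))"
    using src finite_edges[of 2] by (intro sum.group[symmetric]) auto
  also have "\<dots> = (\<Sum>i=1..m. tower_height B n i * incidence B 2 i j)"
  proof (rule sum.cong)
    fix i
    have "{e\<in>{e \<in> edges B 2. tgt B 2 e = j}. src B 2 e = i} = {e \<in> edges B 2. src B 2 e = i \<and> tgt B 2 e = j}"
      by auto
    then show "(\<Sum>e\<in>{e\<in>{e \<in> edges B 2. tgt B 2 e = j}. src B 2 e = i}. tower_height B n (src B 2 e)) =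
        tower_height B n i * incidence B 2 i j"
      by (simp add: incidence_def)
  qed simp
  finally show ?thesis .
qed

lemma (in stationary_bratteli) topspace_path_topology: "topspace (path_topology B) = path_space B"
proof -
  have "x \<in> \<Union>{cylinder B p | p n. n \<ge> 1 \<and> p \<in> paths B 1 n}" if "x \<in> path_space B" for x
  proof (rule UnionI)
    show "cylinder B (prefix x 1) \<in> {cylinder B p | p n. n \<ge> 1 \<and> p \<in> paths B 1 n}"
      using prefix_in_paths[OF that, of 1] by blast
    show "x \<in> cylinder B (prefix x 1)" using that by (simp add: cylinder_def)
  qed
  then show ?thesis
    unfolding path_topology_def topology_generated_by_topspace by (auto simp: cylinder_def)
qed

text \<open>
  Otherwise every edge would be maximal, the path space would consist of the maximal path alone, and it would
  not be homeomorphic to the Cantor set.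
\<close>

lemma (in stationary_bratteli) vertex_with_two_incoming_edges:
  "\<exists>j\<in>{1..m}. card (into B 2 j) \<ge> 2"
proof (rule ccontr)
  assume "\<not> (\<exists>j\<in>{1..m}. card (into B 2 j) \<ge> 2)"
  then have small: "card (into B 2 j) < 2" if "j \<in> {1..m}" for j
    using that by (auto simp: not_le)
  have max: "is_max_edge B n e" if n: "n \<ge> 1" and e: "e \<in> edges B n" for n e
  proof (cases "n = 1")
    case True
    then show ?thesis using first_edge_max e by simp
  next
    case False
    then have n2: "n \<ge> 2" using n by simp
    have e2: "e \<in> edges B 2" using edges_eq[OF n2] e by simp
    have "tgt B 2 e \<in> {1..m}" using tgt_in[of 2 e] e2 verts_eq[of 2] by simp
    then have "card (into B 2 (tgt B 2 e)) < 2" by (rule small)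
    moreover have "e \<in> into B 2 (tgt B 2 e)" using e2 by (simp add: into_def)
    moreover have "insert e (below B 2 e) \<subseteq> into B 2 (tgt B 2 e)"
      using insert_below_subset_into e2 by simp
    moreover have "finite (into B 2 (tgt B 2 e))" by simp
    ultimately have "insert e (below B 2 e) = into B 2 (tgt B 2 e)"
      by (metis One_nat_def Suc_leI card_eq_0_iff card_seteq card_gt_0_iff empty_iff
          insert_not_empty less_2_cases_iff less_or_eq_imp_le finite_subset)
    then have "is_max_edge B 2 e" using e2 by (simp add: is_max_edge_iff)
    then show ?thesis using is_max_edge_level[OF n2] by simp
  qed
  have "path_space B \<subseteq> {max_path B}"
    using eq_max_path max path_edge by blast
  moreover obtain f where
    "homeomorphic_map (path_topology B)
      (product_topology (\<lambda>_::nat. discrete_topology (UNIV :: bool set)) UNIV) f"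
    using cantor_minimal unfolding cantor_minimal_system_def
    by (auto simp: homeomorphic_space)
  then have "f ` path_space B = (UNIV :: (nat \<Rightarrow> bool) set)"
    using homeomorphic_imp_surjective_map topspace_path_topology by fastforce
  ultimately have "(UNIV :: (nat \<Rightarrow> bool) set) \<subseteq> {f (max_path B)}" by blast
  then have "(\<lambda>_. True) = f (max_path B)" "(\<lambda>_. False) = f (max_path B)" by blast+
  then show False by (metis (full_types))
qed

text \<open>
  Summation of the eigenvector equation shows that \<open>lam\<close> is the mean of the numbers of edges into the
  vertices, with weights \<open>r\<close>.  These numbers are at least one, and one of them is at least two.
\<close>

lemma (in stationary_bratteli) perron_eigenvalue_gt_1:
  assumes perron: "perron_data m (incidence B 2) lam r l"
  shows "lam > 1"
proof -
  obtain j0 where j0: "j0 \<in> {1..m}" "card (into B 2 j0) \<ge> 2"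
    using vertex_with_two_incoming_edges by blast
  have r: "\<And>i. i \<in> {1..m} \<Longrightarrow> r i > 0"
      "\<And>i. i \<in> {1..m} \<Longrightarrow> (\<Sum>j=1..m. real (incidence B 2 i j) * r j) = lam * r i"
      "(\<Sum>i=1..m. r i) = 1"
    using perron by (auto simp: perron_data_def)
  have col: "(\<Sum>i=1..m. incidence B 2 i j) = card (into B 2 j)" if j: "j \<in> {1..m}" for j
  proof -
    have "tower_height B 2 j = (\<Sum>i=1..m. incidence B 2 i j)"
      using tower_height_recurrence[OF j, of 1] tower_height_1 by (simp add: numeral_2_eq_2)
    moreover have "tower_height B 2 j = card (into B 2 j)"
    proof -
      have "tower_height B 1 (src B 2 e) = 1" if "e \<in> into B 2 j" for e
        using that src_in[of 2 e] verts_eq[of 1] by (intro tower_height_1) (simp add: into_def)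
      then show ?thesis by (simp add: numeral_2_eq_2)
    qed
    ultimately show ?thesis by simp
  qed
  have ge1: "card (into B 2 j) \<ge> 1" if j: "j \<in> {1..m}" for j
  proof -
    have "incidence B 2 j j \<le> card (into B 2 j)"
      unfolding col[OF j, symmetric] using j by (intro member_le_sum) auto
    then show ?thesis using incidence_pos[OF j j] by simp
  qed
  have "lam = (\<Sum>i=1..m. lam * r i)" using r(3) by (simp flip: sum_distrib_left)
  also have "\<dots> = (\<Sum>i=1..m. \<Sum>j=1..m. real (incidence B 2 i j) * r j)"
    using r(2) by (intro sum.cong) auto
  also have "\<dots> = (\<Sum>j=1..m. \<Sum>i=1..m. real (incidence B 2 i j) * r j)"
    by (rule sum.swap)
  also have "\<dots> = (\<Sum>j=1..m. real (card (into B 2 j)) * r j)"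
    using col by (intro sum.cong refl) (simp flip: sum_distrib_right of_nat_sum)
  finally have lam: "lam = (\<Sum>j=1..m. real (card (into B 2 j)) * r j)" .
  have "(\<Sum>j=1..m. 1 * r j) < (\<Sum>j=1..m. real (card (into B 2 j)) * r j)"
  proof (rule sum_strict_mono_ex1)
    show "\<forall>j\<in>{1..m}. 1 * r j \<le> real (card (into B 2 j)) * r j"
    proof
      fix j assume j: "j \<in> {1..m}"
      then have "1 \<le> real (card (into B 2 j))" using ge1 by fastforce
      then show "1 * r j \<le> real (card (into B 2 j)) * r j"
        using r(1)[OF j] by (intro mult_right_mono) auto
    qed
    have "1 * r j0 < real (card (into B 2 j0)) * r j0"
      using r(1)[OF j0(1)] j0(2) by (intro mult_strict_right_mono) auto
    then show "\<exists>j\<in>{1..m}. 1 * r j < real (card (into B 2 j)) * r j" using j0(1) by blast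
  qed simp
  then show ?thesis using r(3) lam by simp
qed

locale entrance_law_setting = entrance_setting B m xs istar N
  for B :: "(nat, 'e) bratteli" and m xs istar N +
  fixes lam :: real and r l :: "nat \<Rightarrow> real" and \<mu> :: "(nat \<Rightarrow> 'e) measure"
  assumes perron: "perron_data m (incidence B 2) lam r l"
    and invariant: "invariant_prob (path_topology B) (vershik B) \<mu>"
    and measure_cylinder: "\<And>n p. n \<ge> 1 \<Longrightarrow> p \<in> paths B 1 n \<Longrightarrow>
           measure \<mu> (cylinder B p) = r (tgt B n (last p)) / lam ^ (n - 1)"
    and N_infinite: "infinite N"
begin

abbreviation cbar :: "'e list \<Rightarrow> real" where
  "cbar \<equiv> weighted_count B m l N xs"

text \<open>
  The measure of the cylinder \<open>[I\<^sub>n p]\<close> up to the factor \<open>lam ^ (n - 1)\<close>.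
\<close>

definition end_weight :: "nat \<Rightarrow> 'e list \<Rightarrow> real" where
  "end_weight k p = r (tgt B (Suc k) (last p)) / lam ^ k"

abbreviation F :: "nat \<Rightarrow> nat \<Rightarrow> real \<Rightarrow> real" where
  "F n \<equiv> entrance_cdf T \<mu> (U n)"

abbreviation normalised_time :: "nat \<Rightarrow> 'e list \<Rightarrow> real" where
  "normalised_time n ef \<equiv> real (return_time n ef) / lam ^ (n - 1)"

lemma lam_gt_1: "lam > 1"
  using perron by (rule perron_eigenvalue_gt_1)

lemma r_pos: "i \<in> {1..m} \<Longrightarrow> r i > 0"
  and l_pos: "i \<in> {1..m} \<Longrightarrow> l i > 0"
  using perron by (auto simp: perron_data_def)

lemma cbar_nonneg: "cbar ef \<ge> 0"
  unfolding weighted_count_def using l_pos by (intro sum_nonneg mult_nonneg_nonneg) (auto intro: less_imp_le)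

lemma end_weight_nonneg: "k \<ge> 1 \<Longrightarrow> p \<in> paths_from B istar k \<Longrightarrow> end_weight k p \<ge> 0"
proof -
  assume k: "k \<ge> 1" and p: "p \<in> paths_from B istar k"
  have "p \<noteq> []" "set p \<subseteq> edges B 2" using paths_from_nonempty[OF k p] p k by (auto simp: paths_from_iff)
  then have "last p \<in> edges B 2" by auto
  then have "tgt B (Suc k) (last p) \<in> {1..m}"
    using tgt_in[of "Suc k" "last p"] edges_eq[of "Suc k"] verts_eq[of "Suc k"] k by simp
  then show ?thesis using r_pos lam_gt_1 by (simp add: end_weight_def less_imp_le)
qed

lemma normalised_time_tendsto:
  "((\<lambda>n. normalised_time n ef) \<longlongrightarrow> cbar ef) sequentially"
proof -
  have "(\<lambda>n. real (tower_height B (Suc n) i) / lam ^ n) \<longlonglongrightarrow> l i" if "i \<in> {1..m}" for i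
  proof (rule perron_asymptotics(2)[OF perron])
    show "real (tower_height B (Suc 0) j) = 1" if "j \<in> {1..m}" for j
      using tower_height_1[OF that] by simp
    show "real (tower_height B (Suc (Suc n)) j) =
        (\<Sum>i=1..m. real (tower_height B (Suc n) i) * real (incidence B 2 i j))"
      if "j \<in> {1..m}" for n j
      using tower_height_recurrence[OF that, of "Suc n"] by simp
  qed (use istar_in incidence_pos that in auto)
  then have "(\<lambda>n. \<Sum>i=1..m. real (visit_count B N xs ef i) * (real (tower_height B (Suc n) i) / lam ^ n))
      \<longlonglongrightarrow> (\<Sum>i=1..m. real (visit_count B N xs ef i) * l i)"
    by (intro tendsto_sum tendsto_mult tendsto_const) auto
  moreover have "(\<Sum>i=1..m. real (visit_count B N xs ef i) * (real (tower_height B (Suc n) i) / lam ^ n))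
      = normalised_time (Suc n) ef" for n
    by (simp add: return_time_def sum_divide_distrib del: tower_height.simps)
  ultimately have "(\<lambda>n. normalised_time (Suc n) ef) \<longlonglongrightarrow> cbar ef"
    by (simp add: weighted_count_def)
  then show ?thesis by (rule LIMSEQ_imp_Suc)
qed

section \<open>The distribution functions at a fixed level\<close>

lemma prob: "prob_space \<mu>"
  using invariant by (simp add: invariant_prob_def)

lemma space_eq: "space \<mu> = X"
  using invariant topspace_path_topology by (simp add: invariant_prob_def)

lemma cylinder_sets:
  assumes "n \<ge> 1" "p \<in> paths B 1 n"
  shows "cylinder B p \<in> sets \<mu>"
proof -
  have "openin (path_topology B) (cylinder B p)"
    unfolding path_topology_def using assms by (intro topology_generated_by_Basis) auto
  then show ?thesis using invariant by (auto simp: invariant_prob_def)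
qed

lemma
  assumes n: "n \<in> N" and k: "k \<ge> 1" and p: "p \<in> paths_from B istar k"
  shows cyl_at_sets: "cyl_at B xs n p \<in> sets \<mu>"
    and measure_cyl_at: "measure \<mu> (cyl_at B xs n p) = end_weight k p / lam ^ (n - 1)"
proof -
  have n1: "n \<ge> 1" and v: "vtx B xs n = istar" using N_level[OF n] vtx_xs[OF n] by auto
  note path = prefix_append_in_paths[OF xs_path n1 k, unfolded v, OF p]
  show "cyl_at B xs n p \<in> sets \<mu>"
    unfolding cyl_at_def using n1 path by (intro cylinder_sets[of "n + k"]) auto
  have "measure \<mu> (cyl_at B xs n p) = r (tgt B (n + k) (last (prefix xs n @ p))) / lam ^ (n + k - 1)"
    unfolding cyl_at_def using n1 path by (intro measure_cylinder) auto
  also have "\<dots> = end_weight k p / lam ^ (n - 1)"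
    using paths_from_nonempty[OF k p] path(2) n1 by (simp add: end_weight_def add.commute[of n k] flip: power_add)
  finally show "measure \<mu> (cyl_at B xs n p) = end_weight k p / lam ^ (n - 1)" .
qed

lemma measure_U:
  assumes n: "n \<in> N"
  shows "measure \<mu> (U n) = r istar / lam ^ (n - 1)"
proof -
  have n1: "n \<ge> 1" and t: "tgt B n (xs n) = istar" using N_level[OF n] by auto
  have "measure \<mu> (cylinder B (prefix xs n)) = r (tgt B n (last (prefix xs n))) / lam ^ (n - 1)"
    using n1 prefix_in_paths[OF xs_path] by (intro measure_cylinder)
  then show ?thesis using t n1 by (simp add: cyl_at_def last_prefix)
qed

lemma measure_U_pos: "n \<in> N \<Longrightarrow> measure \<mu> (U n) > 0"
  using measure_U r_pos[OF istar_in] lam_gt_1 by simp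

lemma U_partition:
  assumes n: "n \<in> N" and k: "k \<ge> 1"
  shows "U n = (\<Union>p\<in>paths_from B istar k. cyl_at B xs n p)"
    and "disjoint_family_on (cyl_at B xs n) (paths_from B istar k)"
proof -
  show "U n = (\<Union>p\<in>paths_from B istar k. cyl_at B xs n p)"
  proof (intro equalityI subsetI)
    fix z assume z: "z \<in> U n"
    then have zp: "z \<in> X" by (rule in_cyl_at_path)
    have "vtx B z n = istar"
      using z in_U_iff[OF n] vtx_shift_path_1[OF zp] N_level[OF n] by auto
    then have "map z [Suc n..<Suc n + k] \<in> paths_from B istar k"
      using segment_in_paths_from[OF zp _ k, of n] N_level[OF n] by simp
    moreover have "z \<in> cyl_at B xs n (map z [Suc n..<Suc n + k])"
      using z by (simp add: in_cyl_at_iff del: upt_Suc)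
    ultimately show "z \<in> (\<Union>p\<in>paths_from B istar k. cyl_at B xs n p)" by blast
  qed (use cyl_at_subset_U in blast)
  have "p = q" if "p \<in> paths_from B istar k" "q \<in> paths_from B istar k"
    "z \<in> cyl_at B xs n p" "z \<in> cyl_at B xs n q" for p q z
    using that k by (intro nth_equalityI) (auto simp: paths_from_iff in_cyl_at_iff)
  then show "disjoint_family_on (cyl_at B xs n) (paths_from B istar k)"
    by (auto simp: disjoint_family_on_def)
qed

lemma time_on_path:
  assumes n: "n \<in> N" and k: "k \<ge> 2" and p: "p \<in> paths_from B istar k" and z: "z \<in> cyl_at B xs n p"
  shows "time n z = return_time n (take 2 p)"
proof (rule time_on_edge_pair[OF n])
  show "take 2 p \<in> edge_pairs B istar"
    unfolding edge_pairs_eq using p k by (intro take_paths_from) auto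
  show "z \<in> cyl_at B xs n (take 2 p)"
    using z by (auto simp: in_cyl_at_iff)
qed

lemma entrance_iterate_facts:
  assumes n: "n \<in> N" and z: "z \<in> X"
  shows "entrance_time T (U n) (Suc k) z =
      entrance_time T (U n) k z + time n ((enter n ^^ k) z)"
    and "enter n z \<in> U n"
proof -
  show "entrance_time T (U n) (Suc k) z =
      entrance_time T (U n) k z + time n ((enter n ^^ k) z)"
    using vershik_in_path_space U_recurrent[OF n] z
    by (rule entrance_time_iterate(3)[where X=X])
  obtain s where "s > 0" "(T ^^ s) z \<in> U n" using U_recurrent[OF n z] by blast
  then show "enter n z \<in> U n"
    unfolding entrance_map_def by (rule entrance_time_1(2))
qed

text \<open>
  The factor \<open>1 / lam ^ (n - 1)\<close> in the measures of the cylinders is moved to the return times, which then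
  converge, and to the truncation \<open>K\<close>.
\<close>

lemma entrance_law_at_level:
  assumes n: "n \<in> N" and k: "k \<ge> 2" and W: "W \<in> sets \<mu>" "W \<subseteq> U n"
    and w: "\<And>p z. p \<in> paths_from B istar k \<Longrightarrow> z \<in> cyl_at B xs n p \<Longrightarrow>
      enter n z \<in> W \<longleftrightarrow> w p"
  shows "measure \<mu> {x \<in> space \<mu>. time n x \<le> K \<and> enter n x \<in> W} =
      (\<Sum>p\<in>{p\<in>paths_from B istar k. w p}.
        min (normalised_time n (take 2 p)) (real K / lam ^ (n - 1)) * end_weight k p)"
      (is "measure \<mu> ?A1 = ?S1")
    and "measure \<mu> {x \<in> space \<mu>. enter n x \<in> W} =
      (\<Sum>p\<in>{p\<in>paths_from B istar k. w p}. normalised_time n (take 2 p) * end_weight k p)"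
      (is "measure \<mu> ?A2 = ?S2")
proof -
  interpret prob_space \<mu> by (rule prob)
  have inv: "T \<in> measurable \<mu> \<mu>" "distr \<mu> \<mu> T = \<mu>"
    using invariant by (auto simp: invariant_prob_def)
  have k1: "k \<ge> 1" using k by simp
  have rec: "\<exists>s>0. (T ^^ s) x \<in> U n" if "x \<in> space \<mu>" for x
    using that U_recurrent[OF n] by (simp add: space_eq)
  have pow: "lam ^ (n - 1) > 0" using lam_gt_1 by simp
  note law = entrance_law[OF finite_measure_axioms inv W rec finite_paths_from[OF k1]
      U_partition[OF n k1] cyl_at_sets[OF n k1] time_on_path[OF n k] w]
  show "measure \<mu> ?A1 = ?S1"
  proof -
    have "measure \<mu> ?A1 =
        (\<Sum>p\<in>{p\<in>paths_from B istar k. w p}.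
          real (min (return_time n (take 2 p)) K) * measure \<mu> (cyl_at B xs n p))"
      by (rule law(1))
    also have "\<dots> = ?S1"
    proof (intro sum.cong refl)
      fix p assume "p \<in> {p\<in>paths_from B istar k. w p}"
      then have "measure \<mu> (cyl_at B xs n p) = end_weight k p / lam ^ (n - 1)"
        using measure_cyl_at[OF n k1] by blast
      moreover have "min (normalised_time n (take 2 p)) (real K / lam ^ (n - 1)) =
          real (min (return_time n (take 2 p)) K) / lam ^ (n - 1)"
        using pow lam_gt_1 by (simp add: min_def divide_le_cancel)
      ultimately show "real (min (return_time n (take 2 p)) K) * measure \<mu> (cyl_at B xs n p) =
          min (normalised_time n (take 2 p)) (real K / lam ^ (n - 1)) * end_weight k p"
        by simp
    qed
    finally show ?thesis .
  qed
  have "measure \<mu> ?A2 =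
      (\<Sum>p\<in>{p\<in>paths_from B istar k. w p}.
        real (return_time n (take 2 p)) * measure \<mu> (cyl_at B xs n p))"
    by (rule law(2))
  also have "\<dots> = ?S2"
    using measure_cyl_at[OF n k1] by (intro sum.cong) auto
  finally show "measure \<mu> ?A2 = ?S2" .
qed

lemma U_sets: "n \<in> N \<Longrightarrow> U n \<in> sets \<mu>"
  using U_partition(1)[of n 1] finite_paths_from[of 1 istar] cyl_at_sets[of n 1] by auto

lemma entrance_cdf_1:
  assumes n: "n \<in> N" and t: "t \<ge> 0"
  shows "F n 1 t = (\<Sum>ef\<in>edge_pairs B istar.
    min (normalised_time n ef) (real (nat \<lfloor>t / measure \<mu> (U n)\<rfloor>) / lam ^ (n - 1)) * end_weight 2 ef)"
proof -
  let ?K = "nat \<lfloor>t / measure \<mu> (U n)\<rfloor>"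
  have "measure \<mu> (U n) * real s \<le> t \<longleftrightarrow> s \<le> ?K" for s
  proof -
    have "measure \<mu> (U n) * real s \<le> t \<longleftrightarrow> real s \<le> t / measure \<mu> (U n)"
      using measure_U_pos[OF n] by (simp add: field_simps)
    also have "\<dots> \<longleftrightarrow> s \<le> ?K"
      using t measure_U_pos[OF n] by (simp add: le_nat_iff le_floor_iff)
    finally show ?thesis .
  qed
  then have "F n 1 t =
      measure \<mu> {x \<in> space \<mu>. time n x \<le> ?K \<and> enter n x \<in> U n}"
    unfolding entrance_cdf_def using entrance_iterate_facts(2)[OF n]
    by (intro arg_cong[where f="measure \<mu>"]) (auto simp: space_eq)
  also have "\<dots> = (\<Sum>p\<in>{p\<in>paths_from B istar 2. True}.
        min (normalised_time n (take 2 p)) (real ?K / lam ^ (n - 1)) * end_weight 2 p)"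
    using entrance_iterate_facts(2)[OF n] in_cyl_at_path
    by (intro entrance_law_at_level(1)[OF n _ U_sets[OF n]]) auto
  also have "\<dots> = (\<Sum>ef\<in>edge_pairs B istar.
    min (normalised_time n ef) (real ?K / lam ^ (n - 1)) * end_weight 2 ef)"
    unfolding edge_pairs_eq by (intro sum.cong) (auto simp: paths_from_iff)
  finally show ?thesis .
qed

text \<open>
  The total mass in the law of the entrance point; in the limit it makes the weights sum to one.
\<close>

lemma total_weight_at_level:
  assumes n: "n \<in> N" and k: "k \<ge> 2"
  shows "(\<Sum>p\<in>paths_from B istar k. normalised_time n (take 2 p) * end_weight k p) = 1"
proof -
  interpret prob_space \<mu> by (rule prob)
  have "measure \<mu> {x \<in> space \<mu>. enter n x \<in> U n} =
    (\<Sum>p\<in>{p\<in>paths_from B istar k. True}. normalised_time n (take 2 p) * end_weight k p)"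
    using entrance_iterate_facts(2)[OF n] in_cyl_at_path
    by (intro entrance_law_at_level(2)[OF n k U_sets[OF n]]) auto
  moreover have "{x \<in> space \<mu>. enter n x \<in> U n} = space \<mu>"
    using entrance_iterate_facts(2)[OF n] by (auto simp: space_eq)
  ultimately show ?thesis using prob_space by simp
qed

text \<open>
  The difference of the \<open>k\<close>-th and the previous entrance time is a return time that is measured along the
  orbit of the first entrance point.  Its being small is an event \<open>W\<close> for that point, and on \<open>[I\<^sub>n p]\<close> it is
  decided by the pair of edges \<open>return_edges k p\<close>.
\<close>

lemma entrance_cdf_ge2:
  assumes n: "n \<in> N" and k: "k \<ge> 2"
  shows "F n k t =
    (\<Sum>p\<in>{p\<in>paths_from B istar (Suc k).
        r istar * normalised_time n (return_edges B N xs istar k p) \<le> t}.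
      normalised_time n (take 2 p) * end_weight (Suc k) p)"
proof -
  let ?E = "enter n"
  obtain k' where k': "k = Suc (Suc k')" using k by (metis Suc_le_D numeral_2_eq_2 Suc_le_mono)
  define W where "W = {z \<in> U n. measure \<mu> (U n) * time n ((?E ^^ k') z) \<le> t}"
  have scale: "measure \<mu> (U n) * real s = r istar * (real s / lam ^ (n - 1))" for s
    using measure_U[OF n] by simp
  have ret: "time n ((?E ^^ (j - 1)) z) = return_time n (return_edges B N xs istar j p)"
    if "j \<ge> 1" "p \<in> paths_from B istar (Suc j)" "z \<in> cyl_at B xs n p" for j p z
    using return_edges(1)[OF that(1,2)] return_edges(2)[OF that(1,2) n that(3)]
    by (rule time_on_edge_pair[OF n])
  have "W = (\<Union>p\<in>{p\<in>paths_from B istar k.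
      measure \<mu> (U n) * return_time n (return_edges B N xs istar (Suc k') p) \<le> t}. cyl_at B xs n p)"
    unfolding W_def using U_partition(1)[OF n, of k] ret[of "Suc k'"] cyl_at_subset_U k k' by auto
  then have "W \<in> sets \<mu>"
    using finite_paths_from[of k istar] cyl_at_sets[OF n, of k] k by auto
  have "F n k t = measure \<mu> {x \<in> space \<mu>. ?E x \<in> W}"
    unfolding entrance_cdf_def k' W_def
    using entrance_iterate_facts[OF n] entrance_iterate_facts(1)[OF n, of _ "Suc k'"]
    by (intro arg_cong[where f="measure \<mu>"]) (auto simp: space_eq funpow_swap1)
  also have "\<dots> = (\<Sum>p\<in>{p\<in>paths_from B istar (Suc k).
        r istar * normalised_time n (return_edges B N xs istar k p) \<le> t}.
      normalised_time n (take 2 p) * end_weight (Suc k) p)"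
  proof (rule entrance_law_at_level(2)[OF n])
    show "W \<in> sets \<mu>" "W \<subseteq> U n" by fact (auto simp: W_def)
    fix p z assume p: "p \<in> paths_from B istar (Suc k)" and z: "z \<in> cyl_at B xs n p"
    have "?E z \<in> W \<longleftrightarrow> measure \<mu> (U n) * time n ((?E ^^ (k - 1)) z) \<le> t"
      unfolding W_def k' using entrance_iterate_facts(2)[OF n in_cyl_at_path[OF z]]
      by (simp add: funpow_swap1)
    then show "?E z \<in> W \<longleftrightarrow> r istar * normalised_time n (return_edges B N xs istar k p) \<le> t"
      using ret[OF _ p z] k scale by simp
  qed (use k in simp)
  finally show ?thesis .
qed

end

section \<open>The limit laws\<close>

text \<open>
  Assembles the limit laws from one term for each path: a clipped ramp for \<open>k = 1\<close>, a step for
  \<open>k \<ge> 2\<close>.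
\<close>

lemma real_distribution_sum:
  fixes \<phi> :: "'b \<Rightarrow> real \<Rightarrow> real"
  assumes fin: "finite P"
    and mono: "\<And>p x y. p \<in> P \<Longrightarrow> x \<le> y \<Longrightarrow> \<phi> p x \<le> \<phi> p y"
    and cont: "\<And>p a. p \<in> P \<Longrightarrow> continuous (at_right a) (\<phi> p)"
    and bot: "\<And>p. p \<in> P \<Longrightarrow> (\<phi> p \<longlongrightarrow> 0) at_bot"
    and top: "\<And>p. p \<in> P \<Longrightarrow> (\<phi> p \<longlongrightarrow> w p) at_top" and total: "(\<Sum>p\<in>P. w p) = 1"
  defines "F \<equiv> \<lambda>t. \<Sum>p\<in>P. \<phi> p t"
  shows "real_distribution (interval_measure F)" and "cdf (interval_measure F) = F"
proof -
  have F: "F x \<le> F y" if "x \<le> y" for x y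
    unfolding F_def using mono that by (intro sum_mono)
  have c: "continuous (at_right a) F" for a
    unfolding F_def using cont by (intro continuous_sum)
  have "((\<lambda>t. \<Sum>p\<in>P. \<phi> p t) \<longlongrightarrow> (\<Sum>p\<in>P. 0)) at_bot"
    using bot by (intro tendsto_sum)
  then have b: "(F \<longlongrightarrow> 0) at_bot" by (simp add: F_def)
  have "((\<lambda>t. \<Sum>p\<in>P. \<phi> p t) \<longlongrightarrow> (\<Sum>p\<in>P. w p)) at_top"
    using top by (intro tendsto_sum)
  then have t: "(F \<longlongrightarrow> 1) at_top" by (simp add: F_def total)
  show "real_distribution (interval_measure F)"
    by (rule real_distribution_interval_measure[OF F c b t])
  show "cdf (interval_measure F) = F"
  proof (rule ext)
    fix x
    show "cdf (interval_measure F) x = F x"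
      unfolding cdf_def by (rule measure_interval_measure_Iic[of F]) (fact F c b t)+
  qed
qed

lemma clipped_ramp:
  fixes w c \<rho> :: real
  assumes "w \<ge> 0" "c \<ge> 0" "\<rho> > 0"
  defines "\<phi> \<equiv> \<lambda>t. w * max 0 (min c (t / \<rho>))"
  shows "x \<le> y \<Longrightarrow> \<phi> x \<le> \<phi> y" and "continuous (at_right a) \<phi>"
    and "(\<phi> \<longlongrightarrow> 0) at_bot" and "(\<phi> \<longlongrightarrow> c * w) at_top"
proof -
  show "\<phi> x \<le> \<phi> y" if "x \<le> y"
    unfolding \<phi>_def using that assms
    by (intro mult_left_mono max.mono min.mono divide_right_mono) auto
  have "continuous_on UNIV \<phi>"
    unfolding \<phi>_def using assms by (intro continuous_intros) auto
  then show "continuous (at_right a) \<phi>"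
    by (simp add: continuous_on_eq_continuous_at continuous_at_imp_continuous_at_within)
  have "\<forall>\<^sub>F t in at_bot. \<phi> t = 0"
    using eventually_le_at_bot[of 0]
  proof eventually_elim
    case (elim t)
    then have "min c (t / \<rho>) \<le> 0" using assms by (simp add: min.coboundedI2 divide_nonpos_pos)
    then show ?case by (simp add: \<phi>_def)
  qed
  then show "(\<phi> \<longlongrightarrow> 0) at_bot" by (rule tendsto_eventually)
  have "\<forall>\<^sub>F t in at_top. \<phi> t = c * w"
    using eventually_ge_at_top[of "c * \<rho>"]
  proof eventually_elim
    case (elim t)
    then have "min c (t / \<rho>) = c" using assms by (simp add: min_absorb1 pos_le_divide_eq)
    then show ?case using assms by (simp add: \<phi>_def)
  qed
  then show "(\<phi> \<longlongrightarrow> c * w) at_top" by (rule tendsto_eventually)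
qed

lemma unit_step:
  fixes w v :: real
  assumes "w \<ge> 0"
  defines "\<phi> \<equiv> \<lambda>t. if v \<le> t then w else 0"
  shows "x \<le> y \<Longrightarrow> \<phi> x \<le> \<phi> y" and "continuous (at_right a) \<phi>"
    and "(\<phi> \<longlongrightarrow> 0) at_bot" and "(\<phi> \<longlongrightarrow> w) at_top"
proof -
  show "\<phi> x \<le> \<phi> y" if "x \<le> y" using that assms by (auto simp: \<phi>_def)
  have "\<forall>\<^sub>F t in at_right a. \<phi> t = \<phi> a"
  proof (cases "v \<le> a")
    case True
    then have "\<phi> t = \<phi> a" if "a < t" for t using that by (simp add: \<phi>_def)
    then show ?thesis by (rule eventually_mono[OF eventually_at_right_less])
  next
    case False
    then have "\<forall>\<^sub>F t in at_right a. t < v"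
      by (intro order_tendstoD(2)[OF tendsto_ident_at]) simp
    moreover have "\<phi> t = \<phi> a" if "t < v" for t using that False by (simp add: \<phi>_def)
    ultimately show ?thesis by (rule eventually_mono)
  qed
  then show "continuous (at_right a) \<phi>"
    unfolding continuous_within by (rule tendsto_eventually)
  have "\<forall>\<^sub>F t in at_bot. \<phi> t = 0"
    using eventually_gt_at_bot[of v] by eventually_elim (simp add: \<phi>_def)
  then show "(\<phi> \<longlongrightarrow> 0) at_bot" by (rule tendsto_eventually)
  have "\<forall>\<^sub>F t in at_top. \<phi> t = w"
    using eventually_ge_at_top[of v] by eventually_elim (simp add: \<phi>_def)
  then show "(\<phi> \<longlongrightarrow> w) at_top" by (rule tendsto_eventually)
qed

lemma min_perturbation: "\<bar>min a b - min a' b'\<bar> \<le> \<bar>a - a'\<bar> + \<bar>b - b'\<bar>" for a b a' b' :: real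
  by (simp add: min_def abs_if)

lemma uniform_limit_bound:
  fixes f :: "'i \<Rightarrow> 'x \<Rightarrow> real"
  assumes "\<forall>\<^sub>F n in F. \<forall>x\<in>A. \<bar>f n x - g x\<bar> \<le> e n" and "(e \<longlongrightarrow> 0) F"
  shows "uniform_limit A f g F"
proof (rule uniform_limitI)
  fix \<epsilon> :: real assume "\<epsilon> > 0"
  then have "\<forall>\<^sub>F n in F. e n < \<epsilon>" using order_tendstoD(2)[OF assms(2)] by simp
  with assms(1) show "\<forall>\<^sub>F n in F. \<forall>x\<in>A. dist (f n x) (g x) < \<epsilon>"
    by eventually_elim (auto simp: dist_real_def)
qed

context entrance_law_setting
begin

abbreviation along_N :: "nat filter" where
  "along_N \<equiv> inf sequentially (principal N)"

lemma eventually_along_N: "(\<And>n. n \<in> N \<Longrightarrow> P n) \<Longrightarrow> \<forall>\<^sub>F n in along_N. P n"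
  by (simp add: eventually_inf_principal)

lemma along_N_neq_bot: "along_N \<noteq> bot"
proof
  assume "along_N = bot"
  then have "\<forall>\<^sub>F n in along_N. False" by simp
  then have "\<forall>\<^sub>F n in sequentially. n \<notin> N" by (simp add: eventually_inf_principal)
  then obtain n0 where "\<forall>n\<ge>n0. n \<notin> N" by (auto simp: eventually_sequentially)
  then have "N \<subseteq> {..n0}" by (auto simp: not_le intro: less_imp_le dest: leI)
  then show False using N_infinite finite_subset by auto
qed

lemma normalised_time_along_N: "((\<lambda>n. normalised_time n ef) \<longlongrightarrow> cbar ef) along_N"
  by (rule tendsto_mono[OF _ normalised_time_tendsto]) simp

text \<open>
  The equality of \<open>total_weight_at_level\<close> passes to the limit.
\<close>

lemma total_weight:
  assumes k: "k \<ge> 2"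
  shows "(\<Sum>p\<in>paths_from B istar k. cbar (take 2 p) * end_weight k p) = 1"
proof -
  have "((\<lambda>n. \<Sum>p\<in>paths_from B istar k. normalised_time n (take 2 p) * end_weight k p) \<longlongrightarrow>
      (\<Sum>p\<in>paths_from B istar k. cbar (take 2 p) * end_weight k p)) along_N"
    by (intro tendsto_sum tendsto_mult normalised_time_along_N tendsto_const)
  moreover have "((\<lambda>n. \<Sum>p\<in>paths_from B istar k. normalised_time n (take 2 p) * end_weight k p) \<longlongrightarrow> 1)
      along_N"
    using total_weight_at_level k by (intro tendsto_eventually eventually_along_N) auto
  ultimately show ?thesis using tendsto_unique[OF along_N_neq_bot] by blast
qed

lemma edge_pair_take: "ef \<in> edge_pairs B istar \<Longrightarrow> take 2 ef = ef"
  by (simp add: edge_pairs_eq paths_from_iff)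

definition limit_cdf :: "nat \<Rightarrow> real \<Rightarrow> real" where
  "limit_cdf k t =
     (if k = 1 then \<Sum>ef\<in>edge_pairs B istar. end_weight 2 ef * max 0 (min (cbar ef) (t / r istar))
      else \<Sum>p\<in>paths_from B istar (Suc k).
        if r istar * cbar (return_edges B N xs istar k p) \<le> t
        then cbar (take 2 p) * end_weight (Suc k) p else 0)"

lemma limit_cdf_distribution:
  assumes k: "k \<ge> 1"
  shows "real_distribution (interval_measure (limit_cdf k)) \<and>
    cdf (interval_measure (limit_cdf k)) = limit_cdf k"
proof (cases "k = 1")
  case True
  have pairs: "edge_pairs B istar = paths_from B istar 2" by (rule edge_pairs_eq)
  have w: "end_weight 2 ef \<ge> 0" if "ef \<in> edge_pairs B istar" for ef
    using end_weight_nonneg[of 2 ef] that by (simp add: pairs)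
  have total: "(\<Sum>ef\<in>edge_pairs B istar. cbar ef * end_weight 2 ef) = 1"
    using total_weight[of 2] edge_pair_take by (simp add: pairs)
  have "limit_cdf k = (\<lambda>t. \<Sum>ef\<in>edge_pairs B istar. end_weight 2 ef * max 0 (min (cbar ef) (t / r istar)))"
    using True by (simp add: limit_cdf_def fun_eq_iff)
  then show ?thesis
    using real_distribution_sum[of "edge_pairs B istar"
        "\<lambda>ef t. end_weight 2 ef * max 0 (min (cbar ef) (t / r istar))" "\<lambda>ef. cbar ef * end_weight 2 ef"]
      clipped_ramp[OF w cbar_nonneg r_pos[OF istar_in]] total finite_paths_from[of 2 istar]
    by (simp add: pairs)
next
  case False
  then have k2: "k \<ge> 2" using k by simp
  let ?P = "paths_from B istar (Suc k)"
  let ?w = "\<lambda>p. cbar (take 2 p) * end_weight (Suc k) p"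
  let ?\<phi> = "\<lambda>p t. if r istar * cbar (return_edges B N xs istar k p) \<le> t then ?w p else 0"
  have w: "?w p \<ge> 0" if "p \<in> ?P" for p
    using cbar_nonneg end_weight_nonneg[OF _ that] by simp
  have "limit_cdf k = (\<lambda>t. \<Sum>p\<in>?P. ?\<phi> p t)"
    using False by (simp add: limit_cdf_def fun_eq_iff)
  then show ?thesis
    using real_distribution_sum[of ?P ?\<phi> ?w] unit_step[OF w] total_weight[of "Suc k"]
      finite_paths_from[of "Suc k" istar] k2
    by simp
qed

text \<open>
  The error at level \<open>n\<close> is bounded independently of \<open>t\<close>: rounding \<open>t / \<mu> I\<^sub>n\<close> to an integer costs at most
  \<open>1 / lam ^ (n - 1)\<close> after normalisation, the rest is the error of the normalised return times.
\<close>

lemma uniform_limit_1: "uniform_limit {0..} (\<lambda>n. F n 1) (limit_cdf 1) along_N"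
proof (rule uniform_limit_bound)
  let ?e = "\<lambda>n. \<Sum>ef\<in>edge_pairs B istar.
    (\<bar>normalised_time n ef - cbar ef\<bar> + 1 / lam ^ (n - 1)) * end_weight 2 ef"
  show "\<forall>\<^sub>F n in along_N. \<forall>t\<in>{0..}. \<bar>F n 1 t - limit_cdf 1 t\<bar> \<le> ?e n"
  proof (intro eventually_along_N ballI)
    fix n t assume n: "n \<in> N" and "t \<in> {0::real..}"
    then have t: "t \<ge> 0" by simp
    define \<Lambda> where "\<Lambda> = lam ^ (n - 1)"
    have \<Lambda>: "\<Lambda> > 0" using lam_gt_1 by (simp add: \<Lambda>_def)
    have rs: "r istar > 0" by (rule r_pos[OF istar_in])
    define u where "u = t / measure \<mu> (U n)"
    have u: "u / \<Lambda> = t / r istar" 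
      unfolding u_def measure_U[OF n] \<Lambda>_def[symmetric] using \<Lambda> by simp
    have "u \<ge> 0" using t measure_U_pos[OF n] by (simp add: u_def)
    then have K: "\<bar>real (nat \<lfloor>u\<rfloor>) - u\<bar> \<le> 1" by linarith
    have "\<bar>real (nat \<lfloor>u\<rfloor>) / \<Lambda> - t / r istar\<bar> = \<bar>real (nat \<lfloor>u\<rfloor>) - u\<bar> / \<Lambda>"
      using \<Lambda> u[symmetric] by (simp flip: diff_divide_distrib)
    also have "\<dots> \<le> 1 / \<Lambda>" using K \<Lambda> by (intro divide_right_mono) auto
    finally have floor: "\<bar>real (nat \<lfloor>u\<rfloor>) / \<Lambda> - t / r istar\<bar> \<le> 1 / \<Lambda>" .
    have "\<bar>F n 1 t - limit_cdf 1 t\<bar> =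
        \<bar>\<Sum>ef\<in>edge_pairs B istar. (min (normalised_time n ef) (real (nat \<lfloor>u\<rfloor>) / \<Lambda>) -
          min (cbar ef) (t / r istar)) * end_weight 2 ef\<bar>"
    proof -
      have "max 0 (min (cbar ef) (t / r istar)) = min (cbar ef) (t / r istar)" for ef
        using t rs cbar_nonneg by simp
      then have "limit_cdf 1 t = (\<Sum>ef\<in>edge_pairs B istar. min (cbar ef) (t / r istar) * end_weight 2 ef)"
        by (simp add: limit_cdf_def mult.commute)
      moreover have "F n 1 t = (\<Sum>ef\<in>edge_pairs B istar.
          min (normalised_time n ef) (real (nat \<lfloor>u\<rfloor>) / \<Lambda>) * end_weight 2 ef)"
        unfolding u_def \<Lambda>_def by (rule entrance_cdf_1[OF n t])
      ultimately show ?thesis by (simp only: left_diff_distrib sum_subtractf)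
    qed
    also have "\<dots> \<le> (\<Sum>ef\<in>edge_pairs B istar. \<bar>(min (normalised_time n ef) (real (nat \<lfloor>u\<rfloor>) / \<Lambda>) -
          min (cbar ef) (t / r istar)) * end_weight 2 ef\<bar>)"
      by (rule sum_abs)
    also have "\<dots> \<le> ?e n"
    proof (rule sum_mono)
      fix ef assume "ef \<in> edge_pairs B istar"
      then have w: "end_weight 2 ef \<ge> 0" using end_weight_nonneg[of 2 ef] by (simp add: edge_pairs_eq)
      have "\<bar>min (normalised_time n ef) (real (nat \<lfloor>u\<rfloor>) / \<Lambda>) - min (cbar ef) (t / r istar)\<bar> \<le>
          \<bar>normalised_time n ef - cbar ef\<bar> + 1 / lam ^ (n - 1)"
        using min_perturbation[of "normalised_time n ef" "real (nat \<lfloor>u\<rfloor>) / \<Lambda>" "cbar ef" "t / r istar"]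
          floor by (simp add: \<Lambda>_def)
      then show "\<bar>(min (normalised_time n ef) (real (nat \<lfloor>u\<rfloor>) / \<Lambda>) - min (cbar ef) (t / r istar)) *
          end_weight 2 ef\<bar> \<le> (\<bar>normalised_time n ef - cbar ef\<bar> + 1 / lam ^ (n - 1)) * end_weight 2 ef"
        unfolding abs_mult abs_of_nonneg[OF w] by (rule mult_right_mono[OF _ w])
    qed
    finally show "\<bar>F n 1 t - limit_cdf 1 t\<bar> \<le> ?e n" .
  qed
  have "(\<lambda>n. 1 / lam ^ (Suc n - 1)) \<longlonglongrightarrow> 0"
    using LIMSEQ_divide_realpow_zero[OF lam_gt_1, of 1] by simp
  then have "(\<lambda>n. 1 / lam ^ (n - 1)) \<longlonglongrightarrow> 0" by (rule LIMSEQ_imp_Suc)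
  then have "((\<lambda>n. 1 / lam ^ (n - 1)) \<longlongrightarrow> 0) along_N" by (rule tendsto_mono[rotated]) simp
  moreover have "((\<lambda>n. \<bar>normalised_time n ef - cbar ef\<bar>) \<longlongrightarrow> 0) along_N" for ef
    using tendsto_diff[OF normalised_time_along_N[of ef] tendsto_const[of "cbar ef"]]
    by (intro tendsto_rabs_zero) simp
  ultimately have "(?e \<longlongrightarrow> (\<Sum>ef\<in>edge_pairs B istar. (0 + 0) * end_weight 2 ef)) along_N"
    by (intro tendsto_sum tendsto_mult tendsto_add tendsto_const)
  then show "(?e \<longlongrightarrow> 0) along_N" by simp
qed

text \<open>
  The finitely many limits of normalised return times have positive distance from the closed set \<open>A\<close>.  Once the
  normalised return times are closer to them than that, replacing them by their limits does not change on
  which side of a \<open>t \<in> A\<close> they lie, and only the weights still vary.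
\<close>

lemma uniform_limit_ge2:
  assumes k: "k \<ge> 2" and A: "closed A"
    and away: "\<And>p. p \<in> paths_from B istar (Suc k) \<Longrightarrow>
      r istar * cbar (return_edges B N xs istar k p) \<notin> A"
  shows "uniform_limit A (\<lambda>n. F n k) (limit_cdf k) along_N"
proof (rule uniform_limit_bound)
  let ?P = "paths_from B istar (Suc k)"
  let ?R = "return_edges B N xs istar k"
  let ?e = "\<lambda>n. \<Sum>p\<in>?P. \<bar>normalised_time n (take 2 p) - cbar (take 2 p)\<bar> * end_weight (Suc k) p"
  have fin: "finite ?P" by (rule finite_paths_from) simp
  have "\<forall>\<^sub>F n in along_N. \<forall>p\<in>?P. \<forall>t\<in>A. r istar * normalised_time n (?R p) \<le> t \<longleftrightarrow> r istar * cbar (?R p) \<le> t"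
  proof (rule eventually_ball_finite[OF fin], rule ballI)
    fix p assume "p \<in> ?P"
    then have "r istar * cbar (?R p) \<in> - A" using away by simp
    moreover have "open (- A)" using A by (rule open_Compl)
    ultimately obtain \<epsilon> where \<epsilon>: "\<epsilon> > 0" "ball (r istar * cbar (?R p)) \<epsilon> \<subseteq> - A"
      by (meson open_contains_ball)
    have "((\<lambda>n. r istar * normalised_time n (?R p)) \<longlongrightarrow> r istar * cbar (?R p)) along_N"
      by (intro tendsto_mult tendsto_const normalised_time_along_N)
    then have "\<forall>\<^sub>F n in along_N. dist (r istar * normalised_time n (?R p)) (r istar * cbar (?R p)) < \<epsilon>"
      using \<epsilon>(1) by (rule tendstoD)
    then show "\<forall>\<^sub>F n in along_N. \<forall>t\<in>A. r istar * normalised_time n (?R p) \<le> t \<longleftrightarrow> r istar * cbar (?R p) \<le> t"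
    proof eventually_elim
      case (elim n)
      show ?case
      proof
        fix t assume "t \<in> A"
        then have "t \<notin> ball (r istar * cbar (?R p)) \<epsilon>" using \<epsilon>(2) by auto
        then show "r istar * normalised_time n (?R p) \<le> t \<longleftrightarrow> r istar * cbar (?R p) \<le> t"
          using elim by (auto simp: dist_real_def abs_if split: if_splits)
      qed
    qed
  qed
  moreover have "\<forall>\<^sub>F n in along_N. n \<in> N" by (rule eventually_along_N)
  ultimately show "\<forall>\<^sub>F n in along_N. \<forall>t\<in>A. \<bar>F n k t - limit_cdf k t\<bar> \<le> ?e n"
  proof eventually_elim
    case (elim n)
    show ?case
    proof
      fix t assume t: "t \<in> A"
      let ?H = "{p\<in>?P. r istar * cbar (?R p) \<le> t}"
      have "{p\<in>?P. r istar * normalised_time n (?R p) \<le> t} = ?H" using elim(1) t by blast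
      then have "F n k t =
          (\<Sum>p\<in>?H. normalised_time n (take 2 p) * end_weight (Suc k) p)"
        using entrance_cdf_ge2[OF elim(2) k, of t] by simp
      moreover have "limit_cdf k t = (\<Sum>p\<in>?H. cbar (take 2 p) * end_weight (Suc k) p)"
        using k fin by (simp add: limit_cdf_def sum.inter_filter)
      ultimately have "\<bar>F n k t - limit_cdf k t\<bar> =
          \<bar>\<Sum>p\<in>?H. (normalised_time n (take 2 p) - cbar (take 2 p)) * end_weight (Suc k) p\<bar>"
        by (simp add: left_diff_distrib sum_subtractf)
      also have "\<dots> \<le> (\<Sum>p\<in>?H. \<bar>(normalised_time n (take 2 p) - cbar (take 2 p)) * end_weight (Suc k) p\<bar>)"
        by (rule sum_abs)
      also have "\<dots> = (\<Sum>p\<in>?H. \<bar>normalised_time n (take 2 p) - cbar (take 2 p)\<bar> * end_weight (Suc k) p)"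
        using end_weight_nonneg[of "Suc k"] by (intro sum.cong) (auto simp: abs_mult)
      also have "\<dots> \<le> ?e n"
        using end_weight_nonneg[of "Suc k"] fin by (intro sum_mono2) auto
      finally show "\<bar>F n k t - limit_cdf k t\<bar> \<le> ?e n" .
    qed
  qed
  have "((\<lambda>n. \<bar>normalised_time n ef - cbar ef\<bar>) \<longlongrightarrow> 0) along_N" for ef
    using tendsto_diff[OF normalised_time_along_N[of ef] tendsto_const[of "cbar ef"]]
    by (intro tendsto_rabs_zero) simp
  then have "(?e \<longlongrightarrow> (\<Sum>p\<in>?P. 0 * end_weight (Suc k) p)) along_N"
    by (intro tendsto_sum tendsto_mult tendsto_const)
  then show "(?e \<longlongrightarrow> 0) along_N" by simp
qed

end

section \<open>The break points\<close>

lemma nth_value_properties: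
  assumes "finite V"
  shows "v \<in> V \<Longrightarrow> \<exists>i\<in>{1..card V}. v = nth_value V i"
    and "i \<in> {1..card V} \<Longrightarrow> nth_value V i \<in> V"
    and "1 \<le> i \<Longrightarrow> i < j \<Longrightarrow> j \<le> card V \<Longrightarrow> nth_value V i < nth_value V j"
proof -
  let ?l = "sorted_list_of_set V"
  have len: "length ?l = card V" and set: "set ?l = V" using assms by auto
  show "\<exists>i\<in>{1..card V}. v = nth_value V i" if "v \<in> V"
  proof -
    have "v \<in> set ?l" using that set by simp
    then obtain i where "i < card V" "v = ?l ! i" unfolding in_set_conv_nth len by blast
    then show ?thesis by (intro bexI[of _ "Suc i"]) (auto simp: nth_value_def)
  qed
  show "nth_value V i \<in> V" if "i \<in> {1..card V}"
  proof -
    have "i - 1 < length ?l" using that unfolding len by auto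
    from nth_mem[OF this] show ?thesis unfolding set nth_value_def .
  qed
  show "nth_value V i < nth_value V j" if "1 \<le> i" "i < j" "j \<le> card V"
  proof -
    have "i - 1 < j - 1" "j - 1 < length ?l" using that unfolding len by auto
    then show ?thesis
      unfolding nth_value_def by (rule sorted_wrt_nth_less[OF strict_sorted_list_of_set])
  qed
qed

text \<open>
  Between consecutive break points \<open>d j\<close> and \<open>d (j + 1)\<close>, exactly the first \<open>j\<close> values, scaled by
  \<open>rho\<close>, are at most \<open>t\<close>; this translates the index \<open>j\<close> into a condition on \<open>t\<close>.
\<close>

lemma breakpoint_comparison:
  fixes V :: "real set" and rho t :: real
  assumes V: "finite V" and rho: "rho > 0" and j: "j \<le> card V" and i: "i \<in> {1..card V}"
  defines "c \<equiv> nth_value V"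
  assumes t: "breakpoint (card V) c rho j \<le> ereal t" "ereal t < breakpoint (card V) c rho (j + 1)"
  shows "c i * rho \<le> t \<longleftrightarrow> i \<le> j"
    and "j = 0 \<or> breakpoint (card V) c rho j < ereal t \<Longrightarrow> c i * rho \<noteq> t"
proof -
  have mono: "c a \<le> c b" if "1 \<le> a" "a \<le> b" "b \<le> card V" for a b
    using nth_value_properties(3)[OF V, of a b] that by (cases "a = b") (auto simp: c_def)
  have low: "c i * rho \<le> c j * rho" "breakpoint (card V) c rho j = ereal (c j * rho)" if "i \<le> j"
    using that i j rho mono[of i j] by (auto simp: breakpoint_def)
  have high: "t < c i * rho" if "j < i"
  proof -
    have "t < c (j + 1) * rho" using t(2) that i by (auto simp: breakpoint_def split: if_splits)
    also have "\<dots> \<le> c i * rho" using mono[of "j + 1" i] that i rho by simp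
    finally show ?thesis .
  qed
  show "c i * rho \<le> t \<longleftrightarrow> i \<le> j"
  proof (cases "i \<le> j")
    case True
    then show ?thesis using low t(1) by simp
  next
    case False
    then show ?thesis using high by simp
  qed
  show "c i * rho \<noteq> t" if strict: "j = 0 \<or> breakpoint (card V) c rho j < ereal t"
  proof (cases "i \<le> j")
    case True
    then have "breakpoint (card V) c rho j < ereal t" using strict i by auto
    then show ?thesis using low[OF True] by simp
  next
    case False
    then show ?thesis using high by simp
  qed
qed

theorem theorem2p4:
  fixes B :: "(nat, 'e) bratteli" and m :: nat
    and lam :: real and r l :: "nat \<Rightarrow> real"
    and \<mu> :: "(nat \<Rightarrow> 'e) measure"
    and xs :: "nat \<Rightarrow> 'e" and istar :: nat and N :: "nat set"
    and I :: "nat \<Rightarrow> (nat \<Rightarrow> 'e) set" and F :: "nat \<Rightarrow> nat \<Rightarrow> real \<Rightarrow> real"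
    and cbar :: "'e list \<Rightarrow> real" and L :: nat and c :: "nat \<Rightarrow> real"
    and S :: "nat \<Rightarrow> 'e list set" and d :: "nat \<Rightarrow> ereal"
  assumes "stationary_bratteli B m"
    and "perron_data m (incidence B 2) lam r l"
    and "invariant_prob (path_topology B) (vershik B) \<mu>"
    and "\<And>n p. n \<ge> 1 \<Longrightarrow> p \<in> paths B 1 n \<Longrightarrow>
           measure \<mu> (cylinder B p) = r (tgt B n (last p)) / lam ^ (n - 1)"
    and "xs \<in> path_space B"
    and "istar \<in> {1..m}"
    and "infinite N" and "\<And>n. n \<in> N \<Longrightarrow> n \<ge> 1 \<and> tgt B n (xs n) = istar"
    and I_def: "\<And>n. I n = cyl_at B xs n []"
    and F_def: "\<And>n. F n = entrance_cdf (vershik B) \<mu> (I n)"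
    and cbar_def: "\<And>ef. cbar ef = weighted_count B m l N xs ef"
    and L_def: "L = card (cbar ` edge_pairs B istar)"
    and c_def: "\<And>i. c i = nth_value (cbar ` edge_pairs B istar) i"
    and S_def: "\<And>i. S i = {ef \<in> edge_pairs B istar. cbar ef = c i}"
    and d_def: "\<And>i. d i = breakpoint L c (r istar) i"
  shows "\<exists>Law :: nat \<Rightarrow> real measure.
    (\<forall>k\<ge>1. real_distribution (Law k)) \<and>
    (\<forall>j\<le>L. \<forall>t::real. d j \<le> ereal t \<and> ereal t < d (j + 1) \<longrightarrow>
       cdf (Law 1) t =
         (\<Sum>ef\<in>(\<Union>i\<in>{1..j}. S i). cbar ef * (r (tgt B 3 (last ef)) / lam ^ 2)) +
         t / r istar * (\<Sum>ef\<in>(\<Union>i\<in>{j+1..L}. S i). r (tgt B 3 (last ef)) / lam ^ 2) \<and>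
       ((\<lambda>n. F n 1 t) \<longlongrightarrow> cdf (Law 1) t) (inf sequentially (principal N)) \<and>
       (\<forall>k\<ge>2.
         cdf (Law k) t =
           (\<Sum>p\<in>{p \<in> paths B 2 (k + 2). src B 2 (hd p) = istar \<and>
                     return_edges B N xs istar k p \<in> (\<Union>i\<in>{1..j}. S i)}.
              cbar (take 2 p) * (r (tgt B (k + 2) (last p)) / lam ^ (k + 1))) \<and>
         (j = 0 \<or> d j < ereal t \<longrightarrow>
           ((\<lambda>n. F n k t) \<longlongrightarrow> cdf (Law k) t) (inf sequentially (principal N))))) \<and>
    (\<forall>k\<ge>1. \<forall>j\<le>L. \<forall>J::real set.
       closed J \<and> is_interval J \<and> (\<forall>t\<in>J. d j < ereal t \<and> ereal t < d (j + 1)) \<longrightarrow>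
       uniform_limit J (\<lambda>n. F n k) (cdf (Law k)) (inf sequentially (principal N)))"
proof -
  interpret stationary_bratteli B m by (rule assms(1))
  interpret entrance_law_setting B m xs istar N lam r l \<mu>
  proof unfold_locales
    show "N \<noteq> {}" using assms(7) by auto
  qed (use assms(2-8) in auto)
  have cbar: "cbar = weighted_count B m l N xs" using cbar_def by blast
  have F: "F n = entrance_cdf (vershik B) \<mu> (cyl_at B xs n [])" for n using F_def I_def by simp
  define V where "V = cbar ` edge_pairs B istar"
  have V: "finite V" unfolding V_def edge_pairs_eq by (intro finite_imageI finite_paths_from) simp
  have L: "L = card V" using L_def by (simp add: V_def)
  have c: "c = nth_value V" using c_def by (auto simp: V_def)
  have d: "d = breakpoint (card V) (nth_value V) (r istar)"
    using d_def L c by auto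
  have rs: "r istar > 0" by (rule r_pos[OF istar_in])
  have rank: "\<exists>i\<in>{1..L}. cbar ef = c i" if "ef \<in> edge_pairs B istar" for ef
    using nth_value_properties(1)[OF V, of "cbar ef"] that by (auto simp: V_def L c)
  have le_iff: "c i * r istar \<le> t \<longleftrightarrow> i \<le> j"
    if "j \<le> L" "d j \<le> ereal t" "ereal t < d (j + 1)" "i \<in> {1..L}" for i j t
    using breakpoint_comparison(1)[OF V rs, of j i t] that by (simp add: L d c)
  have ne: "c i * r istar \<noteq> t"
    if "j \<le> L" "d j \<le> ereal t" "ereal t < d (j + 1)" "i \<in> {1..L}" "j = 0 \<or> d j < ereal t" for i j t
    using breakpoint_comparison(2)[OF V rs, of j i t] that by (simp add: L d c)
  \<comment> \<open>The index \<open>j\<close> of the interval that contains \<open>t\<close> splits the edge pairs by comparing their limits of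
    normalised return times with \<open>t\<close>, which is how \<open>limit_cdf\<close> splits them.\<close>
  have low: "ef \<in> (\<Union>i\<in>{1..j}. S i) \<longleftrightarrow> ef \<in> edge_pairs B istar \<and> cbar ef * r istar \<le> t"
    and high: "ef \<in> (\<Union>i\<in>{j+1..L}. S i) \<longleftrightarrow> ef \<in> edge_pairs B istar \<and> \<not> cbar ef * r istar \<le> t"
    if j: "j \<le> L" "d j \<le> ereal t" "ereal t < d (j + 1)" for j t ef
  proof -
    show "ef \<in> (\<Union>i\<in>{1..j}. S i) \<longleftrightarrow> ef \<in> edge_pairs B istar \<and> cbar ef * r istar \<le> t"
    proof
      assume "ef \<in> (\<Union>i\<in>{1..j}. S i)"
      then obtain i where "i \<in> {1..j}" "ef \<in> edge_pairs B istar" "cbar ef = c i"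
        by (auto simp: S_def)
      then show "ef \<in> edge_pairs B istar \<and> cbar ef * r istar \<le> t" using le_iff[OF j, of i] j(1) by simp
    next
      assume *: "ef \<in> edge_pairs B istar \<and> cbar ef * r istar \<le> t"
      then obtain i where "i \<in> {1..L}" "cbar ef = c i" using rank by blast
      then show "ef \<in> (\<Union>i\<in>{1..j}. S i)" using le_iff[OF j, of i] * by (auto simp: S_def)
    qed
    show "ef \<in> (\<Union>i\<in>{j+1..L}. S i) \<longleftrightarrow> ef \<in> edge_pairs B istar \<and> \<not> cbar ef * r istar \<le> t"
    proof
      assume "ef \<in> (\<Union>i\<in>{j+1..L}. S i)"
      then obtain i where "i \<in> {j+1..L}" "ef \<in> edge_pairs B istar" "cbar ef = c i"
        by (auto simp: S_def)
      then show "ef \<in> edge_pairs B istar \<and> \<not> cbar ef * r istar \<le> t" using le_iff[OF j, of i] by simp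
    next
      assume *: "ef \<in> edge_pairs B istar \<and> \<not> cbar ef * r istar \<le> t"
      then obtain i where "i \<in> {1..L}" "cbar ef = c i" using rank by blast
      then show "ef \<in> (\<Union>i\<in>{j+1..L}. S i)" using le_iff[OF j, of i] * by (auto simp: S_def)
    qed
  qed
  have d_nonneg: "t \<ge> 0" if j: "j \<le> L" "d j \<le> ereal t" for j t
  proof (cases "j = 0")
    case True
    then show ?thesis using that by (simp add: d breakpoint_def)
  next
    case False
    then have "c j \<in> V" using nth_value_properties(2)[OF V, of j] j(1) by (simp add: L c)
    then have "c j \<ge> 0" using cbar_nonneg by (auto simp: V_def cbar)
    moreover have "c j * r istar \<le> t" using False j by (simp add: d breakpoint_def L c)
    ultimately show ?thesis using rs by (meson mult_nonneg_nonneg less_imp_le order_trans)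
  qed
  define Law where "Law k = interval_measure (limit_cdf k)" for k
  have Law: "real_distribution (Law k)" "cdf (Law k) = limit_cdf k" if "k \<ge> 1" for k
    using limit_cdf_distribution[OF that] by (auto simp: Law_def)
  have weight2: "end_weight 2 ef = r (tgt B 3 (last ef)) / lam ^ 2" for ef
    by (simp add: end_weight_def numeral_3_eq_3)
  have value_1: "limit_cdf 1 t =
      (\<Sum>ef\<in>(\<Union>i\<in>{1..j}. S i). cbar ef * (r (tgt B 3 (last ef)) / lam ^ 2)) +
      t / r istar * (\<Sum>ef\<in>(\<Union>i\<in>{j+1..L}. S i). r (tgt B 3 (last ef)) / lam ^ 2)"
    if j: "j \<le> L" "d j \<le> ereal t" "ereal t < d (j + 1)" for j t
  proof -
    let ?E = "edge_pairs B istar"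
    have fin: "finite ?E" unfolding edge_pairs_eq by (intro finite_paths_from) simp
    have low_set: "?E \<inter> {ef. cbar ef * r istar \<le> t} = (\<Union>i\<in>{1..j}. S i)"
      using low[OF j] by blast
    have high_set: "?E \<inter> - {ef. cbar ef * r istar \<le> t} = (\<Union>i\<in>{j+1..L}. S i)"
      using high[OF j] by blast
    have "max 0 (min (cbar ef) (t / r istar)) = (if cbar ef * r istar \<le> t then cbar ef else t / r istar)" for ef
      using d_nonneg[OF j(1,2)] rs cbar_nonneg[of ef] by (auto simp: cbar min_def pos_le_divide_eq)
    then have "limit_cdf 1 t = (\<Sum>ef\<in>?E. if cbar ef * r istar \<le> t
        then cbar ef * end_weight 2 ef else t / r istar * end_weight 2 ef)"
      unfolding limit_cdf_def by (auto simp: cbar intro!: sum.cong)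
    also have "\<dots> = (\<Sum>ef\<in>?E \<inter> {ef. cbar ef * r istar \<le> t}. cbar ef * end_weight 2 ef) +
        (\<Sum>ef\<in>?E \<inter> - {ef. cbar ef * r istar \<le> t}. t / r istar * end_weight 2 ef)"
      using fin by (rule sum.If_cases)
    finally show ?thesis
      unfolding low_set high_set by (simp only: weight2 sum_distrib_left)
  qed
  have value_k: "limit_cdf k t =
      (\<Sum>p\<in>{p \<in> paths B 2 (k + 2). src B 2 (hd p) = istar \<and>
          return_edges B N xs istar k p \<in> (\<Union>i\<in>{1..j}. S i)}.
        cbar (take 2 p) * (r (tgt B (k + 2) (last p)) / lam ^ (k + 1)))"
    if j: "j \<le> L" "d j \<le> ereal t" "ereal t < d (j + 1)" and k: "k \<ge> 2" for j t k
  proof -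
    have P: "p \<in> paths_from B istar (Suc k) \<longleftrightarrow> p \<in> paths B 2 (k + 2) \<and> src B 2 (hd p) = istar" for p
      by (simp add: paths_from_def)
    have pairs: "return_edges B N xs istar k p \<in> edge_pairs B istar" if "p \<in> paths_from B istar (Suc k)" for p
      using return_edges(1)[OF _ that] k by simp
    have "{p \<in> paths_from B istar (Suc k). r istar * cbar (return_edges B N xs istar k p) \<le> t} =
        {p \<in> paths B 2 (k + 2). src B 2 (hd p) = istar \<and>
          return_edges B N xs istar k p \<in> (\<Union>i\<in>{1..j}. S i)}"
      using low[OF j] pairs P by (auto simp: mult.commute[of "r istar"])
    moreover have "limit_cdf k t = (\<Sum>p\<in>{p \<in> paths_from B istar (Suc k).
        r istar * cbar (return_edges B N xs istar k p) \<le> t}. cbar (take 2 p) * end_weight (Suc k) p)"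
      using k finite_paths_from[of "Suc k" istar] by (simp add: limit_cdf_def cbar sum.inter_filter)
    ultimately show ?thesis by (simp add: end_weight_def)
  qed
  have uniform: "uniform_limit A (\<lambda>n. F n k) (cdf (Law k)) (inf sequentially (principal N))"
    if k: "k \<ge> 1" and j: "j \<le> L" and A: "closed A"
      and t: "\<And>t. t \<in> A \<Longrightarrow> d j \<le> ereal t \<and> ereal t < d (j + 1) \<and> (k = 1 \<or> j = 0 \<or> d j < ereal t)" for k j A
  proof (cases "k = 1")
    case True
    have "A \<subseteq> {0..}" using d_nonneg[OF j] t by auto
    then show ?thesis
      using uniform_limit_on_subset[OF uniform_limit_1] Law(2)[of 1] True by (simp add: F)
  next
    case False
    have "r istar * cbar (return_edges B N xs istar k p) \<notin> A" if p: "p \<in> paths_from B istar (Suc k)" for p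
    proof
      let ?t = "r istar * cbar (return_edges B N xs istar k p)"
      assume "?t \<in> A"
      then have *: "d j \<le> ereal ?t" "ereal ?t < d (j + 1)" "j = 0 \<or> d j < ereal ?t"
        using t False by auto
      obtain i where "i \<in> {1..L}" "cbar (return_edges B N xs istar k p) = c i"
        using rank return_edges(1)[OF k p] by blast
      then show False using ne[OF j *(1,2) _ *(3), of i] by (simp add: mult.commute)
    qed
    then have "uniform_limit A (\<lambda>n. entrance_cdf (vershik B) \<mu> (cyl_at B xs n []) k) (limit_cdf k)
        (inf sequentially (principal N))"
      using k False A by (intro uniform_limit_ge2) (auto simp: cbar)
    then show ?thesis using Law(2)[OF k] by (simp add: F)
  qed
  have pointwise: "((\<lambda>n. F n k t) \<longlongrightarrow> cdf (Law k) t) (inf sequentially (principal N))"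
    if "k \<ge> 1" "j \<le> L" "d j \<le> ereal t" "ereal t < d (j + 1)" "k = 1 \<or> j = 0 \<or> d j < ereal t" for k j t
    using tendsto_uniform_limitI[OF uniform[of k j "{t}"], of t] that by auto
  show ?thesis
  proof (intro exI[of _ Law] conjI allI impI)
    show "real_distribution (Law k)" if "1 \<le> k" for k using Law(1) that .
    fix j t assume j: "j \<le> L" and t: "d j \<le> ereal t \<and> ereal t < d (j + 1)"
    show "cdf (Law 1) t =
         (\<Sum>ef\<in>(\<Union>i\<in>{1..j}. S i). cbar ef * (r (tgt B 3 (last ef)) / lam ^ 2)) +
         t / r istar * (\<Sum>ef\<in>(\<Union>i\<in>{j+1..L}. S i). r (tgt B 3 (last ef)) / lam ^ 2)"
      unfolding Law(2)[OF order_refl] using value_1 j t by blast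
    show "((\<lambda>n. F n 1 t) \<longlongrightarrow> cdf (Law 1) t) (inf sequentially (principal N))"
      using pointwise[of 1 j t] j t by blast
    fix k :: nat assume k: "2 \<le> k"
    then have k1: "k \<ge> 1" by simp
    show "cdf (Law k) t =
           (\<Sum>p\<in>{p \<in> paths B 2 (k + 2). src B 2 (hd p) = istar \<and>
                     return_edges B N xs istar k p \<in> (\<Union>i\<in>{1..j}. S i)}.
              cbar (take 2 p) * (r (tgt B (k + 2) (last p)) / lam ^ (k + 1)))"
      unfolding Law(2)[OF k1] using value_k j t k by blast
    show "((\<lambda>n. F n k t) \<longlongrightarrow> cdf (Law k) t) (inf sequentially (principal N))"
      if "j = 0 \<or> d j < ereal t"
      using pointwise[of k j t] k1 j t that by blast
  next
    fix k j :: nat and A :: "real set"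
    assume k: "1 \<le> k" and j: "j \<le> L"
      and A: "closed A \<and> is_interval A \<and> (\<forall>t\<in>A. d j < ereal t \<and> ereal t < d (j + 1))"
    then show "uniform_limit A (\<lambda>n. F n k) (cdf (Law k)) (inf sequentially (principal N))"
      by (intro uniform[OF k j]) (auto intro: less_imp_le)
  qed
qed

end
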